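(* The ergodic mean $m:\mathcal E(\mathbb R,X)\to X$ can be extended uniquely to a map $\widetilde m:\mathcal D'_{\mathcal E}(\mathbb R,X)\to X$ which is linear and $(\mathcal D_{L^1})'$-continuous. This $\widetilde m$ is translation-invariant and satisfies $$m(T*\varphi)=\widetilde m(T)\cdot\int_{\mathbb R}\varphi(x)\,dx,\qquad T\in\mathcal D'_{\mathcal E}(\mathbb R,X),\ \varphi\in\mathcal D(\mathbb R,\mathbb C).$$ Furthermore, for $S\in\mathcal D'_{\mathcal E}(\mathbb R,X)$, $\widetilde M_T(S)\to\widetilde m(S)$ (constant function) as $T\to\infty$ in the $(\mathcal D_{L^1})'$-topology restricted to $\mathcal D(\mathbb R,\mathbb C)$.
   Context: $X$ is a complex Banach space. $\mathcal D(\mathbb R,\mathbb C)$: Schwartz test functions; $\mathcal D'(\mathbb R,X)$: linear continuous maps $\mathcal D(\mathbb R,\mathbb C)\to X$; locally Bochner integrable functions are identified with the distributions they define. Translates: $T_a(\varphi)=T(\varphi_{-a})$, $\varphi_a(t)=\varphi(t+a)$. $\mathcal E(\mathbb R,X)$: all $\phi\in L^1_{loc}(\mathbb R,X)$ for which there is a (unique) $m(\phi)\in X$ with $\sup_{x\in\mathbb R}\left\|\frac1T\int_0^T\phi(x+s)\,ds-m(\phi)\right\|\to0$ as $T\to\infty$; $m(\phi)$ is the ergodic mean. $\mathcal D'_{\mathcal E}(\mathbb R,X)=\{T\in\mathcal D'(\mathbb R,X):T*\varphi\in\mathcal E(\mathbb R,X)\ \forall\varphi\in\mathcal D(\mathbb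 R,\mathbb C)\}$, where $(T*\varphi)(x)=T(y\mapsto\varphi(x-y))$; it contains $\mathcal E(\mathbb R,X)$. $(\mathcal D_{L^1})'$-topology: given by the seminorms $\|T\|_U=\sup_{\varphi\in U}\|T(\varphi)\|$ with $U\subset\mathcal D(\mathbb R,\mathbb C)$ bounded in $\mathcal D_{L^1}$, i.e. $\sup_{\varphi\in U}\|\varphi^{(j)}\|_{L^1}<\infty$ for each $j\in\mathbb N_0$; these are finite on $\mathcal D'_{\mathcal E}(\mathbb R,X)$, whose elements extend uniquely to continuous linear maps on $\mathcal D_{L^1}(\mathbb R,\mathbb C)=\{\varphi\in C^\infty:\varphi^{(j)}\in L^1\ \forall j\ge0\}$. For $h>0$, $\widetilde M_hS(\varphi)=S(M_{-h}\varphi)$ with $M_{-h}\varphi(t)=\frac1h\int_0^h\varphi(t-s)\,ds$. In the last assertion $\widetilde m(S)$ stands for the distribution $\varphi\mapsto\widetilde m(S)\int\varphi\,dx$ given by the constant function. *)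

theory Defs
  imports "HOL-Analysis.Analysis"
begin

section \<open>Complex Banach spaces\<close>

class complex_banach = banach +
  fixes scaleC :: "complex \<Rightarrow> 'a \<Rightarrow> 'a"  (infixr \<open>*\<^sub>C\<close> 75)
  assumes scaleC_add_right: "c *\<^sub>C (x + y) = c *\<^sub>C x + c *\<^sub>C y"
    and scaleC_add_left: "(c + d) *\<^sub>C x = c *\<^sub>C x + d *\<^sub>C x"
    and scaleC_scaleC: "c *\<^sub>C (d *\<^sub>C x) = (c * d) *\<^sub>C x"
    and scaleC_of_real: "complex_of_real r *\<^sub>C x = r *\<^sub>R x"
    and norm_scaleC: "norm (c *\<^sub>C x) = cmod c * norm x"

instantiation complex :: complex_banach
begin

definition scaleC_complex :: "complex \<Rightarrow> complex \<Rightarrow> complex"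
  where "scaleC_complex c x = c * x"

instance
  by standard (simp_all add: scaleC_complex_def algebra_simps scaleR_conv_of_real norm_mult)

end


section \<open>The Bochner integral in arbitrary Banach spaces\<close>

(* The library's has_bochner_integral demands a second countable (i.e. separable) target.
   This is the same definition without that restriction. *)
definition has_bochner_int :: "'a measure \<Rightarrow> ('a \<Rightarrow> 'b::real_normed_vector) \<Rightarrow> 'b \<Rightarrow> bool" where
  "has_bochner_int M f x \<longleftrightarrow>
     f \<in> borel_measurable M \<and>
     (\<exists>s. (\<forall>i. Bochner_Integration.simple_bochner_integrable M (s i)) \<and>
          (\<lambda>i. \<integral>\<^sup>+t. norm (f t - s i t) \<partial>M) \<longlonglongrightarrow> 0 \<and>
          (\<lambda>i. Bochner_Integration.simple_bochner_integral M (s i)) \<longlonglongrightarrow> x)"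

lemma has_bochner_int_iff_has_bochner_integral:
  fixes f :: "'a \<Rightarrow> 'b::{real_normed_vector, second_countable_topology}"
  shows "has_bochner_int M f x \<longleftrightarrow> has_bochner_integral M f x"
  unfolding has_bochner_int_def has_bochner_integral.simps by blast

definition bochner_integrable :: "'a measure \<Rightarrow> ('a \<Rightarrow> 'b::real_normed_vector) \<Rightarrow> bool" where
  "bochner_integrable M f \<longleftrightarrow> (\<exists>x. has_bochner_int M f x)"

definition bochner_int :: "'a measure \<Rightarrow> ('a \<Rightarrow> 'b::real_normed_vector) \<Rightarrow> 'b" where
  "bochner_int M f = (THE x. has_bochner_int M f x)"

definition locally_bochner_integrable :: "(real \<Rightarrow> 'x::real_normed_vector) \<Rightarrow> bool" where
  "locally_bochner_integrable f \<longleftrightarrow>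
     (\<forall>K. compact K \<longrightarrow> bochner_integrable lebesgue (\<lambda>t. indicator K t *\<^sub>R f t))"


section \<open>Topologies generated by seminorms\<close>

(* Seminorms take values in ennreal, so that a supremum of an unbounded set is \<infinity> rather than
   an unspecified real number. *)
definition seminorm_topology ::
    "('a \<Rightarrow> 'b::ab_group_add) set \<Rightarrow> (('a \<Rightarrow> 'b) \<Rightarrow> ennreal) set \<Rightarrow> ('a \<Rightarrow> 'b) topology" where
  "seminorm_topology V P = topology (\<lambda>W. W \<subseteq> V \<and>
     (\<forall>f\<in>W. \<exists>F. \<exists>\<epsilon>>0. finite F \<and> F \<subseteq> P \<and>
        {g \<in> V. \<forall>p\<in>F. p (\<lambda>x. g x - f x) < ennreal \<epsilon>} \<subseteq> W))"

lemma openin_seminorm_topology: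
  "openin (seminorm_topology V P) W \<longleftrightarrow> W \<subseteq> V \<and>
     (\<forall>f\<in>W. \<exists>F. \<exists>\<epsilon>>0. finite F \<and> F \<subseteq> P \<and>
        {g \<in> V. \<forall>p\<in>F. p (\<lambda>x. g x - f x) < ennreal \<epsilon>} \<subseteq> W)"
proof -
  let ?nb = "\<lambda>W f. \<exists>F. \<exists>\<epsilon>>0. finite F \<and> F \<subseteq> P \<and>
        {g \<in> V. \<forall>p\<in>F. p (\<lambda>x. g x - f x) < ennreal \<epsilon>} \<subseteq> W"
  have int: "?nb (S \<inter> T) f" if S: "?nb S f" and T: "?nb T f" for S T f
  proof -
    obtain F \<epsilon> where F: "\<epsilon> > 0" "finite F" "F \<subseteq> P"
      "{g \<in> V. \<forall>p\<in>F. p (\<lambda>x. g x - f x) < ennreal \<epsilon>} \<subseteq> S" using S by blast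
    obtain G \<delta> where G: "\<delta> > 0" "finite G" "G \<subseteq> P"
      "{g \<in> V. \<forall>p\<in>G. p (\<lambda>x. g x - f x) < ennreal \<delta>} \<subseteq> T" using T by blast
    have le: "ennreal (min \<epsilon> \<delta>) \<le> ennreal \<epsilon>" "ennreal (min \<epsilon> \<delta>) \<le> ennreal \<delta>"
      by (auto intro: ennreal_leI)
    have "{g \<in> V. \<forall>p\<in>F \<union> G. p (\<lambda>x. g x - f x) < ennreal (min \<epsilon> \<delta>)} \<subseteq> S \<inter> T"
      using F(4) G(4) order.strict_trans2[OF _ le(1)] order.strict_trans2[OF _ le(2)] by blast
    then show ?thesis
      using F G by (intro exI[of _ "F \<union> G"] exI[of _ "min \<epsilon> \<delta>"]) auto
  qed
  have un: "?nb (\<Union>\<K>) f" if S: "?nb S f" "S \<in> \<K>" for S \<K> f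
  proof -
    obtain F \<epsilon> where "\<epsilon> > 0" "finite F" "F \<subseteq> P"
      "{g \<in> V. \<forall>p\<in>F. p (\<lambda>x. g x - f x) < ennreal \<epsilon>} \<subseteq> S" using S(1) by blast
    with S(2) show ?thesis by (intro exI[of _ F] exI[of _ \<epsilon>]) auto
  qed
  have "istopology (\<lambda>W. W \<subseteq> V \<and> (\<forall>f\<in>W. ?nb W f))"
    unfolding istopology_def
  proof (rule conjI)
    show "\<forall>S T. S \<subseteq> V \<and> (\<forall>f\<in>S. ?nb S f) \<longrightarrow> T \<subseteq> V \<and> (\<forall>f\<in>T. ?nb T f) \<longrightarrow>
        S \<inter> T \<subseteq> V \<and> (\<forall>f\<in>S \<inter> T. ?nb (S \<inter> T) f)"
      by (intro allI impI conjI ballI int) (auto simp only: Int_iff)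
    show "\<forall>\<K>. (\<forall>W\<in>\<K>. W \<subseteq> V \<and> (\<forall>f\<in>W. ?nb W f)) \<longrightarrow>
        \<Union>\<K> \<subseteq> V \<and> (\<forall>f\<in>\<Union>\<K>. ?nb (\<Union>\<K>) f)"
    proof (intro allI impI conjI ballI)
      fix \<K> f
      assume K: "\<forall>W\<in>\<K>. W \<subseteq> V \<and> (\<forall>f\<in>W. ?nb W f)"
      show "\<Union>\<K> \<subseteq> V" using K by (simp add: Sup_le_iff)
      assume "f \<in> \<Union>\<K>"
      then obtain S where S: "S \<in> \<K>" "f \<in> S" by (elim UnionE)
      have "?nb S f" using bspec[OF conjunct2[OF bspec[OF K S(1)]] S(2)] .
      then show "?nb (\<Union>\<K>) f" using S(1) by (rule un)
    qed
  qed
  then show ?thesis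
    unfolding seminorm_topology_def by (simp add: topology_inverse')
qed

lemma topspace_seminorm_topology [simp]: "topspace (seminorm_topology V P) = V"
proof (rule subset_antisym)
  show "topspace (seminorm_topology V P) \<subseteq> V"
    using openin_topspace[of "seminorm_topology V P"] openin_seminorm_topology by blast
  have "openin (seminorm_topology V P) V"
    unfolding openin_seminorm_topology
    by (intro conjI subset_refl ballI exI[of _ "{}"] exI[of _ 1]) auto
  then show "V \<subseteq> topspace (seminorm_topology V P)"
    by (rule openin_subset)
qed


section \<open>Test functions\<close>

definition nth_deriv :: "nat \<Rightarrow> (real \<Rightarrow> complex) \<Rightarrow> real \<Rightarrow> complex" where
  "nth_deriv j \<phi> = ((\<lambda>g x. vector_derivative g (at x)) ^^ j) \<phi>"

definition smooth :: "(real \<Rightarrow> complex) \<Rightarrow> bool" where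
  "smooth \<phi> \<longleftrightarrow> (\<forall>j x. nth_deriv j \<phi> differentiable at x)"

definition test_functions_on :: "real set \<Rightarrow> (real \<Rightarrow> complex) set" where
  "test_functions_on K = {\<phi>. smooth \<phi> \<and> (\<forall>x. x \<notin> K \<longrightarrow> \<phi> x = 0)}"

definition test_functions :: "(real \<Rightarrow> complex) set" where
  "test_functions = (\<Union>K\<in>{K. compact K}. test_functions_on K)"

definition test_topology_on :: "real set \<Rightarrow> (real \<Rightarrow> complex) topology" where
  "test_topology_on K = seminorm_topology (test_functions_on K)
     (range (\<lambda>j \<phi>. SUP x. ennreal (norm (nth_deriv j \<phi> x))))"

definition seminorm_on_tests :: "((real \<Rightarrow> complex) \<Rightarrow> real) \<Rightarrow> bool" where
  "seminorm_on_tests p \<longleftrightarrow>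
     (\<forall>\<phi>\<in>test_functions. \<forall>\<psi>\<in>test_functions. p (\<lambda>x. \<phi> x + \<psi> x) \<le> p \<phi> + p \<psi>) \<and>
     (\<forall>\<phi>\<in>test_functions. \<forall>c. p (\<lambda>x. c * \<phi> x) = cmod c * p \<phi>)"

(* The LF topology: the finest locally convex topology for which all inclusions of the spaces
   of test functions supported in a fixed compact set are continuous. *)
definition test_topology :: "(real \<Rightarrow> complex) topology" where
  "test_topology = seminorm_topology test_functions
     {\<lambda>\<phi>. ennreal (p \<phi>) | p. seminorm_on_tests p \<and>
        (\<forall>K. compact K \<longrightarrow> continuous_map (test_topology_on K) euclideanreal p)}"

(* This is \<phi>\<^sub>a. *)
definition shift :: "real \<Rightarrow> (real \<Rightarrow> complex) \<Rightarrow> real \<Rightarrow> complex" where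
  "shift a \<phi> = (\<lambda>t. \<phi> (t + a))"

(* This is M\<^sub>-\<^sub>h \<phi>, for h > 0. *)
definition back_average :: "real \<Rightarrow> (real \<Rightarrow> complex) \<Rightarrow> real \<Rightarrow> complex" where
  "back_average h \<phi> = (\<lambda>t. (1 / h) *\<^sub>R (LINT s:{0..h}|lebesgue. \<phi> (t - s)))"


section \<open>Vector-valued distributions\<close>

(* Distributions are total HOL functions; to give equality its usual meaning they are
   normalised to be 0 off the test functions. *)
definition on_tests :: "((real \<Rightarrow> complex) \<Rightarrow> 'x::zero) \<Rightarrow> (real \<Rightarrow> complex) \<Rightarrow> 'x" where
  "on_tests F = (\<lambda>\<phi>. if \<phi> \<in> test_functions then F \<phi> else 0)"

definition distributions :: "((real \<Rightarrow> complex) \<Rightarrow> 'x::complex_banach) set" where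
  "distributions = {T.
     (\<forall>\<phi>. \<phi> \<notin> test_functions \<longrightarrow> T \<phi> = 0) \<and>
     (\<forall>\<phi>\<in>test_functions. \<forall>\<psi>\<in>test_functions. T (\<lambda>x. \<phi> x + \<psi> x) = T \<phi> + T \<psi>) \<and>
     (\<forall>\<phi>\<in>test_functions. \<forall>c. T (\<lambda>x. c * \<phi> x) = c *\<^sub>C T \<phi>) \<and>
     continuous_map test_topology euclidean T}"

definition dist_of :: "(real \<Rightarrow> 'x::complex_banach) \<Rightarrow> (real \<Rightarrow> complex) \<Rightarrow> 'x" where
  "dist_of f = on_tests (\<lambda>\<phi>. bochner_int lebesgue (\<lambda>t. \<phi> t *\<^sub>C f t))"

definition const_dist :: "'x::complex_banach \<Rightarrow> (real \<Rightarrow> complex) \<Rightarrow> 'x" where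
  "const_dist a = on_tests (\<lambda>\<phi>. (LINT x|lebesgue. \<phi> x) *\<^sub>C a)"

definition translate :: "real \<Rightarrow> ((real \<Rightarrow> complex) \<Rightarrow> 'x::complex_banach) \<Rightarrow> (real \<Rightarrow> complex) \<Rightarrow> 'x"
  where "translate a T = on_tests (\<lambda>\<phi>. T (shift (- a) \<phi>))"

definition dist_average ::
    "real \<Rightarrow> ((real \<Rightarrow> complex) \<Rightarrow> 'x::complex_banach) \<Rightarrow> (real \<Rightarrow> complex) \<Rightarrow> 'x"
  where "dist_average h S = on_tests (\<lambda>\<phi>. S (back_average h \<phi>))"

definition dist_conv :: "((real \<Rightarrow> complex) \<Rightarrow> 'x) \<Rightarrow> (real \<Rightarrow> complex) \<Rightarrow> real \<Rightarrow> 'x" where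
  "dist_conv T \<phi> = (\<lambda>x. T (\<lambda>y. \<phi> (x - y)))"


section \<open>Ergodic functions and distributions\<close>

definition has_ergodic_mean :: "(real \<Rightarrow> 'x::real_normed_vector) \<Rightarrow> 'x \<Rightarrow> bool" where
  "has_ergodic_mean f m \<longleftrightarrow>
     ((\<lambda>T. SUP x. ennreal (norm
        ((1 / T) *\<^sub>R bochner_int lebesgue (\<lambda>s. indicator {0..T} s *\<^sub>R f (x + s)) - m)))
      \<longlongrightarrow> 0) at_top"

definition ergodic_functions :: "(real \<Rightarrow> 'x::complex_banach) set" where
  "ergodic_functions = {f. locally_bochner_integrable f \<and> (\<exists>m. has_ergodic_mean f m)}"

definition ergodic_mean :: "(real \<Rightarrow> 'x::real_normed_vector) \<Rightarrow> 'x" where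
  "ergodic_mean f = (THE m. has_ergodic_mean f m)"

definition ergodic_distributions :: "((real \<Rightarrow> complex) \<Rightarrow> 'x::complex_banach) set" where
  "ergodic_distributions =
     {T \<in> distributions. \<forall>\<phi>\<in>test_functions. dist_conv T \<phi> \<in> ergodic_functions}"

definition DL1_bounded :: "(real \<Rightarrow> complex) set \<Rightarrow> bool" where
  "DL1_bounded U \<longleftrightarrow> U \<subseteq> test_functions \<and>
     (\<forall>j. (SUP \<phi>\<in>U. \<integral>\<^sup>+x. norm (nth_deriv j \<phi> x) \<partial>lebesgue) < \<infinity>)"

(* The (D_L1)'-topology on the ergodic distributions. *)
definition DL1_dual_topology :: "((real \<Rightarrow> complex) \<Rightarrow> 'x::complex_banach) topology" where
  "DL1_dual_topology = seminorm_topology ergodic_distributions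
     {\<lambda>T. SUP \<phi>\<in>U. ennreal (norm (T \<phi>)) | U. DL1_bounded U}"

definition continuous_linear_mean_extension ::
    "(((real \<Rightarrow> complex) \<Rightarrow> 'x::complex_banach) \<Rightarrow> 'x) \<Rightarrow> bool" where
  "continuous_linear_mean_extension M \<longleftrightarrow>
     (\<forall>f\<in>ergodic_functions. M (dist_of f) = ergodic_mean f) \<and>
     (\<forall>S\<in>ergodic_distributions. \<forall>T\<in>ergodic_distributions.
        M (\<lambda>\<phi>. S \<phi> + T \<phi>) = M S + M T) \<and>
     (\<forall>T\<in>ergodic_distributions. \<forall>c. M (\<lambda>\<phi>. c *\<^sub>C T \<phi>) = c *\<^sub>C M T) \<and>
     continuous_map DL1_dual_topology euclidean M"

end

theory Submission
  imports Defs
begin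

text \<open>
  Write \<open>M\<close> for the extended mean. A distribution has no values, but it has orbits
  \<open>orbit T \<phi> x = T (shift (- x) \<phi>)\<close>, which are its convolutions with test functions. The mean is defined through the
  orbit of one fixed test function of integral 1, and everything depends on how orbits for different test functions are
  related, and on how well \<open>T\<close> is determined by them.

  \<^bold>\<open>Boundedness.\<close> The orbit of \<open>\<phi>'\<close> is minus the derivative of the orbit of \<open>\<phi>\<close>. Since both orbits are ergodic, the
  orbit of \<open>\<phi>\<close> has bounded means and bounded oscillation over intervals of a fixed length, hence it is bounded
  (\<open>ergodic_orbit_bounded\<close>). Consequently a test function of integral 0, which is the derivative of a test function
  \<open>\<theta>\<close>, has an orbit of mean 0: its means over intervals of length \<open>h\<close> are increments of the bounded orbit of \<open>\<theta>\<close>, divided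
  by \<open>h\<close>. So the mean of the orbit of \<open>\<phi>\<close> is the integral of \<open>\<phi>\<close> times \<open>M T\<close>
  (\<open>orbit_mean_eq_extended_mean\<close>), which is the formula for the convolutions. Translation invariance is
  immediate, and \<open>M\<close> is continuous because \<open>M T\<close> is bounded by the supremum of \<open>T\<close> over the translates of the fixed
  test function (\<open>extended_mean_continuous\<close>).

  \<^bold>\<open>Finite order.\<close> As all orbits are bounded, the uniform boundedness principle, applied to the translates of \<open>T\<close> on
  the Frechet space of test functions supported in \<open>{-1..1}\<close>, gives one order bound for all translates
  (\<open>orbit_uniform_order_bound\<close>). Cutting a test function \<open>\<psi>\<close> into pieces of bounded length turns this into
  \<open>norm (T \<psi>) \<le> C * sobolev_norm k \<psi>\<close>, where the Sobolev norm sums the L1 norms of the derivatives up to order \<open>k\<close>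
  (\<open>L1_order_bound\<close>). On a set \<open>U\<close> that is bounded in all these norms, the mollifications of \<open>\<phi> \<in> U\<close> by a kernel of
  width \<open>r\<close> tend to \<open>\<phi>\<close> at the uniform rate \<open>r\<close>, and averaging does not increase the norms
  (\<open>mollification_uniformly_close\<close>).

  \<^bold>\<open>Uniqueness and averages.\<close> On a mollified \<open>\<phi>\<close>, the value of \<open>T\<close> is the integral of \<open>\<phi>\<close> against the orbit of the kernel,
  that is, the value at \<open>\<phi>\<close> of the distribution defined by an ergodic function of mean \<open>M T\<close>. These functions
  therefore approximate \<open>T\<close> in the topology in question, and a continuous extension of the ergodic mean must be \<open>M T\<close> at \<open>T\<close>
  (\<open>extended_mean_unique\<close>). In the same way, the average of length \<open>h\<close> of \<open>T\<close> at a mollified \<open>\<phi>\<close> is the integral of \<open>\<phi>\<close>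
  against the means of the orbit over \<open>{s..s+h}\<close>, which converge uniformly to \<open>M T\<close> (\<open>dist_average_limit\<close>).

  That \<open>M\<close> extends the ergodic mean of a merely locally integrable \<open>f\<close> (\<open>dist_of_ergodic_mean\<close>) is proved through a
  primitive of \<open>f\<close>. The values lie in an arbitrary Banach space, possibly nonseparable, so Bochner integrals are first
  identified with gauge integrals, which depend on no separability (\<open>has_bochner_int_has_integral\<close>).
\<close>

section \<open>Bochner integrals on the line as gauge integrals\<close>

abbreviation simple_integrable :: "(real \<Rightarrow> 'x::real_normed_vector) \<Rightarrow> bool" where
  "simple_integrable \<equiv> Bochner_Integration.simple_bochner_integrable lebesgue"

abbreviation simple_int :: "(real \<Rightarrow> 'x::real_normed_vector) \<Rightarrow> 'x" where
  "simple_int \<equiv> Bochner_Integration.simple_bochner_integral lebesgue"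

lemma scaleC_scaleR_left: "(r *\<^sub>R c) *\<^sub>C x = r *\<^sub>R (c *\<^sub>C (x::'x::complex_banach))"
  by (simp add: scaleR_conv_of_real scaleC_scaleC[symmetric] scaleC_of_real)

lemma scaleC_scaleR_right: "c *\<^sub>C (r *\<^sub>R x) = r *\<^sub>R (c *\<^sub>C (x::'x::complex_banach))"
  by (simp add: scaleC_of_real[symmetric] scaleC_scaleC mult.commute)

lemma bounded_bilinear_scaleC: "bounded_bilinear (\<lambda>c x. c *\<^sub>C (x::'x::complex_banach))"
  by (rule bounded_bilinear.intro)
     (auto simp: scaleC_add_left scaleC_add_right scaleC_scaleR_left scaleC_scaleR_right norm_scaleC
       intro!: exI[of _ 1])

interpretation scaleC: bounded_bilinear "\<lambda>c x. c *\<^sub>C (x::'x::complex_banach)"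
  by (rule bounded_bilinear_scaleC)

lemma scaleC_one [simp]: "1 *\<^sub>C (x::'x::complex_banach) = x"
  using scaleC_of_real[of 1 x] by simp

lemma simple_integrable_has_integral:
  fixes s :: "real \<Rightarrow> 'x::real_normed_vector"
  assumes "simple_integrable s"
  shows "(s has_integral simple_int s) UNIV"
proof -
  have fin: "finite (range s)" and meas: "\<And>y. s -` {y} \<in> sets lebesgue"
    using assms simple_functionD(2)[of lebesgue s]
    unfolding Bochner_Integration.simple_bochner_integrable.simps simple_function_def by auto
  have sup: "emeasure lebesgue {y. s y \<noteq> 0} < \<infinity>"
    using assms unfolding Bochner_Integration.simple_bochner_integrable.simps by (auto simp: top.not_eq_extremum)
  have sup_meas: "{y. s y \<noteq> 0} \<in> sets lebesgue"
  proof -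
    have "{y. s y \<noteq> 0} = space lebesgue - s -` {0}" by auto
    then show ?thesis using meas[of 0] by (metis sets.compl_sets)
  qed
  have lm: "s -` {y} \<in> lmeasurable" if "y \<noteq> 0" for y
  proof (rule fmeasurableI2[of "{y. s y \<noteq> 0}"])
    show "{y. s y \<noteq> 0} \<in> lmeasurable" using sup sup_meas by (rule fmeasurableI[rotated])
  qed (use that meas in auto)
  have "((\<lambda>x. \<Sum>y\<in>range s. indicat_real (s -` {y}) x *\<^sub>R y) has_integral
      (\<Sum>y\<in>range s. measure lebesgue (s -` {y}) *\<^sub>R y)) UNIV"
  proof (rule has_integral_sum[OF fin])
    fix y
    show "((\<lambda>x. indicat_real (s -` {y}) x *\<^sub>R y) has_integral measure lebesgue (s -` {y}) *\<^sub>R y) UNIV"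
    proof (cases "y = 0")
      case False
      then show ?thesis using lm[OF False] by (intro has_integral_scaleR_left) (simp add: lmeasurable_iff_has_integral)
    qed simp
  qed
  moreover have "(\<Sum>y\<in>range s. indicat_real (s -` {y}) x *\<^sub>R y) = s x" for x
  proof -
    have "(\<Sum>y\<in>range s. indicat_real (s -` {y}) x *\<^sub>R y) = (\<Sum>y\<in>{s x}. indicat_real (s -` {y}) x *\<^sub>R y)"
      by (rule sum.mono_neutral_right[OF fin]) auto
    then show ?thesis by simp
  qed
  ultimately show ?thesis
    by (simp add: Bochner_Integration.simple_bochner_integral_def vimage_def)
qed

text \<open>
  A Riemann sum of \<open>f\<close> differs from the one of \<open>s\<close> by at most the Riemann sum of the majorant \<open>g\<close>,
  and a common gauge controls the sums of \<open>s\<close> and \<open>g\<close>. This is what turns an approximation in mean by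
  simple functions into convergence of Riemann sums, in any normed space.
\<close>

lemma has_integral_by_approximation:
  fixes f :: "real \<Rightarrow> 'x::real_normed_vector"
  assumes appr: "\<And>\<epsilon>. \<epsilon> > 0 \<Longrightarrow> \<exists>s y g c. (s has_integral y) {a..b} \<and> (g has_integral c) {a..b} \<and> c < \<epsilon> \<and>
      norm (y - x) < \<epsilon> \<and> (\<forall>t\<in>{a..b}. norm (f t - s t) \<le> g t)"
  shows "(f has_integral x) {a..b}"
  unfolding has_integral box_real[symmetric]
proof (intro allI impI)
  fix e :: real assume e: "e > 0"
  obtain s y g c where s: "(s has_integral y) {a..b}" and g: "(g has_integral c) {a..b}" and c: "c < e/4"
    and y: "norm (y - x) < e/4" and fs: "\<And>t. t \<in> {a..b} \<Longrightarrow> norm (f t - s t) \<le> g t"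
    using appr[of "e/4"] e by auto
  obtain \<gamma>1 where \<gamma>1: "gauge \<gamma>1" "\<And>D. D tagged_division_of cbox a b \<Longrightarrow> \<gamma>1 fine D \<Longrightarrow>
      norm ((\<Sum>(x,k)\<in>D. measure lborel k *\<^sub>R s x) - y) < e/4"
    using s e unfolding has_integral box_real[symmetric] by (meson divide_pos_pos zero_less_numeral)
  obtain \<gamma>2 where \<gamma>2: "gauge \<gamma>2" "\<And>D. D tagged_division_of cbox a b \<Longrightarrow> \<gamma>2 fine D \<Longrightarrow>
      norm ((\<Sum>(x,k)\<in>D. measure lborel k *\<^sub>R g x) - c) < e/4"
    using g e unfolding has_integral box_real[symmetric] by (meson divide_pos_pos zero_less_numeral)
  show "\<exists>\<gamma>. gauge \<gamma> \<and> (\<forall>D. D tagged_division_of cbox a b \<and> \<gamma> fine D \<longrightarrow>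
      norm ((\<Sum>(x,k)\<in>D. measure lborel k *\<^sub>R f x) - x) < e)"
  proof (intro exI[of _ "\<lambda>t. \<gamma>1 t \<inter> \<gamma>2 t"] conjI allI impI)
    show "gauge (\<lambda>t. \<gamma>1 t \<inter> \<gamma>2 t)" using \<gamma>1(1) \<gamma>2(1) by (rule gauge_Int)
    fix D assume D: "D tagged_division_of cbox a b \<and> (\<lambda>t. \<gamma>1 t \<inter> \<gamma>2 t) fine D"
    then have f12: "\<gamma>1 fine D" "\<gamma>2 fine D" by (auto simp: fine_Int)
    have "norm ((\<Sum>(x,k)\<in>D. measure lborel k *\<^sub>R f x) - (\<Sum>(x,k)\<in>D. measure lborel k *\<^sub>R s x))
        \<le> (\<Sum>(x,k)\<in>D. measure lborel k *\<^sub>R g x)"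
      unfolding sum_subtractf[symmetric] split_def
    proof (rule sum_norm_le)
      fix p assume p: "p \<in> D"
      have "fst p \<in> {a..b}"
        using tagged_division_ofD(2,3)[OF conjunct1[OF D], of "fst p" "snd p"] p by auto
      then have "measure lborel (snd p) * norm (f (fst p) - s (fst p)) \<le> measure lborel (snd p) * g (fst p)"
        using fs by (intro mult_left_mono) auto
      then show "norm (measure lborel (snd p) *\<^sub>R f (fst p) - measure lborel (snd p) *\<^sub>R s (fst p)) \<le> measure lborel (snd p) *\<^sub>R g (fst p)"
        by (simp add: scaleR_diff_right[symmetric])
    qed
    moreover have "norm ((\<Sum>(x,k)\<in>D. measure lborel k *\<^sub>R s x) - y) < e/4" using \<gamma>1(2) D f12 by blast
    moreover have "norm ((\<Sum>(x,k)\<in>D. measure lborel k *\<^sub>R g x) - c) < e/4" using \<gamma>2(2) D f12 by blast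
    ultimately show "norm ((\<Sum>(x,k)\<in>D. measure lborel k *\<^sub>R f x) - x) < e"
      using c y norm_triangle_ineq[of "(\<Sum>(x,k)\<in>D. measure lborel k *\<^sub>R f x) - (\<Sum>(x,k)\<in>D. measure lborel k *\<^sub>R s x)"
         "(\<Sum>(x,k)\<in>D. measure lborel k *\<^sub>R s x) - x"]
         norm_triangle_ineq[of "(\<Sum>(x,k)\<in>D. measure lborel k *\<^sub>R s x) - y" "y - x"]
      by (simp add: abs_real_def split: if_splits)
  qed
qed

text \<open>
  In a nonseparable space sums of measurable functions can fail to be measurable; a function with finitely
  many values causes no trouble, because on each of its level sets only a constant is subtracted.
\<close>

lemma simple_diff_measurable:
  fixes f :: "real \<Rightarrow> 'x::real_normed_vector"
  assumes f: "f \<in> borel_measurable lebesgue" and s: "simple_integrable s"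
  shows "(\<lambda>x. f x - s x) \<in> borel_measurable lebesgue"
proof -
  have s': "simple_function lebesgue s"
    using s unfolding Bochner_Integration.simple_bochner_integrable.simps by auto
  show ?thesis
  proof (rule measurable_compose_countable'[where f="\<lambda>i x. f x - i" and g=s and I="range s"])
    show "(\<lambda>x. f x - i) \<in> borel_measurable lebesgue" for i
      by (rule measurable_compose[OF f]) (intro borel_measurable_continuous_onI continuous_intros)
    show "countable (range s)" using s' unfolding simple_function_def by (auto intro: countable_finite)
    show "s \<in> lebesgue \<rightarrow>\<^sub>M count_space (range s)"
    proof (rule measurableI)
      show "s -` A \<inter> space lebesgue \<in> sets lebesgue" for A
        using measurable_sets[OF measurable_simple_function[OF s'], of A] by simp
    qed simp
  qed
qed


lemma simple_diff_norm_has_integral: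
  fixes f :: "real \<Rightarrow> 'x::real_normed_vector"
  assumes f: "f \<in> borel_measurable lebesgue" and s: "simple_integrable s"
    and lt: "(\<integral>\<^sup>+t. norm (f t - s t) \<partial>lebesgue) < ennreal \<epsilon>"
  shows "\<exists>c<\<epsilon>. ((\<lambda>t. norm (f t - s t)) has_integral c) UNIV"
proof -
  have fin: "(\<integral>\<^sup>+t. norm (f t - s t) \<partial>lebesgue) < \<infinity>"
    using lt by (rule order.strict_trans) simp
  then obtain c where c: "(\<integral>\<^sup>+t. norm (f t - s t) \<partial>lebesgue) = ennreal c" "c \<ge> 0"
    by (metis ennreal_cases infinity_ennreal_def less_irrefl)
  have "((\<lambda>t. norm (f t - s t)) has_integral c) UNIV"
    using c simple_diff_measurable[OF f s] by (subst has_integral_iff_nn_integral_lebesgue) auto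
  moreover have "c < \<epsilon>" using lt c by (simp add: ennreal_less_iff)
  ultimately show ?thesis by blast
qed

lemma simple_integrable_diff_bound:
  fixes s t :: "real \<Rightarrow> 'x::banach"
  assumes s: "simple_integrable s" and t: "simple_integrable t"
    and g: "(g has_integral c) UNIV" and le: "\<And>x. norm (s x - t x) \<le> g x"
  shows "norm (simple_int s - simple_int t) \<le> c"
proof -
  have "((\<lambda>x. s x - t x) has_integral (simple_int s - simple_int t)) UNIV"
    by (intro has_integral_diff simple_integrable_has_integral s t)
  then show ?thesis
    using integral_norm_bound_integral[of "\<lambda>x. s x - t x" UNIV g] g le
    by (auto simp: has_integral_iff)
qed

text \<open>
  Convergence of the integrals of the approximating simple functions is automatic, by completeness. Integrability
  thus becomes a pure density condition, and the value of the integral is read off from the gauge integral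
  in the next lemma.
\<close>

lemma bochner_integrable_lebesgue_iff:
  fixes f :: "real \<Rightarrow> 'x::banach"
  shows "bochner_integrable lebesgue f \<longleftrightarrow> f \<in> borel_measurable lebesgue \<and>
    (\<forall>\<epsilon>>0. \<exists>s. simple_integrable s \<and> (\<integral>\<^sup>+t. norm (f t - s t) \<partial>lebesgue) < ennreal \<epsilon>)" (is "?L \<longleftrightarrow> ?R")
proof
  assume ?L
  then obtain s x where f: "f \<in> borel_measurable lebesgue" and s: "\<And>i. simple_integrable (s i)"
    and lim: "(\<lambda>i. \<integral>\<^sup>+t. norm (f t - s i t) \<partial>lebesgue) \<longlonglongrightarrow> 0"
    unfolding bochner_integrable_def has_bochner_int_def by auto
  have "\<exists>i. (\<integral>\<^sup>+t. norm (f t - s i t) \<partial>lebesgue) < ennreal \<epsilon>" if "\<epsilon> > 0" for \<epsilon>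
    using order_tendstoD(2)[OF lim, of "ennreal \<epsilon>"] that by (auto simp: eventually_sequentially)
  then show ?R using f s by blast
next
  assume R: ?R
  then have f: "f \<in> borel_measurable lebesgue" by blast
  have "\<forall>n. \<exists>s. simple_integrable s \<and> (\<integral>\<^sup>+t. norm (f t - s t) \<partial>lebesgue) < ennreal (inverse (Suc n))"
    using R by (simp del: of_nat_Suc)
  then obtain s where s: "\<And>n. simple_integrable (s n)"
    and lt: "\<And>n. (\<integral>\<^sup>+t. norm (f t - s n t) \<partial>lebesgue) < ennreal (inverse (Suc n))"
    by metis
  have lim: "(\<lambda>n. \<integral>\<^sup>+t. norm (f t - s n t) \<partial>lebesgue) \<longlonglongrightarrow> 0"
  proof (rule tendsto_sandwich[of "\<lambda>_. 0" _ _ "\<lambda>n. ennreal (inverse (Suc n))"])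
    show "(\<lambda>n. ennreal (inverse (real (Suc n)))) \<longlonglongrightarrow> 0"
      using tendsto_ennrealI[OF LIMSEQ_inverse_real_of_nat] by simp
    show "\<forall>\<^sub>F n in sequentially. (\<integral>\<^sup>+t. norm (f t - s n t) \<partial>lebesgue) \<le> ennreal (inverse (real (Suc n)))"
      by (intro always_eventually allI less_imp_le lt)
  qed simp_all
  have "Cauchy (\<lambda>n. simple_int (s n))"
  proof (rule metric_CauchyI)
    fix e :: real assume e: "e > 0"
    obtain N where N: "inverse (real (Suc N)) < e/2" using reals_Archimedean[of "e/2"] e by auto
    have "dist (simple_int (s m)) (simple_int (s n)) < e" if "m \<ge> N" "n \<ge> N" for m n
    proof -
      have "inverse (real (Suc k)) < e/2" if "k \<ge> N" for k
      proof -
        have "inverse (real (Suc k)) \<le> inverse (real (Suc N))"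
          by (rule le_imp_inverse_le) (use that in auto)
        then show ?thesis using N by linarith
      qed
      then have le: "inverse (real (Suc m)) < e/2" "inverse (real (Suc n)) < e/2" using that by blast+
      obtain c d where c: "c < e/2" "((\<lambda>t. norm (f t - s m t)) has_integral c) UNIV"
        and d: "d < e/2" "((\<lambda>t. norm (f t - s n t)) has_integral d) UNIV"
        using simple_diff_norm_has_integral[OF f s lt[of m]] simple_diff_norm_has_integral[OF f s lt[of n]] le
        by (meson less_trans)
      have "norm (simple_int (s m) - simple_int (s n)) \<le> c + d"
        by (rule simple_integrable_diff_bound[OF s s has_integral_add[OF c(2) d(2)]])
          (metis norm_minus_commute norm_diff_triangle_le order_refl)
      then show ?thesis using c d by (simp add: dist_norm)
    qed
    then show "\<exists>M. \<forall>m\<ge>M. \<forall>n\<ge>M. dist (simple_int (s m)) (simple_int (s n)) < e" by blast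
  qed
  then obtain x where "(\<lambda>n. simple_int (s n)) \<longlonglongrightarrow> x"
    using Cauchy_convergent convergentD by blast
  then show ?L unfolding bochner_integrable_def has_bochner_int_def using f s lim by blast
qed

text \<open>
  The simple functions that approximate \<open>f\<close> in mean are gauge integrable, and the norms of the differences are
  majorants with small integral. Through this lemma Bochner integrals inherit additivity, norm estimates, the action of
  bounded linear maps and the fundamental theorem of calculus from the gauge integral.
\<close>

lemma has_bochner_int_has_integral:
  fixes f :: "real \<Rightarrow> 'x::banach"
  assumes "has_bochner_int lebesgue (\<lambda>t. indicator {a..b} t *\<^sub>R f t) x"
  shows "(f has_integral x) {a..b}" and "(\<lambda>t. norm (f t)) integrable_on {a..b}"
proof -
  define F where "F = (\<lambda>t. indicator {a..b} t *\<^sub>R f t)"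
  obtain s where F: "F \<in> borel_measurable lebesgue" and s: "\<And>i. simple_integrable (s i)"
    and lim: "(\<lambda>i. \<integral>\<^sup>+t. norm (F t - s i t) \<partial>lebesgue) \<longlonglongrightarrow> 0"
    and lim2: "(\<lambda>i. simple_int (s i)) \<longlonglongrightarrow> x"
    using assms unfolding has_bochner_int_def F_def by auto
  have appr: "\<exists>i c. c < \<epsilon> \<and> ((\<lambda>t. norm (F t - s i t)) has_integral c) UNIV \<and> norm (simple_int (s i) - x) < \<epsilon>"
    if "\<epsilon> > 0" for \<epsilon>
  proof -
    have "\<forall>\<^sub>F i in sequentially. (\<integral>\<^sup>+t. norm (F t - s i t) \<partial>lebesgue) < ennreal \<epsilon> \<and> norm (simple_int (s i) - x) < \<epsilon>"
      using order_tendstoD(2)[OF lim, of "ennreal \<epsilon>"] tendstoD[OF lim2 that] that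
      by (auto intro: eventually_conj simp: dist_norm)
    then obtain i where "(\<integral>\<^sup>+t. norm (F t - s i t) \<partial>lebesgue) < ennreal \<epsilon>" "norm (simple_int (s i) - x) < \<epsilon>"
      by (auto simp: eventually_sequentially)
    then show ?thesis using simple_diff_norm_has_integral[OF F s] by blast
  qed
  show "(f has_integral x) {a..b}"
  proof (rule has_integral_by_approximation)
    fix \<epsilon> :: real assume "\<epsilon> > 0"
    then obtain i c where c: "c < \<epsilon>/2" and g: "((\<lambda>t. norm (F t - s i t)) has_integral c) UNIV"
      and x: "norm (simple_int (s i) - x) < \<epsilon>/2" using appr[of "\<epsilon>/2"] by auto
    define g where "g = (\<lambda>t. norm (F t - s i t))"
    have S: "(s i has_integral simple_int (s i)) UNIV" by (rule simple_integrable_has_integral[OF s])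
    have gi: "g integrable_on {a..b}" and sii: "s i integrable_on {a..b}"
      using integrable_on_subcbox[of _ UNIV a b] g S unfolding g_def by (auto simp: has_integral_iff)
    have c': "integral {a..b} g \<le> c"
      using has_integral_subset_le[OF _ integrable_integral[OF gi] g[folded g_def]] by (auto simp: g_def)
    have "((\<lambda>t. if t \<in> {a..b} then s i t else 0) has_integral integral {a..b} (s i)) UNIV"
      using integrable_integral[OF sii] unfolding has_integral_restrict_UNIV .
    then have "((\<lambda>t. (if t \<in> {a..b} then s i t else 0) - s i t) has_integral (integral {a..b} (s i) - simple_int (s i))) UNIV"
      by (rule has_integral_diff[OF _ S])
    then have "norm (integral {a..b} (s i) - simple_int (s i)) \<le> c"
      using integral_norm_bound_integral[of "\<lambda>t. (if t \<in> {a..b} then s i t else 0) - s i t" UNIV g] g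
      by (auto simp: has_integral_iff g_def F_def)
    then have y: "norm (integral {a..b} (s i) - x) < \<epsilon>"
      using c x norm_triangle_ineq[of "integral {a..b} (s i) - simple_int (s i)" "simple_int (s i) - x"] by simp
    show "\<exists>s y g c. (s has_integral y) {a..b} \<and> (g has_integral c) {a..b} \<and> c < \<epsilon> \<and>
      norm (y - x) < \<epsilon> \<and> (\<forall>t\<in>{a..b}. norm (f t - s t) \<le> g t)"
    proof (intro exI conjI)
      show "(s i has_integral integral {a..b} (s i)) {a..b}" using sii by (rule integrable_integral)
      show "(g has_integral integral {a..b} g) {a..b}" using gi by (rule integrable_integral)
      show "integral {a..b} g < \<epsilon>" using c c' \<open>\<epsilon> > 0\<close> by simp
      show "norm (integral {a..b} (s i) - x) < \<epsilon>" by (rule y)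
      show "\<forall>t\<in>{a..b}. norm (f t - s i t) \<le> g t" by (simp add: g_def F_def)
    qed
  qed
  show "(\<lambda>t. norm (f t)) integrable_on {a..b}"
  proof -
    obtain i c where g: "((\<lambda>t. norm (F t - s i t)) has_integral c) UNIV" using appr[of 1] by auto
    have ns: "simple_integrable (\<lambda>t. norm (s i t))"
      using Bochner_Integration.simple_bochner_integrable_compose2[of "\<lambda>x _. norm x", OF _ s s] by simp
    have h: "((\<lambda>t. norm (F t - s i t) + norm (s i t)) has_integral (c + simple_int (\<lambda>t. norm (s i t)))) UNIV"
      by (rule has_integral_add[OF g simple_integrable_has_integral[OF ns]])
    have "(\<integral>\<^sup>+t. norm (F t) \<partial>lebesgue) \<le> (\<integral>\<^sup>+t. ennreal (norm (F t - s i t) + norm (s i t)) \<partial>lebesgue)"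
      by (intro nn_integral_mono ennreal_leI) (metis add.commute norm_triangle_sub)
    also have "\<dots> = ennreal (c + simple_int (\<lambda>t. norm (s i t)))"
      using h by (subst (asm) has_integral_iff_nn_integral_lebesgue) auto
    finally obtain r where "(\<integral>\<^sup>+t. norm (F t) \<partial>lebesgue) = ennreal r" "r \<ge> 0"
      by (metis ennreal_cases ennreal_neq_top top.extremum_unique)
    then have "((\<lambda>t. norm (F t)) has_integral r) UNIV"
      using F by (subst has_integral_iff_nn_integral_lebesgue) auto
    moreover have "(\<lambda>t. norm (F t)) = (\<lambda>t. if t \<in> {a..b} then norm (f t) else 0)"
      by (auto simp: F_def indicator_def)
    ultimately have "((\<lambda>t. norm (f t)) has_integral r) {a..b}"
      by (simp only: has_integral_restrict_UNIV)
    then show ?thesis by blast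
  qed
qed

lemma bochner_int_eq_integral:
  fixes f :: "real \<Rightarrow> 'x::banach"
  assumes "bochner_integrable lebesgue (\<lambda>t. indicator {a..b} t *\<^sub>R f t)"
  shows "f integrable_on {a..b}" "(\<lambda>t. norm (f t)) integrable_on {a..b}"
    "bochner_int lebesgue (\<lambda>t. indicator {a..b} t *\<^sub>R f t) = integral {a..b} f"
proof -
  obtain x where x: "has_bochner_int lebesgue (\<lambda>t. indicator {a..b} t *\<^sub>R f t) x"
    using assms unfolding bochner_integrable_def by blast
  show "f integrable_on {a..b}" "(\<lambda>t. norm (f t)) integrable_on {a..b}"
    using has_bochner_int_has_integral[OF x] by auto
  have "bochner_int lebesgue (\<lambda>t. indicator {a..b} t *\<^sub>R f t) = x"
    unfolding bochner_int_def using x has_bochner_int_has_integral(1) has_integral_unique by blast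
  then show "bochner_int lebesgue (\<lambda>t. indicator {a..b} t *\<^sub>R f t) = integral {a..b} f"
    using has_bochner_int_has_integral(1)[OF x] by (simp add: integral_unique)
qed

text \<open>
  Rounding the argument to multiples of \<open>1/n\<close> turns any function into a step function.
\<close>

definition grid :: "real \<Rightarrow> real \<Rightarrow> real" where
  "grid n t = real_of_int \<lfloor>n * t\<rfloor> / n"

lemma grid_dist: "n > 0 \<Longrightarrow> \<bar>grid n t - t\<bar> \<le> 1 / n"
proof -
  assume n: "n > 0"
  have "\<bar>real_of_int \<lfloor>n * t\<rfloor> - n * t\<bar> \<le> 1" by linarith
  then have "\<bar>real_of_int \<lfloor>n * t\<rfloor> - n * t\<bar> / n \<le> 1 / n" using n by (simp add: divide_right_mono)
  moreover have "grid n t - t = (real_of_int \<lfloor>n * t\<rfloor> - n * t) / n" using n by (simp add: grid_def field_simps)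
  ultimately show ?thesis using n by simp
qed

lemma simple_integrable_grid:
  fixes f :: "real \<Rightarrow> 'x::real_normed_vector"
  assumes K: "compact K"
  shows "simple_integrable (\<lambda>t. indicator K t *\<^sub>R f (grid n t))"
proof (rule Bochner_Integration.simple_bochner_integrable.intros)
  obtain R where R: "\<And>t. t \<in> K \<Longrightarrow> \<bar>t\<bar> \<le> R"
    using compact_imp_bounded[OF K] unfolding bounded_iff by auto
  define u where "u = (\<lambda>t. indicat_real K t * real_of_int \<lfloor>n * t\<rfloor>)"
  have Km [measurable]: "K \<in> sets lebesgue" using lmeasurable_compact[OF K] by blast
  have idm [measurable]: "(\<lambda>t::real. t) \<in> borel_measurable lebesgue" by (simp add: measurable_completion)
  have um: "u \<in> borel_measurable lebesgue" unfolding u_def by measurable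
  have "u ` UNIV \<subseteq> insert 0 (real_of_int ` {-\<lceil>\<bar>n\<bar> * R\<rceil> - 1..\<lceil>\<bar>n\<bar> * R\<rceil>})"
  proof
    fix y assume "y \<in> u ` UNIV"
    then obtain t where y: "y = u t" by blast
    show "y \<in> insert 0 (real_of_int ` {-\<lceil>\<bar>n\<bar> * R\<rceil> - 1..\<lceil>\<bar>n\<bar> * R\<rceil>})"
    proof (cases "t \<in> K")
      case True
      have "\<bar>n * t\<bar> \<le> \<bar>n\<bar> * R" using R[OF True] by (simp add: abs_mult mult_left_mono)
      then have "\<lfloor>n * t\<rfloor> \<in> {-\<lceil>\<bar>n\<bar> * R\<rceil> - 1..\<lceil>\<bar>n\<bar> * R\<rceil>}" by simp linarith
      then show ?thesis using True by (auto simp: y u_def)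
    qed (simp add: y u_def)
  qed
  then have "finite (u ` space lebesgue)" by (auto intro: finite_subset)
  then have us: "simple_function lebesgue u" using um by (rule simple_function_borel_measurable[rotated])
  have ik: "simple_function lebesgue (indicat_real K)" by (rule simple_function_indicator[OF Km])
  have "(\<lambda>t. indicator K t *\<^sub>R f (grid n t)) = (\<lambda>t. indicat_real K t *\<^sub>R f (u t / n))"
    by (rule ext) (simp add: u_def grid_def indicator_def)
  then show "simple_function lebesgue (\<lambda>t. indicator K t *\<^sub>R f (grid n t))"
    using simple_function_compose2[OF ik us, of "\<lambda>i j. i *\<^sub>R f (j / n)"] by simp
  have "{y. indicator K y *\<^sub>R f (grid n y) \<noteq> 0} \<subseteq> K" by (auto simp: indicator_def)
  then have "emeasure lebesgue {y \<in> space lebesgue. indicator K y *\<^sub>R f (grid n y) \<noteq> 0} \<le> emeasure lebesgue K"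
    using Km by (intro emeasure_mono) auto
  also have "\<dots> < \<infinity>" using lmeasurable_compact[OF K] by (auto simp: fmeasurable_def)
  finally show "emeasure lebesgue {y \<in> space lebesgue. indicator K y *\<^sub>R f (grid n y) \<noteq> 0} \<noteq> \<infinity>" by simp
qed

lemma grid_uniform_approximation:
  fixes f :: "real \<Rightarrow> 'x::real_normed_vector"
  assumes K: "compact K" and f: "continuous_on UNIV f" and e: "\<epsilon> > 0"
  shows "\<exists>n>0. \<forall>t\<in>K. norm (f t - f (grid n t)) \<le> \<epsilon>"
proof -
  obtain R where R: "\<And>t. t \<in> K \<Longrightarrow> \<bar>t\<bar> \<le> R"
    using compact_imp_bounded[OF K] unfolding bounded_iff by auto
  have "uniformly_continuous_on {-R-1..R+1} f"
    by (intro compact_uniformly_continuous continuous_on_subset[OF f]) auto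
  then obtain d where d: "d > 0" "\<And>x y. x \<in> {-R-1..R+1} \<Longrightarrow> y \<in> {-R-1..R+1} \<Longrightarrow> dist y x < d \<Longrightarrow> dist (f y) (f x) < \<epsilon>"
    unfolding uniformly_continuous_on_def using e by metis
  define n where "n = 1 + 1 / d"
  have n: "n > 0" "1 / n \<le> 1" "1 / n < d" using d by (auto simp: n_def field_simps add_pos_pos)

  have "norm (f t - f (grid n t)) \<le> \<epsilon>" if t: "t \<in> K" for t
  proof -
    have g: "grid n t - t \<le> 1 / n" "t - grid n t \<le> 1 / n" using grid_dist[of n t] n by (auto simp: abs_le_iff)
    have "dist (f t) (f (grid n t)) < \<epsilon>"
      by (rule d(2)) (use g n(2,3) R[OF t] in \<open>simp_all add: dist_real_def abs_le_iff, (linarith+)?\<close>)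
    then show ?thesis by (simp add: dist_norm)
  qed
  with n show ?thesis by blast
qed

text \<open>
  The product is a pointwise limit of functions which on each grid cell are a constant multiple of \<open>f\<close>; the
  detour avoids joint measurability of the multiplication, which is delicate for nonseparable values.
\<close>

lemma borel_measurable_continuous_scaleC:
  fixes f :: "real \<Rightarrow> 'x::complex_banach"
  assumes \<psi>: "continuous_on UNIV \<psi>" and f: "f \<in> borel_measurable lebesgue"
  shows "(\<lambda>t. \<psi> t *\<^sub>C f t) \<in> borel_measurable lebesgue"
proof (rule borel_measurable_LIMSEQ_metric)
  fix k :: nat
  have idm [measurable]: "(\<lambda>t::real. t) \<in> borel_measurable lebesgue" by (simp add: measurable_completion)
  have fl: "(\<lambda>t. \<lfloor>real (Suc k) * t\<rfloor>) \<in> lebesgue \<rightarrow>\<^sub>M count_space UNIV" by measurable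
  show "(\<lambda>t. \<psi> (grid (Suc k) t) *\<^sub>C f t) \<in> borel_measurable lebesgue"
    unfolding grid_def
  proof (rule measurable_compose_countable[OF _ fl])
    fix i :: int
    show "(\<lambda>t. \<psi> (real_of_int i / real (Suc k)) *\<^sub>C f t) \<in> borel_measurable lebesgue"
      by (rule measurable_compose[OF f])
         (intro borel_measurable_continuous_onI linear_continuous_on scaleC.bounded_linear_right)
  qed
next
  fix t
  have "(\<lambda>k. grid (Suc k) t) \<longlonglongrightarrow> t"
  proof (rule LIM_zero_cancel, rule Lim_null_comparison)
    show "\<forall>\<^sub>F k in sequentially. norm (grid (Suc k) t - t) \<le> inverse (Suc k)"
      using grid_dist[of "real (Suc _)" t] by (intro always_eventually allI) (simp add: inverse_eq_divide)
  qed (rule LIMSEQ_inverse_real_of_nat)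
  moreover have "isCont \<psi> t" using \<psi> by (simp add: continuous_on_eq_continuous_at)
  ultimately show "(\<lambda>k. \<psi> (grid (Suc k) t) *\<^sub>C f t) \<longlonglongrightarrow> \<psi> t *\<^sub>C f t"
    by (intro scaleC.tendsto tendsto_const isCont_tendsto_compose[where g=\<psi>])
qed

lemma nn_integral_indicator_compact_finite: "compact K \<Longrightarrow> \<exists>c\<ge>0. (\<integral>\<^sup>+t. ennreal (indicat_real K t) \<partial>lebesgue) = ennreal c"
  for K :: "real set"
proof -
  assume K: "compact K"
  then have Km: "K \<in> lmeasurable" by (rule lmeasurable_compact)
  then show ?thesis
    by (intro exI[of _ "measure lebesgue K"])
       (auto simp: ennreal_indicator emeasure_eq_measure2 fmeasurableD)
qed

lemma locally_bochner_integrable_continuous: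
  fixes f :: "real \<Rightarrow> 'x::banach"
  assumes f: "continuous_on UNIV f"
  shows "locally_bochner_integrable f"
  unfolding locally_bochner_integrable_def bochner_integrable_lebesgue_iff
proof (intro allI impI conjI)
  fix K :: "real set" assume K: "compact K"
  have Km: "K \<in> sets lebesgue" using lmeasurable_compact[OF K] by blast
  have fm: "f \<in> borel_measurable lebesgue"
    using borel_measurable_continuous_onI[OF f] by (simp add: measurable_completion)
  show "(\<lambda>t. indicat_real K t *\<^sub>R f t) \<in> borel_measurable lebesgue"
    unfolding indicator_scaleR_eq_if using Km fm by (intro measurable_If_set) auto
  fix \<epsilon> :: real assume e: "\<epsilon> > 0"
  obtain c where c: "c \<ge> 0" "(\<integral>\<^sup>+t. ennreal (indicat_real K t) \<partial>lebesgue) = ennreal c"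
    using nn_integral_indicator_compact_finite[OF K] by blast
  define \<eta> where "\<eta> = \<epsilon> / (2 * (c + 1))"
  have \<eta>: "\<eta> > 0" "\<eta> * c < \<epsilon>" using e c by (auto simp: \<eta>_def field_simps add_nonneg_pos)
  obtain n where n: "\<And>t. t \<in> K \<Longrightarrow> norm (f t - f (grid n t)) \<le> \<eta>"
    using grid_uniform_approximation[OF K f \<eta>(1)] by blast
  have "(\<integral>\<^sup>+t. norm (indicat_real K t *\<^sub>R f t - indicat_real K t *\<^sub>R f (grid n t)) \<partial>lebesgue)
      \<le> (\<integral>\<^sup>+t. ennreal \<eta> * ennreal (indicat_real K t) \<partial>lebesgue)"
    using n \<eta>(1) by (intro nn_integral_mono) (auto simp: indicator_def intro: ennreal_leI)
  also have "\<dots> = ennreal \<eta> * ennreal c"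
    using Km c by (subst nn_integral_cmult) auto
  also have "\<dots> < ennreal \<epsilon>" using \<eta> c by (simp add: ennreal_mult'[symmetric] ennreal_less_iff)
  finally show "\<exists>s. simple_integrable s \<and> (\<integral>\<^sup>+t. norm (indicat_real K t *\<^sub>R f t - s t) \<partial>lebesgue) < ennreal \<epsilon>"
    using simple_integrable_grid[OF K] by blast
qed

text \<open>
  On a compact set, multiply a simple approximation of \<open>f\<close> by a step approximation of \<open>\<psi>\<close>.
\<close>

lemma locally_bochner_integrable_scaleC:
  fixes f :: "real \<Rightarrow> 'x::complex_banach"
  assumes f: "locally_bochner_integrable f" and \<psi>: "continuous_on UNIV \<psi>"
  shows "locally_bochner_integrable (\<lambda>t. \<psi> t *\<^sub>C f t)"
  unfolding locally_bochner_integrable_def bochner_integrable_lebesgue_iff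
proof (intro allI impI conjI)
  fix K :: "real set" assume K: "compact K"
  define F where "F = (\<lambda>t. indicat_real K t *\<^sub>R f t)"
  have Fm: "F \<in> borel_measurable lebesgue"
    and F: "\<And>\<epsilon>. \<epsilon> > 0 \<Longrightarrow> \<exists>s. simple_integrable s \<and> (\<integral>\<^sup>+t. norm (F t - s t) \<partial>lebesgue) < ennreal \<epsilon>"
    using f K unfolding locally_bochner_integrable_def bochner_integrable_lebesgue_iff F_def by auto
  have eq: "indicat_real K t *\<^sub>R \<psi> t *\<^sub>C f t = \<psi> t *\<^sub>C F t" for t
    by (simp add: F_def scaleC_scaleR_right)
  show "(\<lambda>t. indicat_real K t *\<^sub>R \<psi> t *\<^sub>C f t) \<in> borel_measurable lebesgue"
    unfolding eq by (rule borel_measurable_continuous_scaleC[OF \<psi> Fm])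
  fix \<epsilon> :: real assume e: "\<epsilon> > 0"
  have "bounded (\<psi> ` K)"
    by (intro compact_imp_bounded compact_continuous_image continuous_on_subset[OF \<psi>] K) auto
  then obtain B where B: "\<And>t. t \<in> K \<Longrightarrow> norm (\<psi> t) \<le> B" unfolding bounded_iff by auto
  define B' where "B' = max B 1"
  have B': "B' > 0" "\<And>t. t \<in> K \<Longrightarrow> norm (\<psi> t) \<le> B'" using B by (force simp: B'_def)+
  obtain s where s: "simple_integrable s" and sl: "(\<integral>\<^sup>+t. norm (F t - s t) \<partial>lebesgue) < ennreal (\<epsilon> / (2 * B'))"
    using F[of "\<epsilon> / (2 * B')"] e B' by auto
  obtain c where c: "c < \<epsilon> / (2 * B')" and ci: "((\<lambda>t. norm (F t - s t)) has_integral c) UNIV"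
    using simple_diff_norm_has_integral[OF Fm s sl] by blast
  have ns: "simple_integrable (\<lambda>t. norm (s t))"
    using Bochner_Integration.simple_bochner_integrable_compose2[of "\<lambda>x _. norm x", OF _ s s] by simp
  define N where "N = simple_int (\<lambda>t. norm (s t))"
  have N: "((\<lambda>t. norm (s t)) has_integral N) UNIV"
    unfolding N_def by (rule simple_integrable_has_integral[OF ns])
  have N0: "N \<ge> 0" by (rule has_integral_nonneg[OF N]) auto
  define \<eta> where "\<eta> = \<epsilon> / (2 * (N + 1))"
  have \<eta>: "\<eta> > 0" "\<eta> * N < \<epsilon> / 2" using e N0 by (auto simp: \<eta>_def field_simps add_nonneg_pos)
  obtain n where n: "\<And>t. t \<in> K \<Longrightarrow> norm (\<psi> t - \<psi> (grid n t)) \<le> \<eta>"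
    using grid_uniform_approximation[OF K \<psi> \<eta>(1)] by blast
  define z where "z = (\<lambda>t. indicat_real K t *\<^sub>R \<psi> (grid n t))"
  have zs: "simple_integrable (\<lambda>t. z t *\<^sub>C s t)"
    by (rule Bochner_Integration.simple_bochner_integrable_compose2[of "\<lambda>x y. x *\<^sub>C y"])
       (auto simp: s z_def scaleC.zero_left intro: simple_integrable_grid[OF K])
  have le: "norm (\<psi> t *\<^sub>C F t - z t *\<^sub>C s t) \<le> B' * norm (F t - s t) + \<eta> * norm (s t)" for t
  proof (cases "t \<in> K")
    case True
    have "\<psi> t *\<^sub>C F t - z t *\<^sub>C s t = \<psi> t *\<^sub>C (F t - s t) + (\<psi> t - z t) *\<^sub>C s t"
      by (simp add: scaleC.diff_left scaleC.diff_right)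
    also have "norm \<dots> \<le> norm (\<psi> t) * norm (F t - s t) + norm (\<psi> t - z t) * norm (s t)"
      by (metis norm_scaleC norm_triangle_ineq)
    also have "\<dots> \<le> B' * norm (F t - s t) + \<eta> * norm (s t)"
      using n[OF True] B'(2)[OF True] True by (intro add_mono mult_right_mono) (auto simp: z_def)
    finally show ?thesis .
  next
    case False
    then have "\<psi> t *\<^sub>C F t - z t *\<^sub>C s t = 0"
      by (simp add: F_def z_def scaleC.zero_left scaleC.zero_right)
    moreover have "0 \<le> B' * norm (F t - s t) + \<eta> * norm (s t)" using B' \<eta> by simp
    ultimately show ?thesis by (simp only: norm_zero)
  qed
  have hi: "((\<lambda>t. B' * norm (F t - s t) + \<eta> * norm (s t)) has_integral (B' * c + \<eta> * N)) UNIV"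
    by (intro has_integral_add has_integral_mult_right ci N)
  have "(\<integral>\<^sup>+t. norm (\<psi> t *\<^sub>C F t - z t *\<^sub>C s t) \<partial>lebesgue)
      \<le> (\<integral>\<^sup>+t. ennreal (B' * norm (F t - s t) + \<eta> * norm (s t)) \<partial>lebesgue)"
    using le by (intro nn_integral_mono ennreal_leI)
  also have "\<dots> = ennreal (B' * c + \<eta> * N)"
    using hi B' \<eta> by (subst (asm) has_integral_iff_nn_integral_lebesgue) auto
  also have "\<dots> < ennreal \<epsilon>"
  proof (rule ennreal_lessI)
    have "B' * c < \<epsilon> / 2" using c B' by (simp add: field_simps)
    then show "B' * c + \<eta> * N < \<epsilon>" using \<eta> by simp
  qed (rule e)
  finally show "\<exists>s. simple_integrable s \<and> (\<integral>\<^sup>+t. norm (indicat_real K t *\<^sub>R \<psi> t *\<^sub>C f t - s t) \<partial>lebesgue) < ennreal \<epsilon>"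
    unfolding eq using zs by blast
qed

lemma distr_lebesgue_translation: "distr lebesgue lebesgue (\<lambda>t. a + t) = (lebesgue :: real measure)"
  using lebesgue_real_affine[of 1 a] by (simp add: density_1)

lemma translation_measurable: "(\<lambda>t. a + t) \<in> lebesgue \<rightarrow>\<^sub>M (lebesgue :: real measure)"
  using lebesgue_affine_measurable[of "\<lambda>_. 1::real" a] by simp

lemma simple_integrable_translation:
  assumes s: "simple_integrable s"
  shows "simple_integrable (\<lambda>t. s (a + t))"
proof (rule Bochner_Integration.simple_bochner_integrable.intros)
  have s': "simple_function lebesgue s" "emeasure lebesgue {y. s y \<noteq> 0} \<noteq> \<infinity>"
    using s unfolding Bochner_Integration.simple_bochner_integrable.simps by auto
  have sm: "s \<in> measurable lebesgue (count_space UNIV)" by (rule measurable_simple_function[OF s'(1)])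
  have "range (\<lambda>t. s (a + t)) \<subseteq> range s" by auto
  then have fin: "finite (range (\<lambda>t. s (a + t)))"
    using simple_functionD(1)[OF s'(1)] by (auto intro: finite_subset)
  show "simple_function lebesgue (\<lambda>t. s (a + t))"
    unfolding simple_function_def
    using fin measurable_sets[OF measurable_compose[OF translation_measurable sm]] by auto
  have m: "{y. s y \<noteq> 0} \<in> sets lebesgue"
    using measurable_sets[OF sm, of "- {0}"] by (simp add: vimage_def)
  have "emeasure lebesgue {y. s y \<noteq> 0} = emeasure (distr lebesgue lebesgue (\<lambda>t. a + t)) {y. s y \<noteq> 0}"
    by (simp only: distr_lebesgue_translation)
  also have "\<dots> = emeasure lebesgue {y. s (a + y) \<noteq> 0}"
    using m by (subst emeasure_distr[OF translation_measurable]) (auto simp: vimage_def)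
  finally show "emeasure lebesgue {y \<in> space lebesgue. s (a + y) \<noteq> 0} \<noteq> \<infinity>" using s'(2) by simp
qed

lemma bochner_integrable_translation:
  fixes f :: "real \<Rightarrow> 'x::banach"
  assumes "bochner_integrable lebesgue f"
  shows "bochner_integrable lebesgue (\<lambda>t. f (a + t))"
  unfolding bochner_integrable_lebesgue_iff
proof (intro conjI allI impI)
  have f: "f \<in> borel_measurable lebesgue" using assms by (simp add: bochner_integrable_lebesgue_iff)
  show "(\<lambda>t. f (a + t)) \<in> borel_measurable lebesgue"
    by (rule measurable_compose[OF translation_measurable f])
  fix \<epsilon> :: real assume "\<epsilon> > 0"
  then obtain s where s: "simple_integrable s" "(\<integral>\<^sup>+t. norm (f t - s t) \<partial>lebesgue) < ennreal \<epsilon>"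
    using assms by (auto simp: bochner_integrable_lebesgue_iff)
  have m: "(\<lambda>t. ennreal (norm (f t - s t))) \<in> borel_measurable lebesgue"
    using simple_diff_measurable[OF f s(1)] by simp
  have "(\<integral>\<^sup>+t. norm (f t - s t) \<partial>lebesgue) = (\<integral>\<^sup>+t. norm (f t - s t) \<partial>(distr lebesgue lebesgue (\<lambda>t. a + t)))"
    by (simp only: distr_lebesgue_translation)
  also have "\<dots> = (\<integral>\<^sup>+t. norm (f (a + t) - s (a + t)) \<partial>lebesgue)"
    by (rule nn_integral_distr[OF translation_measurable]) (use m in simp)
  finally show "\<exists>s. simple_integrable s \<and> (\<integral>\<^sup>+t. norm (f (a + t) - s t) \<partial>lebesgue) < ennreal \<epsilon>"
    using s simple_integrable_translation[OF s(1)] by metis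
qed

lemma locally_bochner_integrable_translation:
  fixes f :: "real \<Rightarrow> 'x::banach"
  assumes f: "locally_bochner_integrable f"
  shows "locally_bochner_integrable (\<lambda>t. f (a + t))"
  unfolding locally_bochner_integrable_def
proof (intro allI impI)
  fix K :: "real set" assume "compact K"
  then have "compact ((+) a ` K)" by (rule compact_translation)
  then have "bochner_integrable lebesgue (\<lambda>t. indicator ((+) a ` K) (a + t) *\<^sub>R f (a + t))"
    using f unfolding locally_bochner_integrable_def by (intro bochner_integrable_translation) blast
  moreover have "indicat_real ((+) a ` K) (a + t) = indicator K t" for t by (auto simp: indicator_def)
  ultimately show "bochner_integrable lebesgue (\<lambda>t. indicator K t *\<^sub>R f (a + t))" by simp
qed

lemma locally_bochner_integrableD:
  fixes f :: "real \<Rightarrow> 'x::banach"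
  assumes "locally_bochner_integrable f"
  shows "f integrable_on {a..b}" "(\<lambda>t. norm (f t)) integrable_on {a..b}"
    "bochner_int lebesgue (\<lambda>t. indicator {a..b} t *\<^sub>R f t) = integral {a..b} f"
  using bochner_int_eq_integral[of a b f] assms unfolding locally_bochner_integrable_def by auto

lemma has_integral_translation:
  fixes f :: "real \<Rightarrow> 'x::banach"
  assumes "f integrable_on {x+a..x+b}"
  shows "((\<lambda>s. f (x + s)) has_integral integral {x+a..x+b} f) {a..b}"
  using has_integral_affinity'[of f _ "x+a" "x+b" 1 x] integrable_integral[OF assms]
  by (simp add: add.commute)

lemma bochner_int_shifted_interval:
  fixes f :: "real \<Rightarrow> 'x::banach"
  assumes f: "locally_bochner_integrable f"
  shows "bochner_int lebesgue (\<lambda>s. indicator {0..h} s *\<^sub>R f (x + s)) = integral {x..x+h} f"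
proof -
  have "bochner_int lebesgue (\<lambda>s. indicator {0..h} s *\<^sub>R f (x + s)) = integral {0..h} (\<lambda>s. f (x + s))"
    by (rule locally_bochner_integrableD(3)[OF locally_bochner_integrable_translation[OF f]])
  also have "\<dots> = integral {x..x+h} f"
    using has_integral_translation[of f x 0 h] locally_bochner_integrableD(1)[OF f] by (simp add: integral_unique)
  finally show ?thesis .
qed

lemma bochner_int_compact_support:
  fixes f :: "real \<Rightarrow> 'x::banach"
  assumes f: "locally_bochner_integrable f" and "\<And>t. t \<notin> {a..b} \<Longrightarrow> f t = 0"
  shows "bochner_int lebesgue f = integral {a..b} f"
proof -
  have "f = (\<lambda>t. indicator {a..b} t *\<^sub>R f t)" using assms(2) by (auto simp: indicator_def fun_eq_iff)
  then show ?thesis using locally_bochner_integrableD(3)[OF f, of a b] by simp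
qed

section \<open>Smooth functions and test functions\<close>

lemma nth_deriv_0 [simp]: "nth_deriv 0 \<phi> = \<phi>"
  by (simp add: nth_deriv_def)

lemma nth_deriv_Suc: "nth_deriv (Suc j) \<phi> = (\<lambda>x. vector_derivative (nth_deriv j \<phi>) (at x))"
  by (simp add: nth_deriv_def)

lemma nth_deriv_nth_deriv: "nth_deriv i (nth_deriv j \<phi>) = nth_deriv (i + j) \<phi>"
  by (simp add: nth_deriv_def funpow_add)

lemma smooth_has_vector_derivative:
  assumes "smooth \<phi>"
  shows "(nth_deriv j \<phi> has_vector_derivative nth_deriv (Suc j) \<phi> x) (at x)"
  using assms unfolding smooth_def nth_deriv_Suc by (simp add: vector_derivative_works)

text \<open>
  Iterated derivatives are computed by exhibiting the whole sequence of derivatives at once.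
\<close>

lemma smooth_chain:
  assumes 0: "D 0 = \<phi>" and D: "\<And>j x. (D j has_vector_derivative D (Suc j) x) (at x)"
  shows "smooth \<phi>" and "nth_deriv j \<phi> = D j"
proof -
  have eq: "nth_deriv j \<phi> = D j" for j
    by (induction j) (auto simp: 0 nth_deriv_Suc intro!: vector_derivative_at D)
  show "nth_deriv j \<phi> = D j" by (rule eq)
  show "smooth \<phi>" unfolding smooth_def eq using D by (blast intro: differentiableI_vector)
qed

text \<open>
  Choosing a derivative within the class \<open>P\<close> again and again yields the whole sequence of derivatives.
\<close>

lemma smooth_coinduct:
  assumes "P \<phi>" and step: "\<And>f. P f \<Longrightarrow> \<exists>g. P g \<and> (\<forall>x. (f has_vector_derivative g x) (at x))"
  shows "smooth \<phi>"
proof -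
  define G where "G = (\<lambda>f. SOME g. P g \<and> (\<forall>x. (f has_vector_derivative g x) (at x)))"
  have G: "P (G f) \<and> (\<forall>x. (f has_vector_derivative G f x) (at x))" if "P f" for f
    unfolding G_def using someI_ex[OF step[OF that]] .
  have P: "P ((G ^^ j) \<phi>)" for j by (induction j) (use assms(1) G in auto)
  show ?thesis
  proof (rule smooth_chain(1)[of "\<lambda>j. (G ^^ j) \<phi>"])
    show "((G ^^ j) \<phi> has_vector_derivative (G ^^ Suc j) \<phi> x) (at x)" for j x
      using G[OF P[of j]] by simp
  qed simp
qed

lemma smooth_nth_deriv: "smooth \<phi> \<Longrightarrow> smooth (nth_deriv j \<phi>)"
  unfolding smooth_def by (simp add: nth_deriv_nth_deriv)

lemma smooth_continuous_on: "smooth \<phi> \<Longrightarrow> continuous_on S (nth_deriv j \<phi>)"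
  using smooth_has_vector_derivative
  by (meson continuous_at_imp_continuous_on has_vector_derivative_continuous)

lemma smooth_add:
  assumes "smooth \<phi>" "smooth \<psi>"
  shows "smooth (\<lambda>x. \<phi> x + \<psi> x)" "nth_deriv j (\<lambda>x. \<phi> x + \<psi> x) = (\<lambda>x. nth_deriv j \<phi> x + nth_deriv j \<psi> x)"
  by (rule smooth_chain[where D="\<lambda>j x. nth_deriv j \<phi> x + nth_deriv j \<psi> x"];
      auto intro!: has_vector_derivative_add smooth_has_vector_derivative assms)+

lemma smooth_diff:
  assumes "smooth \<phi>" "smooth \<psi>"
  shows "smooth (\<lambda>x. \<phi> x - \<psi> x)" "nth_deriv j (\<lambda>x. \<phi> x - \<psi> x) = (\<lambda>x. nth_deriv j \<phi> x - nth_deriv j \<psi> x)"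
  by (rule smooth_chain[where D="\<lambda>j x. nth_deriv j \<phi> x - nth_deriv j \<psi> x"];
      auto intro!: has_vector_derivative_diff smooth_has_vector_derivative assms)+

lemma smooth_cmult:
  assumes "smooth \<phi>"
  shows "smooth (\<lambda>x. c * \<phi> x)" "nth_deriv j (\<lambda>x. c * \<phi> x) = (\<lambda>x. c * nth_deriv j \<phi> x)"
  by (rule smooth_chain[where D="\<lambda>j x. c * nth_deriv j \<phi> x"];
      auto intro!: has_vector_derivative_mult_right smooth_has_vector_derivative assms)+

lemma smooth_affine:
  assumes "smooth \<phi>"
  shows "smooth (\<lambda>x. \<phi> (c * x + a))" "nth_deriv j (\<lambda>x. \<phi> (c * x + a)) = (\<lambda>x. c ^ j *\<^sub>R nth_deriv j \<phi> (c * x + a))"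
proof -
  have *: "((\<lambda>x. c ^ j *\<^sub>R nth_deriv j \<phi> (c * x + a)) has_vector_derivative
       c ^ Suc j *\<^sub>R nth_deriv (Suc j) \<phi> (c * x + a)) (at x)" for j x
  proof -
    have "((\<lambda>x. c * x + a) has_vector_derivative c) (at x)"
      by (auto intro!: derivative_eq_intros simp: has_real_derivative_iff_has_vector_derivative[symmetric])
    from vector_diff_chain_at[OF this smooth_has_vector_derivative[OF assms, of j "c * x + a"]]
    have "((\<lambda>x. nth_deriv j \<phi> (c * x + a)) has_vector_derivative c *\<^sub>R nth_deriv (Suc j) \<phi> (c * x + a)) (at x)"
      by (simp add: o_def)
    from bounded_linear.has_vector_derivative[OF bounded_linear_scaleR_right this, of "c ^ j"]
    show ?thesis by (simp add: mult.commute)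
  qed
  show "smooth (\<lambda>x. \<phi> (c * x + a))" "nth_deriv j (\<lambda>x. \<phi> (c * x + a)) = (\<lambda>x. c ^ j *\<^sub>R nth_deriv j \<phi> (c * x + a))"
    by (rule smooth_chain[where D="\<lambda>j x. c ^ j *\<^sub>R nth_deriv j \<phi> (c * x + a)"]; use * in auto)+
qed

lemma smooth_shift:
  assumes "smooth \<phi>"
  shows "smooth (shift a \<phi>)" "nth_deriv j (shift a \<phi>) = shift a (nth_deriv j \<phi>)"
  using smooth_affine[OF assms, where c=1 and a=a] by (simp_all add: shift_def)

lemma smooth_reflect:
  assumes "smooth \<phi>"
  shows "smooth (\<lambda>x. \<phi> (- x))" "nth_deriv j (\<lambda>x. \<phi> (- x)) = (\<lambda>x. (-1) ^ j *\<^sub>R nth_deriv j \<phi> (- x))"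
  using smooth_affine[OF assms, where c="-1" and a=0] by simp_all

text \<open>
  Products of smooth functions are not stable under differentiation, but their finite sums are, by the Leibniz rule.
  Hence finite sums are the invariant in the coinductive proof that products are smooth.
\<close>

inductive sum_of_smooth_products :: "(real \<Rightarrow> complex) \<Rightarrow> bool" where
  product: "smooth \<phi> \<Longrightarrow> smooth \<psi> \<Longrightarrow> sum_of_smooth_products (\<lambda>x. \<phi> x * \<psi> x)"
| add: "sum_of_smooth_products f \<Longrightarrow> sum_of_smooth_products g \<Longrightarrow> sum_of_smooth_products (\<lambda>x. f x + g x)"

lemma smooth_product_derivative:
  assumes "smooth \<phi>" "smooth \<psi>"
  shows "((\<lambda>x. \<phi> x * \<psi> x) has_vector_derivative (nth_deriv 1 \<phi> x * \<psi> x + \<phi> x * nth_deriv 1 \<psi> x)) (at x)"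
  using has_vector_derivative_mult[OF smooth_has_vector_derivative[OF assms(1), of 0] smooth_has_vector_derivative[OF assms(2), of 0]]
  by (simp add: add.commute)

lemma smooth_mult:
  assumes "smooth \<phi>" "smooth \<psi>"
  shows "smooth (\<lambda>x. \<phi> x * \<psi> x)"
proof (rule smooth_coinduct[of sum_of_smooth_products])
  fix f assume "sum_of_smooth_products f"
  then show "\<exists>g. sum_of_smooth_products g \<and> (\<forall>x. (f has_vector_derivative g x) (at x))"
  proof induction
    case (product \<phi> \<psi>)
    show ?case
      using smooth_product_derivative[OF product] product
      by (intro exI[of _ "\<lambda>x. nth_deriv 1 \<phi> x * \<psi> x + \<phi> x * nth_deriv 1 \<psi> x"])
         (auto intro!: sum_of_smooth_products.intros smooth_nth_deriv)
  next
    case (add f g)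
    then obtain f' g' where "sum_of_smooth_products f'" "\<forall>x. (f has_vector_derivative f' x) (at x)"
      "sum_of_smooth_products g'" "\<forall>x. (g has_vector_derivative g' x) (at x)" by blast
    then show ?case
      by (intro exI[of _ "\<lambda>x. f' x + g' x"]) (auto intro: sum_of_smooth_products.intros has_vector_derivative_add)
  qed
qed (intro sum_of_smooth_products.product assms)

text \<open>
  The factor \<open>2 ^ j\<close> counts the terms produced by \<open>j\<close> applications of the product rule.
\<close>

lemma nth_deriv_mult_bound:
  assumes "smooth \<phi>" "smooth \<psi>"
    and "\<And>i. i \<le> j \<Longrightarrow> norm (nth_deriv i \<phi> x) \<le> A" "\<And>i. i \<le> j \<Longrightarrow> norm (nth_deriv i \<psi> x) \<le> B"
  shows "norm (nth_deriv j (\<lambda>x. \<phi> x * \<psi> x) x) \<le> 2 ^ j * (A * B)"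
  using assms
proof (induction j arbitrary: \<phi> \<psi>)
  case 0
  then have "norm (\<phi> x) \<le> A" "norm (\<psi> x) \<le> B" by auto
  moreover from this have "A \<ge> 0" using norm_ge_zero order_trans by blast
  ultimately show ?case by (auto simp: norm_mult intro!: mult_mono)
next
  case (Suc j)
  have "nth_deriv 1 (\<lambda>x. \<phi> x * \<psi> x) = (\<lambda>x. nth_deriv 1 \<phi> x * \<psi> x + \<phi> x * nth_deriv 1 \<psi> x)"
    using smooth_product_derivative[OF Suc.prems(1,2)]
    by (auto simp: nth_deriv_Suc vector_derivative_at)
  then have "nth_deriv (Suc j) (\<lambda>x. \<phi> x * \<psi> x) = nth_deriv j (\<lambda>x. nth_deriv 1 \<phi> x * \<psi> x + \<phi> x * nth_deriv 1 \<psi> x)"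
    using nth_deriv_nth_deriv[of j 1] by (metis add.commute plus_1_eq_Suc)
  also have "\<dots> = (\<lambda>x. nth_deriv j (\<lambda>x. nth_deriv 1 \<phi> x * \<psi> x) x + nth_deriv j (\<lambda>x. \<phi> x * nth_deriv 1 \<psi> x) x)"
    by (intro smooth_add smooth_mult smooth_nth_deriv Suc.prems(1,2))
  finally have eq: "nth_deriv (Suc j) (\<lambda>x. \<phi> x * \<psi> x) x
    = nth_deriv j (\<lambda>x. nth_deriv 1 \<phi> x * \<psi> x) x + nth_deriv j (\<lambda>x. \<phi> x * nth_deriv 1 \<psi> x) x" by simp
  have "norm (nth_deriv j (\<lambda>x. nth_deriv 1 \<phi> x * \<psi> x) x) \<le> 2 ^ j * (A * B)"
    by (rule Suc.IH) (use Suc.prems in \<open>auto simp: nth_deriv_nth_deriv intro: smooth_nth_deriv\<close>)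
  moreover have "norm (nth_deriv j (\<lambda>x. \<phi> x * nth_deriv 1 \<psi> x) x) \<le> 2 ^ j * (A * B)"
    by (rule Suc.IH) (use Suc.prems in \<open>auto simp: nth_deriv_nth_deriv intro: smooth_nth_deriv\<close>)
  ultimately show ?case unfolding eq by (intro order_trans[OF norm_triangle_ineq]) simp
qed

lemma nth_deriv_zero_off_closed:
  assumes "closed K" "\<And>x. x \<notin> K \<Longrightarrow> \<phi> x = 0" "x \<notin> K"
  shows "nth_deriv j \<phi> x = 0"
  using assms(3)
proof (induction j arbitrary: x)
  case (Suc j)
  have "(nth_deriv j \<phi> has_vector_derivative 0) (at x)"
  proof (rule has_vector_derivative_transform_within_open[of "\<lambda>_. 0" _ _ "- K"])
    show "open (- K)" "x \<in> - K" using assms(1) Suc.prems by auto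
  qed (use Suc.IH in auto)
  then show ?case by (simp add: nth_deriv_Suc vector_derivative_at)
qed (use assms in auto)

lemma test_functions_onD:
  assumes "\<phi> \<in> test_functions_on K"
  shows "smooth \<phi>" "x \<notin> K \<Longrightarrow> \<phi> x = 0" "closed K \<Longrightarrow> x \<notin> K \<Longrightarrow> nth_deriv j \<phi> x = 0"
  using assms nth_deriv_zero_off_closed[of K \<phi> x j] by (auto simp: test_functions_on_def)

lemma test_functions_on_mono: "K \<subseteq> L \<Longrightarrow> test_functions_on K \<subseteq> test_functions_on L"
  by (auto simp: test_functions_on_def)

lemma test_functions_on_subset: "compact K \<Longrightarrow> \<phi> \<in> test_functions_on K \<Longrightarrow> \<phi> \<in> test_functions"
  by (auto simp: test_functions_def)

lemma test_functions_smooth: "\<phi> \<in> test_functions \<Longrightarrow> smooth \<phi>"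
  by (auto simp: test_functions_def test_functions_on_def)

lemma test_functions_supportE:
  assumes "\<phi> \<in> test_functions"
  obtains R where "R > 0" "\<phi> \<in> test_functions_on {-R..R}"
proof -
  obtain K where K: "compact K" "\<phi> \<in> test_functions_on K" using assms by (auto simp: test_functions_def)
  obtain R where R: "R > 0" "\<And>t. t \<in> K \<Longrightarrow> \<bar>t\<bar> \<le> R"
    using compact_imp_bounded[OF K(1)] unfolding bounded_pos by auto
  then have "K \<subseteq> {-R..R}" by (force simp: abs_le_iff)
  then show thesis using that R(1) K(2) test_functions_on_mono by blast
qed

lemma test_functions_on_enlarge: "\<phi> \<in> test_functions_on {-R..R} \<Longrightarrow> R \<le> R' \<Longrightarrow> \<phi> \<in> test_functions_on {-R'..R'}"
  using test_functions_on_mono[of "{-R..R}" "{-R'..R'}"] by auto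

lemma test_functions_on_bounded:
  assumes "\<phi> \<in> test_functions_on K" "compact K"
  shows "\<exists>B>0. \<forall>j\<le>k. \<forall>x. norm (nth_deriv j \<phi> x) \<le> B"
proof -
  have "\<exists>B>0. \<forall>x. norm (nth_deriv j \<phi> x) \<le> B" for j
  proof -
    have "bounded (nth_deriv j \<phi> ` K)"
      by (intro compact_imp_bounded compact_continuous_image smooth_continuous_on test_functions_onD[OF assms(1)] assms(2))
    then obtain B where B: "B > 0" "\<And>x. x \<in> K \<Longrightarrow> norm (nth_deriv j \<phi> x) \<le> B"
      unfolding bounded_pos by auto
    have "norm (nth_deriv j \<phi> x) \<le> B" for x
      using B test_functions_onD(3)[OF assms(1) compact_imp_closed[OF assms(2)], of x j] by (cases "x \<in> K") auto
    with B show ?thesis by blast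
  qed
  then obtain B where B: "\<And>j. B j > 0" "\<And>j x. norm (nth_deriv j \<phi> x) \<le> B j" by metis
  have "norm (nth_deriv j \<phi> x) \<le> (\<Sum>i\<le>k. B i)" if "j \<le> k" for j x
  proof -
    have "B j \<le> (\<Sum>i\<le>k. B i)" by (rule member_le_sum) (use that B(1) less_imp_le in auto)
    then show ?thesis using B(2) order_trans by blast
  qed
  moreover have "(\<Sum>i\<le>k. B i) > 0" using B(1) by (intro sum_pos) auto
  ultimately show ?thesis by blast
qed

lemma test_functions_bounded:
  assumes "\<phi> \<in> test_functions"
  shows "\<exists>B>0. \<forall>j\<le>k. \<forall>x. norm (nth_deriv j \<phi> x) \<le> B"
  using assms test_functions_on_bounded by (auto simp: test_functions_def)

lemma test_functions_on_add: "\<phi> \<in> test_functions_on K \<Longrightarrow> \<psi> \<in> test_functions_on K \<Longrightarrow> (\<lambda>x. \<phi> x + \<psi> x) \<in> test_functions_on K"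
  by (auto simp: test_functions_on_def smooth_add)

lemma test_functions_on_diff: "\<phi> \<in> test_functions_on K \<Longrightarrow> \<psi> \<in> test_functions_on K \<Longrightarrow> (\<lambda>x. \<phi> x - \<psi> x) \<in> test_functions_on K"
  by (auto simp: test_functions_on_def smooth_diff)

lemma test_functions_on_cmult: "\<phi> \<in> test_functions_on K \<Longrightarrow> (\<lambda>x. c * \<phi> x) \<in> test_functions_on K"
  by (auto simp: test_functions_on_def smooth_cmult)

lemma test_functions_on_shift: "\<phi> \<in> test_functions_on {a..b} \<Longrightarrow> shift c \<phi> \<in> test_functions_on {a-c..b-c}"
  by (auto simp: test_functions_on_def smooth_shift) (auto simp: shift_def)

lemma test_functions_on_reflect: "\<phi> \<in> test_functions_on {a..b} \<Longrightarrow> (\<lambda>x. \<phi> (- x)) \<in> test_functions_on {-b..-a}"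
  by (auto simp: test_functions_on_def smooth_reflect)

lemma test_functions_on_nth_deriv: "\<phi> \<in> test_functions_on K \<Longrightarrow> closed K \<Longrightarrow> nth_deriv j \<phi> \<in> test_functions_on K"
  using test_functions_onD(3)[of \<phi> K] by (auto simp: test_functions_on_def smooth_nth_deriv)

lemma test_functions_common_support:
  assumes "\<phi> \<in> test_functions" "\<psi> \<in> test_functions"
  obtains R where "R > 0" "\<phi> \<in> test_functions_on {-R..R}" "\<psi> \<in> test_functions_on {-R..R}"
proof -
  obtain R S where "R > 0" "\<phi> \<in> test_functions_on {-R..R}" "S > 0" "\<psi> \<in> test_functions_on {-S..S}"
    using assms by (metis test_functions_supportE)
  then show thesis using that[of "max R S"] test_functions_on_enlarge
    by (metis less_max_iff_disj max.cobounded1 max.cobounded2)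
qed

lemma test_functions_add: "\<phi> \<in> test_functions \<Longrightarrow> \<psi> \<in> test_functions \<Longrightarrow> (\<lambda>x. \<phi> x + \<psi> x) \<in> test_functions"
  by (metis test_functions_common_support test_functions_on_add test_functions_on_subset compact_Icc)

lemma test_functions_diff: "\<phi> \<in> test_functions \<Longrightarrow> \<psi> \<in> test_functions \<Longrightarrow> (\<lambda>x. \<phi> x - \<psi> x) \<in> test_functions"
  by (metis test_functions_common_support test_functions_on_diff test_functions_on_subset compact_Icc)

lemma test_functions_cmult: "\<phi> \<in> test_functions \<Longrightarrow> (\<lambda>x. c * \<phi> x) \<in> test_functions"
  by (metis test_functions_supportE test_functions_on_cmult test_functions_on_subset compact_Icc)

lemma test_functions_shift: "\<phi> \<in> test_functions \<Longrightarrow> shift c \<phi> \<in> test_functions"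
  by (metis test_functions_supportE test_functions_on_shift test_functions_on_subset compact_Icc)

lemma test_functions_reflect: "\<phi> \<in> test_functions \<Longrightarrow> (\<lambda>x. \<phi> (- x)) \<in> test_functions"
  by (metis test_functions_supportE test_functions_on_reflect test_functions_on_subset compact_Icc)

lemma test_functions_nth_deriv: "\<phi> \<in> test_functions \<Longrightarrow> nth_deriv j \<phi> \<in> test_functions"
  by (metis test_functions_supportE test_functions_on_nth_deriv test_functions_on_subset compact_Icc closed_atLeastAtMost)

text \<open>
  The integral from the left end of the support is locally constant outside \<open>{a..b}\<close>. With total integral 0 the
  antiderivative is again a test function; with total integral 1 it is a smooth step.
\<close>

lemma test_functions_antiderivative:
  assumes \<phi>: "\<phi> \<in> test_functions_on {a..b}" and ab: "a \<le> b"
  shows "\<exists>\<theta>. smooth \<theta> \<and> nth_deriv 1 \<theta> = \<phi> \<and> (\<forall>x\<le>a. \<theta> x = 0) \<and> (\<forall>x\<ge>b. \<theta> x = integral {a..b} \<phi>)"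
proof -
  (* Starting at a - 1 makes the endpoint a an interior point, where the derivative is two-sided. *)
  define \<theta> where "\<theta> = (\<lambda>x. integral {a-1..x} \<phi>)"
  have cont: "continuous_on S \<phi>" for S
    using smooth_continuous_on[OF test_functions_onD(1)[OF \<phi>], of S 0] by simp
  have zero: "\<phi> x = 0" if "x < a \<or> x > b" for x using test_functions_onD(2)[OF \<phi>, of x] that by auto
  (* The support may touch a, but continuity from the left forces the value 0 there. *)
  have zero_a: "\<phi> a = 0"
  proof (rule ccontr)
    assume "\<phi> a \<noteq> 0"
    have "isCont \<phi> a" using cont[of UNIV] by (simp add: continuous_on_eq_continuous_at)
    then have "(\<phi> \<longlongrightarrow> \<phi> a) (at_left a)"
      by (simp add: continuous_within isCont_def filterlim_at_split)
    moreover have "(\<phi> \<longlongrightarrow> 0) (at_left a)"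
      by (rule tendsto_eventually) (auto simp: eventually_at_left_field zero intro!: exI[of _ "a - 1"])
    ultimately show False using \<open>\<phi> a \<noteq> 0\<close> tendsto_unique trivial_limit_at_left_real by blast
  qed
  have left: "\<theta> x = 0" if "x \<le> a" for x
  proof -
    have "\<theta> x = integral {a-1..x} (\<lambda>_. 0 :: complex)" unfolding \<theta>_def
    proof (rule Henstock_Kurzweil_Integration.integral_cong)
      fix y assume "y \<in> {a-1..x}"
      then show "\<phi> y = 0" using that zero[of y] zero_a by (cases "y = a") auto
    qed
    then show ?thesis by simp
  qed
  have right: "\<theta> x = integral {a..b} \<phi>" if "x \<ge> b" for x
  proof -
    have i: "\<phi> integrable_on {c..d}" for c d by (intro integrable_continuous_real cont)
    have "\<theta> x = integral {a-1..a} \<phi> + integral {a..x} \<phi>" unfolding \<theta>_def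
      using that ab by (intro Henstock_Kurzweil_Integration.integral_combine[symmetric] i) auto
    also have "integral {a..x} \<phi> = integral {a..b} \<phi> + integral {b..x} \<phi>"
      using that ab by (intro Henstock_Kurzweil_Integration.integral_combine[symmetric] i) auto
    also have "integral {a-1..a} \<phi> = 0" using left[of a] by (simp add: \<theta>_def)
    also have "integral {b..x} \<phi> = 0"
    proof -
      have "integral {b..x} \<phi> = integral {b..x} (\<lambda>_. 0 :: complex)"
        by (rule integral_spike[of "{b}"]) (use zero in auto)
      then show ?thesis by simp
    qed
    finally show ?thesis by simp
  qed
  have deriv: "(\<theta> has_vector_derivative \<phi> x) (at x)" for x
  proof (cases "x < a")
    case True
    have "(\<theta> has_vector_derivative 0) (at x)"
      by (rule has_vector_derivative_transform_within_open[of "\<lambda>_. 0" _ _ "{..<a}"]) (use True left in auto)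
    then show ?thesis using zero[of x] True by simp
  next
    case False
    have "(\<theta> has_vector_derivative \<phi> x) (at x within {a-1..x+1})"
      unfolding \<theta>_def by (rule integral_has_vector_derivative[OF cont]) (use False in auto)
    moreover have "at x within {a-1..x+1} = at x" by (rule at_within_interior) (use False in auto)
    ultimately show ?thesis by simp
  qed
  have D: "((case j of 0 \<Rightarrow> \<theta> | Suc i \<Rightarrow> nth_deriv i \<phi>) has_vector_derivative nth_deriv j \<phi> x) (at x)" for j x
    by (cases j) (auto intro: deriv smooth_has_vector_derivative test_functions_onD(1)[OF \<phi>])
  note chain = smooth_chain[of "\<lambda>j. case j of 0 \<Rightarrow> \<theta> | Suc i \<Rightarrow> nth_deriv i \<phi>" \<theta>]
  show ?thesis
  proof (intro exI[of _ \<theta>] conjI)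
    show "smooth \<theta>" by (rule chain(1)) (use D in auto)
    show "nth_deriv 1 \<theta> = \<phi>" using chain(2)[of 1] D by auto
  qed (use left right in auto)
qed

section \<open>Bump functions\<close>

text \<open>
  The functions \<open>p(1/x) exp(-1/x)\<close>, extended by 0 to the left, vanish to infinite order at 0 and are stable
  under differentiation.
\<close>

definition flat :: "real poly \<Rightarrow> real \<Rightarrow> real" where
  "flat p x = (if x > 0 then poly p (1 / x) * exp (- 1 / x) else 0)"

lemma poly_over_exp_tendsto_0: "((\<lambda>y. poly p y / exp y) \<longlongrightarrow> 0) at_top" for p :: "real poly"
proof -
  have "((\<lambda>y. \<Sum>i\<le>degree p. coeff p i * (y ^ i / exp y)) \<longlongrightarrow> (\<Sum>i\<le>degree p. coeff p i * 0)) at_top"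
    by (intro tendsto_intros tendsto_power_div_exp_0)
  then show ?thesis by (simp add: poly_altdef sum_divide_distrib)
qed

text \<open>
  For \<open>x > 0\<close> the chain rule produces the polynomial \<open>y\<^sup>2 (p - p')\<close> in \<open>y = 1/x\<close>; at 0 the difference quotient
  tends to 0 because the exponential beats every polynomial.
\<close>

lemma flat_DERIV: "(flat p has_real_derivative flat ([:0, 0, 1:] * (p - pderiv p)) x) (at x)"
proof (cases "x = 0")
  case False
  show ?thesis
  proof (cases "x > 0")
    case True
    have "((\<lambda>x. poly p (1 / x) * exp (- 1 / x)) has_real_derivative
      poly p (1/x) * (exp (- 1 / x) * (1 / x^2)) + (poly (pderiv p) (1 / x) * (- 1 / x^2)) * exp (- 1 / x)) (at x)"
      using True by (auto intro!: derivative_eq_intros DERIV_chain2[OF poly_DERIV] simp: power2_eq_square)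
    then have "(flat p has_real_derivative
      poly p (1/x) * (exp (- 1 / x) * (1 / x^2)) + (poly (pderiv p) (1 / x) * (- 1 / x^2)) * exp (- 1 / x)) (at x)"
      by (rule has_field_derivative_transform_within_open[where S="{0<..}"]) (use True in \<open>auto simp: flat_def\<close>)
    moreover have "poly p (1/x) * (exp (- 1 / x) * (1 / x^2)) + (poly (pderiv p) (1 / x) * (- 1 / x^2)) * exp (- 1 / x)
        = flat ([:0, 0, 1:] * (p - pderiv p)) x"
      using True by (simp add: flat_def power2_eq_square field_simps)
    ultimately show ?thesis by simp
  next
    case f: False
    have "(flat p has_real_derivative 0) (at x)"
      by (rule has_field_derivative_transform_within_open[where f="\<lambda>_. 0" and S="{..<0}"]) (use f False in \<open>auto simp: flat_def\<close>)
    then show ?thesis using f by (simp add: flat_def)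
  qed
next
  case True
  have right: "((\<lambda>h. flat p h / h) \<longlongrightarrow> 0) (at_right 0)"
  proof (rule Lim_transform_eventually)
    show "((\<lambda>h. poly ([:0, 1:] * p) (inverse h) / exp (inverse h)) \<longlongrightarrow> 0) (at_right 0)"
      by (rule filterlim_compose[OF poly_over_exp_tendsto_0 filterlim_inverse_at_top_right])
    show "\<forall>\<^sub>F h in at_right 0. poly ([:0, 1:] * p) (inverse h) / exp (inverse h) = flat p h / h"
      by (auto simp: eventually_at_right_field flat_def exp_minus field_simps inverse_eq_divide intro!: exI[of _ 1])
  qed
  have left: "((\<lambda>h. flat p h / h) \<longlongrightarrow> 0) (at_left 0)"
    by (rule tendsto_eventually) (auto simp: eventually_at_left_field flat_def intro!: exI[of _ "-1"])
  have "((\<lambda>h. flat p h / h) \<longlongrightarrow> 0) (at 0)"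
    using left right by (simp add: filterlim_at_split)
  then show ?thesis using True by (simp add: DERIV_def flat_def)
qed

lemma smooth_flat: "smooth (\<lambda>x. complex_of_real (flat p x))"
proof (rule smooth_coinduct[of "\<lambda>f. \<exists>p. f = (\<lambda>x. complex_of_real (flat p x))"])
  fix f assume "\<exists>p. f = (\<lambda>x. complex_of_real (flat p x))"
  then obtain p where f: "f = (\<lambda>x. complex_of_real (flat p x))" by blast
  have "(f has_vector_derivative complex_of_real (flat ([:0, 0, 1:] * (p - pderiv p)) x)) (at x)" for x
    unfolding f using flat_DERIV[of p x]
    by (intro bounded_linear.has_vector_derivative[OF bounded_linear_of_real])
       (simp add: has_real_derivative_iff_has_vector_derivative)
  then show "\<exists>g. (\<exists>p. g = (\<lambda>x. complex_of_real (flat p x))) \<and> (\<forall>x. (f has_vector_derivative g x) (at x))" by blast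
qed blast

text \<open>
  The support lies to the right of 0, so that mollifying, like averaging over the past, is a superposition of
  the translates by \<open>s\<close> with \<open>0 \<le> s \<le> r\<close>.
\<close>

definition mollifier :: "real \<Rightarrow> (real \<Rightarrow> real) \<Rightarrow> bool" where
  "mollifier r \<beta> \<longleftrightarrow> (\<lambda>x. complex_of_real (\<beta> x)) \<in> test_functions_on {0..r} \<and> (\<forall>x. \<beta> x \<ge> 0) \<and>
     continuous_on UNIV \<beta> \<and> integral {0..r} \<beta> = 1"

text \<open>
  The product \<open>flat 1 x * flat 1 (r - x)\<close> is smooth and positive exactly on the open interval from 0 to \<open>r\<close>; divide
  it by its integral.
\<close>

lemma mollifier_exists:
  assumes r: "r > 0"
  shows "\<exists>\<beta>. mollifier r \<beta>"
proof -
  define b where "b = (\<lambda>x. flat 1 x * flat 1 (r - x))"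
  have sm: "smooth (\<lambda>x. complex_of_real (b x))"
  proof -
    have "smooth (\<lambda>x. complex_of_real (flat 1 ((-1) * x + r)))" by (rule smooth_affine(1)[OF smooth_flat])
    then have "smooth (\<lambda>x. complex_of_real (flat 1 (r - x)))" by simp
    from smooth_mult[OF smooth_flat this] show ?thesis by (simp add: b_def)
  qed
  have fc: "continuous_on UNIV (flat p)" for p
    using flat_DERIV by (meson DERIV_isCont continuous_at_imp_continuous_on)
  have bc: "continuous_on UNIV b" unfolding b_def
    by (intro continuous_on_mult fc continuous_on_compose2[OF fc] continuous_intros) auto
  have b0: "b x \<ge> 0" for x by (simp add: b_def flat_def)
  have bz: "b x = 0" if "x \<notin> {0..r}" for x using that by (auto simp: b_def flat_def)
  define c where "c = integral {0..r} b"
  have "c \<noteq> 0"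
  proof
    assume "c = 0"
    then have "b (r/2) = 0"
      using integral_eq_0_iff[of 0 r b] continuous_on_subset[OF bc] b0 r by (auto simp: c_def)
    then show False using r by (simp add: b_def flat_def)
  qed
  moreover have "c \<ge> 0" unfolding c_def by (intro Henstock_Kurzweil_Integration.integral_nonneg integrable_continuous_real continuous_on_subset[OF bc]) (auto simp: b0)
  ultimately have c: "c > 0" by simp
  have "mollifier r (\<lambda>x. b x / c)"
    unfolding mollifier_def
  proof (intro conjI)
    show "(\<lambda>x. complex_of_real (b x / c)) \<in> test_functions_on {0..r}"
      using smooth_cmult(1)[OF sm, of "inverse (complex_of_real c)"] bz
      by (auto simp: test_functions_on_def divide_inverse mult.commute)
    show "continuous_on UNIV (\<lambda>x. b x / c)" using c by (intro continuous_intros bc) auto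
    show "integral {0..r} (\<lambda>x. b x / c) = 1" using c by (simp add: c_def)
  qed (use b0 c in auto)
  then show ?thesis by blast
qed

lemma mollifier_integral:
  assumes "mollifier r \<beta>"
  shows "(\<beta> has_integral 1) {0..r}" "((\<lambda>x. complex_of_real (\<beta> x)) has_integral 1) {0..r}"
proof -
  have i: "\<beta> integrable_on {0..r}"
    using assms by (auto simp: mollifier_def intro: integrable_continuous_real continuous_on_subset)
  then show b: "(\<beta> has_integral 1) {0..r}"
    using assms by (metis integrable_integral mollifier_def)
  show "((\<lambda>x. complex_of_real (\<beta> x)) has_integral 1) {0..r}"
    using has_integral_of_real[OF b] by simp
qed

lemma LINT_test_function:
  assumes "\<phi> \<in> test_functions_on {a..b}"
  shows "(LINT x|lebesgue. \<phi> x) = integral {a..b} \<phi>"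
proof -
  have "\<phi> absolutely_integrable_on {a..b}"
    using smooth_continuous_on[OF test_functions_onD(1)[OF assms], of "{a..b}" 0]
    by (intro absolutely_integrable_continuous_real) simp
  then have "set_lebesgue_integral lebesgue {a..b} \<phi> = integral {a..b} \<phi>"
    by (rule set_lebesgue_integral_eq_integral(2))
  moreover have "indicat_real {a..b} x *\<^sub>R \<phi> x = \<phi> x" for x
    using test_functions_onD(2)[OF assms, of x] by (auto simp: indicator_def)
  ultimately show ?thesis by (simp add: set_lebesgue_integral_def)
qed

section \<open>Distributions and their local order\<close>

definition linear_on_tests :: "((real \<Rightarrow> complex) \<Rightarrow> 'x::complex_banach) \<Rightarrow> bool" where
  "linear_on_tests T \<longleftrightarrow> (\<forall>\<phi>\<in>test_functions. \<forall>\<psi>\<in>test_functions. T (\<lambda>x. \<phi> x + \<psi> x) = T \<phi> + T \<psi>) \<and>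
     (\<forall>\<phi>\<in>test_functions. \<forall>c. T (\<lambda>x. c * \<phi> x) = c *\<^sub>C T \<phi>)"

text \<open>
  The least admissible \<open>B\<close> is the largest of the sup norms of the derivatives up to order \<open>k\<close>, so this says that \<open>T\<close> has
  order at most \<open>k\<close> on \<open>K\<close>, with constant \<open>C\<close>.
\<close>

definition order_bound :: "((real \<Rightarrow> complex) \<Rightarrow> 'x::real_normed_vector) \<Rightarrow> real set \<Rightarrow> nat \<Rightarrow> real \<Rightarrow> bool" where
  "order_bound T K k C \<longleftrightarrow> (\<forall>\<phi>\<in>test_functions_on K. \<forall>B. (\<forall>j\<le>k. \<forall>x. norm (nth_deriv j \<phi> x) \<le> B) \<longrightarrow> norm (T \<phi>) \<le> C * B)"

lemma order_boundD: "order_bound T K k C \<Longrightarrow> \<phi> \<in> test_functions_on K \<Longrightarrow> (\<And>j x. j \<le> k \<Longrightarrow> norm (nth_deriv j \<phi> x) \<le> B) \<Longrightarrow> norm (T \<phi>) \<le> C * B"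
  unfolding order_bound_def by blast

lemma linear_on_tests_add: "linear_on_tests T \<Longrightarrow> \<phi> \<in> test_functions \<Longrightarrow> \<psi> \<in> test_functions \<Longrightarrow> T (\<lambda>x. \<phi> x + \<psi> x) = T \<phi> + T \<psi>"
  unfolding linear_on_tests_def by simp

lemma linear_on_tests_cmult: "linear_on_tests T \<Longrightarrow> \<phi> \<in> test_functions \<Longrightarrow> T (\<lambda>x. c * \<phi> x) = c *\<^sub>C T \<phi>"
  unfolding linear_on_tests_def by simp

lemma zero_test_function: "(\<lambda>x. 0) \<in> test_functions_on K"
proof -
  have "smooth (\<lambda>x. 0)" by (rule smooth_chain(1)[of "\<lambda>j x. 0"]) auto
  then show ?thesis by (simp add: test_functions_on_def)
qed

lemma linear_on_tests_zero: "linear_on_tests T \<Longrightarrow> T (\<lambda>x. 0) = 0"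
proof -
  assume T: "linear_on_tests T"
  have "(\<lambda>x. 0) \<in> test_functions" by (rule test_functions_on_subset[OF compact_Icc zero_test_function])
  from linear_on_tests_cmult[OF T this, of 0] show ?thesis by (simp add: scaleC.zero_left)
qed

lemma linear_on_tests_diff:
  assumes T: "linear_on_tests T" and "\<phi> \<in> test_functions" "\<psi> \<in> test_functions"
  shows "T (\<lambda>x. \<phi> x - \<psi> x) = T \<phi> - T \<psi>"
proof -
  have "T (\<lambda>x. \<phi> x + (-1) * \<psi> x) = T \<phi> + T (\<lambda>x. (-1) * \<psi> x)"
    by (intro linear_on_tests_add assms test_functions_cmult)
  also have "T (\<lambda>x. (-1) * \<psi> x) = (-1) *\<^sub>C T \<psi>" by (intro linear_on_tests_cmult assms)
  finally show ?thesis by (simp add: scaleC.minus_left)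
qed

lemma linear_on_tests_sum:
  assumes T: "linear_on_tests T" and "finite I" "\<And>i. i \<in> I \<Longrightarrow> f i \<in> test_functions"
  shows "(\<lambda>x. \<Sum>i\<in>I. f i x) \<in> test_functions \<and> T (\<lambda>x. \<Sum>i\<in>I. f i x) = (\<Sum>i\<in>I. T (f i))"
  using assms(2,3)
proof (induction I)
  case empty
  have "(\<lambda>x. 0) \<in> test_functions" by (rule test_functions_on_subset[OF compact_Icc zero_test_function])
  then show ?case using linear_on_tests_zero[OF T] by simp
next
  case (insert i I)
  then have IH: "(\<lambda>x. \<Sum>i\<in>I. f i x) \<in> test_functions" "T (\<lambda>x. \<Sum>i\<in>I. f i x) = (\<Sum>i\<in>I. T (f i))" and fi: "f i \<in> test_functions" by auto
  have "T (\<lambda>x. f i x + (\<Sum>i\<in>I. f i x)) = T (f i) + T (\<lambda>x. \<Sum>i\<in>I. f i x)"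
    by (rule linear_on_tests_add[OF T fi IH(1)])
  then show ?case using IH fi test_functions_add[OF fi IH(1)] insert by simp
qed

text \<open>
  By homogeneity a bound on one ball of the seminorm gives the estimate everywhere. If all derivatives in question
  vanish, scaling the function up arbitrarily far forces \<open>T \<phi> = 0\<close>.
\<close>

lemma order_bound_scaling:
  fixes T :: "(real \<Rightarrow> complex) \<Rightarrow> 'x::complex_banach"
  assumes T: "linear_on_tests T" and K: "compact K" and d: "d > 0"
    and M: "\<And>\<phi>. \<phi> \<in> test_functions_on K \<Longrightarrow> (\<And>j x. j \<le> k \<Longrightarrow> norm (nth_deriv j \<phi> x) \<le> d) \<Longrightarrow> norm (T \<phi>) \<le> M"
  shows "order_bound T K k (M / d)"
  unfolding order_bound_def
proof (intro ballI allI impI)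
  fix \<phi> B assume \<phi>: "\<phi> \<in> test_functions_on K" and B: "\<forall>j\<le>k. \<forall>x. norm (nth_deriv j \<phi> x) \<le> B"
  have B0: "B \<ge> 0" using B norm_ge_zero order_trans by (metis le0)
  have key: "norm (T \<phi>) \<le> M / d * B'" if B': "B' > 0" "B \<le> B'" for B'
  proof -
    have "norm (T (\<lambda>x. complex_of_real (d / B') * \<phi> x)) \<le> M"
    proof (rule M)
      show "(\<lambda>x. complex_of_real (d / B') * \<phi> x) \<in> test_functions_on K" by (rule test_functions_on_cmult[OF \<phi>])
      fix j x assume "j \<le> k"
      then have "norm (nth_deriv j \<phi> x) \<le> B'" using B B' order_trans by blast
      then have "d / B' * norm (nth_deriv j \<phi> x) \<le> d / B' * B'" using d B' by (intro mult_left_mono) auto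
      then show "norm (nth_deriv j (\<lambda>x. complex_of_real (d / B') * \<phi> x) x) \<le> d"
        unfolding smooth_cmult(2)[OF test_functions_onD(1)[OF \<phi>]] norm_mult norm_of_real using d B' by simp
    qed
    moreover have "T (\<lambda>x. complex_of_real (d / B') * \<phi> x) = complex_of_real (d / B') *\<^sub>C T \<phi>"
      by (rule linear_on_tests_cmult[OF T test_functions_on_subset[OF K \<phi>]])
    ultimately have "d / B' * norm (T \<phi>) \<le> M" using d B' by (simp add: norm_scaleC norm_divide)
    then show ?thesis using d B' by (simp add: field_simps)
  qed
  show "norm (T \<phi>) \<le> M / d * B"
  proof (cases "B = 0")
    case True
    have "norm (T (\<lambda>x. 0)) \<le> M"
    proof (rule M[OF zero_test_function])
      show "norm (nth_deriv j (\<lambda>x. 0) x) \<le> d" for j x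
        using nth_deriv_zero_off_closed[of "{}" "\<lambda>x. 0" x j] d by simp
    qed
    then have M0: "M \<ge> 0" using norm_ge_zero order_trans by blast
    have "norm (T \<phi>) \<le> 0 + e" if "e > 0" for e
    proof -
      have "norm (T \<phi>) \<le> M / d * (e * d / (M + 1))"
        using True d M0 that by (intro key) (auto intro!: divide_pos_pos)
      also have "\<dots> = M / (M + 1) * e" using d by simp
      also have "\<dots> \<le> 1 * e" using M0 that by (intro mult_right_mono) auto
      finally show ?thesis by simp
    qed
    then show ?thesis using True field_le_epsilon[of "norm (T \<phi>)" 0] by simp
  qed (use key[of B] B0 in simp)
qed

lemma openin_seminorm_topologyD:
  assumes "openin (seminorm_topology V P) W" "f \<in> W"
  shows "\<exists>F \<epsilon>. 0 < \<epsilon> \<and> finite F \<and> F \<subseteq> P \<and> {g \<in> V. \<forall>p\<in>F. p (\<lambda>x. g x - f x) < ennreal \<epsilon>} \<subseteq> W"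
  using assms unfolding openin_seminorm_topology by auto

text \<open>
  A neighbourhood of 0 on which \<open>norm (T \<phi>) < 1\<close> contains a finite intersection of balls of continuous seminorms;
  on test functions supported in \<open>K\<close> each of these balls contains a ball for finitely many derivatives.
\<close>

lemma distributions_order_bound:
  fixes T :: "(real \<Rightarrow> complex) \<Rightarrow> 'x::complex_banach"
  assumes T: "T \<in> distributions" and K: "compact K"
  shows "\<exists>k C. C > 0 \<and> order_bound T K k C"
proof -
  have lin: "linear_on_tests T" and cont: "continuous_map test_topology euclidean T"
    using T by (auto simp: distributions_def linear_on_tests_def)
  have z: "(\<lambda>x. 0) \<in> test_functions_on K" by (rule zero_test_function)
  then have z': "(\<lambda>x. 0) \<in> test_functions" by (rule test_functions_on_subset[OF K])
  have "openin test_topology {\<phi> \<in> topspace test_topology. T \<phi> \<in> ball 0 1}"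
    by (rule openin_continuous_map_preimage[OF cont]) (simp add: open_openin[symmetric])
  then have "\<exists>F \<epsilon>. 0 < \<epsilon> \<and> finite F \<and> F \<subseteq> {\<lambda>\<phi>. ennreal (p \<phi>) | p. seminorm_on_tests p \<and>
        (\<forall>K. compact K \<longrightarrow> continuous_map (test_topology_on K) euclideanreal p)} \<and>
      {g \<in> test_functions. \<forall>p\<in>F. p (\<lambda>x. g x - 0) < ennreal \<epsilon>} \<subseteq> {\<phi> \<in> test_functions. T \<phi> \<in> ball 0 1}"
    unfolding test_topology_def topspace_seminorm_topology
    using linear_on_tests_zero[OF lin] by (elim openin_seminorm_topologyD) (simp add: z')
  then obtain F \<epsilon> where e: "\<epsilon> > 0" "finite F" and F: "F \<subseteq> {\<lambda>\<phi>. ennreal (p \<phi>) | p. seminorm_on_tests p \<and>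
        (\<forall>K. compact K \<longrightarrow> continuous_map (test_topology_on K) euclideanreal p)}"
    and sub: "{g \<in> test_functions. \<forall>p\<in>F. p (\<lambda>x. g x - 0) < ennreal \<epsilon>} \<subseteq> {\<phi> \<in> test_functions. T \<phi> \<in> ball 0 1}"
    by blast
  have loc: "\<exists>k. \<exists>\<delta>>0. \<forall>\<phi>\<in>test_functions_on K. (\<forall>j\<le>k. \<forall>x. norm (nth_deriv j \<phi> x) \<le> \<delta>) \<longrightarrow> q \<phi> < ennreal \<epsilon>"
    if "q \<in> F" for q
  proof -
    obtain p where p: "q = (\<lambda>\<phi>. ennreal (p \<phi>))" "seminorm_on_tests p" "continuous_map (test_topology_on K) euclideanreal p"
      using F \<open>q \<in> F\<close> K by blast
    have p0: "p (\<lambda>x. 0) = 0"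
    proof -
      have "\<forall>c. p (\<lambda>x. c * 0) = cmod c * p (\<lambda>x. 0)" by (rule bspec[OF conjunct2[OF p(2)[unfolded seminorm_on_tests_def]] z'])
      then have "p (\<lambda>x. 0 * 0) = cmod 0 * p (\<lambda>x. 0)" by blast
      then show ?thesis by simp
    qed
    have "openin (test_topology_on K) {\<phi> \<in> topspace (test_topology_on K). p \<phi> \<in> {..<\<epsilon>}}"
      by (rule openin_continuous_map_preimage[OF p(3)]) (simp add: open_openin[symmetric])
    then have "\<exists>G \<delta>. 0 < \<delta> \<and> finite G \<and> G \<subseteq> range (\<lambda>j \<phi>. SUP x. ennreal (norm (nth_deriv j \<phi> x))) \<and>
       {g \<in> test_functions_on K. \<forall>p\<in>G. p (\<lambda>x. g x - 0) < ennreal \<delta>} \<subseteq> {\<phi> \<in> test_functions_on K. p \<phi> \<in> {..<\<epsilon>}}"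
      unfolding test_topology_on_def topspace_seminorm_topology
      using p0 e by (elim openin_seminorm_topologyD) (simp add: z)
    then obtain G \<delta> where \<delta>: "\<delta> > 0" "finite G" "G \<subseteq> range (\<lambda>j \<phi>. SUP x. ennreal (norm (nth_deriv j \<phi> x)))"
       and G: "{g \<in> test_functions_on K. \<forall>p\<in>G. p (\<lambda>x. g x - 0) < ennreal \<delta>} \<subseteq> {\<phi> \<in> test_functions_on K. p \<phi> \<in> {..<\<epsilon>}}" by blast
    obtain J where J: "finite J" "G = (\<lambda>j \<phi>. SUP x. ennreal (norm (nth_deriv j \<phi> x))) ` J"
      using finite_subset_image[OF \<delta>(2,3)] by blast
    obtain k where k: "\<And>j. j \<in> J \<Longrightarrow> j \<le> k" using finite_nat_set_iff_bounded_le[of J] J(1) by blast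
    show ?thesis
    proof (intro exI[of _ k] exI[of _ "\<delta>/2"] conjI ballI impI)
      show "\<delta>/2 > 0" using \<delta> by simp
      fix \<phi> assume \<phi>: "\<phi> \<in> test_functions_on K" "\<forall>j\<le>k. \<forall>x. norm (nth_deriv j \<phi> x) \<le> \<delta>/2"
      have "(SUP x. ennreal (norm (nth_deriv j \<phi> x))) < ennreal \<delta>" if "j \<in> J" for j
      proof -
        have "(SUP x. ennreal (norm (nth_deriv j \<phi> x))) \<le> ennreal (\<delta>/2)"
          using \<phi>(2) k[OF that] by (intro SUP_least ennreal_leI) auto
        also have "\<dots> < ennreal \<delta>" using \<delta>(1) by (intro ennreal_lessI) auto
        finally show ?thesis .
      qed
      then have "p \<phi> < \<epsilon>" using G \<phi>(1) J(2) by auto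
      then show "q \<phi> < ennreal \<epsilon>" using e p(1) by (simp add: ennreal_lessI)
    qed
  qed
  then obtain k \<delta> where kd: "\<And>q. q \<in> F \<Longrightarrow> \<delta> q > 0" "\<And>q \<phi>. q \<in> F \<Longrightarrow> \<phi> \<in> test_functions_on K \<Longrightarrow>
     (\<forall>j\<le>k q. \<forall>x. norm (nth_deriv j \<phi> x) \<le> \<delta> q) \<Longrightarrow> q \<phi> < ennreal \<epsilon>" by metis
  obtain k' where k': "\<And>q. q \<in> F \<Longrightarrow> k q \<le> k'"
    using finite_nat_set_iff_bounded_le[of "k ` F"] e(2) by auto
  define d where "d = Min (insert 1 (\<delta> ` F))"
  have d: "d > 0" "\<And>q. q \<in> F \<Longrightarrow> d \<le> \<delta> q" unfolding d_def using kd(1) e(2) by auto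
  have small: "norm (T \<phi>) < 1" if \<phi>K: "\<phi> \<in> test_functions_on K" and \<phi>d: "\<And>j x. j \<le> k' \<Longrightarrow> norm (nth_deriv j \<phi> x) \<le> d" for \<phi>
  proof -
    have "q \<phi> < ennreal \<epsilon>" if q: "q \<in> F" for q
    proof (rule kd(2)[OF q \<phi>K], intro allI impI)
      show "norm (nth_deriv j \<phi> x) \<le> \<delta> q" if "j \<le> k q" for j x
        by (rule order_trans[OF \<phi>d[OF order_trans[OF that k'[OF q]]] d(2)[OF q]])
    qed
    then have "T \<phi> \<in> ball 0 1" using sub \<phi>K test_functions_on_subset[OF K] by auto
    then show ?thesis by simp
  qed
  have "order_bound T K k' (1 / d)"
    by (rule order_bound_scaling[OF lin K d(1)]) (use small less_imp_le in blast)
  moreover have "1 / d > 0" using d by simp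
  ultimately show ?thesis by blast
qed

text \<open>
  For a linear map with local order bounds, \<open>\<phi> \<mapsto> norm (T \<phi>)\<close> is itself one of the seminorms that define the
  topology of test functions.
\<close>

lemma distributionsI:
  fixes T :: "(real \<Rightarrow> complex) \<Rightarrow> 'x::complex_banach"
  assumes off: "\<And>\<phi>. \<phi> \<notin> test_functions \<Longrightarrow> T \<phi> = 0" and lin: "linear_on_tests T"
    and bd: "\<And>R. R > 0 \<Longrightarrow> \<exists>k C. order_bound T {-R..R} k C"
  shows "T \<in> distributions"
proof -
  define p where "p = (\<lambda>\<phi>. norm (T \<phi>))"
  have p: "seminorm_on_tests p"
    using lin unfolding seminorm_on_tests_def linear_on_tests_def p_def by (auto simp: norm_scaleC norm_triangle_ineq)
  have Tdiff: "norm (T g - T f) = p (\<lambda>x. g x - f x)" if "g \<in> test_functions" "f \<in> test_functions" for f g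
    using linear_on_tests_diff[OF lin that] by (simp add: p_def)
  have "continuous_map (test_topology_on K) euclideanreal p" if K: "compact K" for K
    unfolding continuous_map_def
  proof (intro conjI allI impI)
    fix W :: "real set" assume W: "openin euclideanreal W"
    obtain R where R: "R > 0" "\<And>t. t \<in> K \<Longrightarrow> \<bar>t\<bar> \<le> R"
      using compact_imp_bounded[OF K] unfolding bounded_pos by auto
    then have KR: "test_functions_on K \<subseteq> test_functions_on {-R..R}"
      by (intro test_functions_on_mono) (force simp: abs_le_iff)
    obtain k C where C: "order_bound T {-R..R} k C" using bd[OF R(1)] by blast
    show "openin (test_topology_on K) {x \<in> topspace (test_topology_on K). p x \<in> W}"
      unfolding test_topology_on_def openin_seminorm_topology topspace_seminorm_topology
    proof (intro conjI ballI)
      fix f assume f: "f \<in> {x \<in> test_functions_on K. p x \<in> W}"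
      obtain e where e: "e > 0" "\<And>y. dist y (p f) < e \<Longrightarrow> y \<in> W"
        using f W by (auto simp: open_openin[symmetric] open_dist)
      define \<epsilon> where "\<epsilon> = e / (2 * (\<bar>C\<bar> + 1))"
      have \<epsilon>: "\<epsilon> > 0" "\<bar>C\<bar> * \<epsilon> < e" using e by (auto simp: \<epsilon>_def field_simps add_nonneg_pos)
      show "\<exists>F \<epsilon>. 0 < \<epsilon> \<and> finite F \<and> F \<subseteq> range (\<lambda>j \<phi>. SUP x. ennreal (cmod (nth_deriv j \<phi> x))) \<and>
          {g \<in> test_functions_on K. \<forall>p\<in>F. p (\<lambda>x. g x - f x) < ennreal \<epsilon>} \<subseteq> {x \<in> test_functions_on K. p x \<in> W}"
      proof (intro exI conjI)
        show "(\<lambda>j \<phi>. SUP x. ennreal (cmod (nth_deriv j \<phi> x))) ` {..k} \<subseteq> range (\<lambda>j \<phi>. SUP x. ennreal (cmod (nth_deriv j \<phi> x)))" by auto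
        show "{g \<in> test_functions_on K. \<forall>p\<in>(\<lambda>j \<phi>. SUP x. ennreal (cmod (nth_deriv j \<phi> x))) ` {..k}. p (\<lambda>x. g x - f x) < ennreal \<epsilon>}
           \<subseteq> {x \<in> test_functions_on K. p x \<in> W}"
        proof safe
          fix g assume g: "g \<in> test_functions_on K"
            and lt: "\<forall>p\<in>(\<lambda>j \<phi>. SUP x. ennreal (cmod (nth_deriv j \<phi> x))) ` {..k}. p (\<lambda>x. g x - f x) < ennreal \<epsilon>"
          have "norm (nth_deriv j (\<lambda>x. g x - f x) x) \<le> \<epsilon>" if "j \<le> k" for j x
          proof -
            have "ennreal (norm (nth_deriv j (\<lambda>x. g x - f x) x)) \<le> (SUP x. ennreal (cmod (nth_deriv j (\<lambda>x. g x - f x) x)))"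
              by (rule SUP_upper) simp
            also have "\<dots> < ennreal \<epsilon>" using lt that by auto
            finally show ?thesis using \<epsilon>(1) by (simp add: ennreal_less_iff)
          qed
          then have "norm (T (\<lambda>x. g x - f x)) \<le> C * \<epsilon>"
            using f g KR by (intro order_boundD[OF C]) (auto intro!: test_functions_on_diff)
          also have "\<dots> \<le> \<bar>C\<bar> * \<epsilon>" using \<epsilon> by (intro mult_right_mono) auto
          finally have "norm (T (\<lambda>x. g x - f x)) < e" using \<epsilon> by simp
          moreover have "g \<in> test_functions" "f \<in> test_functions" using f g test_functions_on_subset[OF K] by auto
          ultimately have "norm (T g - T f) < e" using linear_on_tests_diff[OF lin] by metis
          then have "dist (p g) (p f) < e" unfolding p_def dist_real_def
            using norm_triangle_ineq3[of "T g" "T f"] by simp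
          then show "p g \<in> W" by (rule e(2))
        qed
      qed (use \<epsilon> in auto)
    qed auto
  qed auto
  then have pmem: "(\<lambda>\<phi>. ennreal (p \<phi>)) \<in> {\<lambda>\<phi>. ennreal (p \<phi>) | p. seminorm_on_tests p \<and>
        (\<forall>K. compact K \<longrightarrow> continuous_map (test_topology_on K) euclideanreal p)}" using p by blast
  have "continuous_map test_topology euclidean T"
    unfolding continuous_map_def
  proof (intro conjI allI impI)
    fix W :: "'x set" assume W: "openin euclidean W"
    show "openin test_topology {x \<in> topspace test_topology. T x \<in> W}"
      unfolding test_topology_def openin_seminorm_topology topspace_seminorm_topology
    proof (intro conjI ballI)
      fix f assume f: "f \<in> {x \<in> test_functions. T x \<in> W}"
      obtain e where e: "e > 0" "\<And>y. dist y (T f) < e \<Longrightarrow> y \<in> W"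
        using f W by (auto simp: open_openin[symmetric] open_dist)
      show "\<exists>F \<epsilon>. 0 < \<epsilon> \<and> finite F \<and> F \<subseteq> {\<lambda>\<phi>. ennreal (p \<phi>) | p. seminorm_on_tests p \<and>
        (\<forall>K. compact K \<longrightarrow> continuous_map (test_topology_on K) euclideanreal p)} \<and>
        {g \<in> test_functions. \<forall>p\<in>F. p (\<lambda>x. g x - f x) < ennreal \<epsilon>} \<subseteq> {x \<in> test_functions. T x \<in> W}"
      proof (intro exI conjI)
        show "{\<lambda>\<phi>. ennreal (p \<phi>)} \<subseteq> {\<lambda>\<phi>. ennreal (p \<phi>) | p. seminorm_on_tests p \<and>
          (\<forall>K. compact K \<longrightarrow> continuous_map (test_topology_on K) euclideanreal p)}" using pmem by blast
        show "{g \<in> test_functions. \<forall>p\<in>{\<lambda>\<phi>. ennreal (p \<phi>)}. p (\<lambda>x. g x - f x) < ennreal e} \<subseteq> {x \<in> test_functions. T x \<in> W}"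
          using e f Tdiff by (auto simp: dist_norm ennreal_less_iff p_def)
      qed (use e in auto)
    qed auto
  qed auto
  then show ?thesis using off lin by (simp add: distributions_def linear_on_tests_def)
qed

lemma distributions_linear: "T \<in> distributions \<Longrightarrow> linear_on_tests T"
  by (auto simp: distributions_def linear_on_tests_def)

section \<open>Superpositions of translates\<close>

text \<open>
  The convolution of \<open>\<phi>\<close> with the weight \<open>w\<close> restricted to \<open>{a..b}\<close>. Both moving averages and mollification are of
  this form.
\<close>

definition superposition :: "(real \<Rightarrow> complex) \<Rightarrow> real \<Rightarrow> real \<Rightarrow> (real \<Rightarrow> complex) \<Rightarrow> real \<Rightarrow> complex" where
  "superposition w a b \<phi> = (\<lambda>y. integral {a..b} (\<lambda>s. w s * \<phi> (y - s)))"

lemma continuous_on_translates: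
  assumes "continuous_on UNIV w" "smooth \<phi>"
  shows "continuous_on S (\<lambda>s. w s * nth_deriv j \<phi> (y - s))"
  by (intro continuous_intros continuous_on_subset[OF assms(1)] continuous_on_compose2[OF smooth_continuous_on[OF assms(2), of UNIV j]]) auto

lemma superposition_smooth:
  assumes w: "continuous_on UNIV w" and \<phi>: "smooth \<phi>"
  shows "smooth (superposition w a b \<phi>)" "nth_deriv j (superposition w a b \<phi>) = superposition w a b (nth_deriv j \<phi>)"
proof -
  have *: "(superposition w a b (nth_deriv j \<phi>) has_vector_derivative superposition w a b (nth_deriv (Suc j) \<phi>) x) (at x)" for j x
  proof -
    have "((\<lambda>x. integral (cbox a b) (\<lambda>s. w s * nth_deriv j \<phi> (x - s))) has_vector_derivative
        integral (cbox a b) (\<lambda>s. w s * nth_deriv (Suc j) \<phi> (x - s))) (at x within UNIV)"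
    proof (rule leibniz_rule_vector_derivative)
      fix x t
      show "((\<lambda>x. w t * nth_deriv j \<phi> (x - t)) has_vector_derivative w t * nth_deriv (Suc j) \<phi> (x - t)) (at x within UNIV)"
        using smooth_has_vector_derivative[OF smooth_cmult(1)[OF smooth_shift(1)[OF \<phi>, of "-t"]], of j "w t" x]
        unfolding smooth_cmult(2)[OF smooth_shift(1)[OF \<phi>]] smooth_shift(2)[OF \<phi>] by (simp add: shift_def)
    next
      fix x show "(\<lambda>s. w s * nth_deriv j \<phi> (x - s)) integrable_on cbox a b"
        by (intro integrable_continuous continuous_on_translates[OF w \<phi>])
    next
      show "continuous_on (UNIV \<times> cbox a b) (\<lambda>(x, t). w t * nth_deriv (Suc j) \<phi> (x - t))"
        unfolding split_def
        by (intro continuous_intros continuous_on_compose2[OF w] continuous_on_compose2[OF smooth_continuous_on[OF \<phi>, of UNIV "Suc j"]]) auto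
    qed auto
    then show ?thesis by (simp add: superposition_def)
  qed
  show "smooth (superposition w a b \<phi>)" "nth_deriv j (superposition w a b \<phi>) = superposition w a b (nth_deriv j \<phi>)"
    by (rule smooth_chain[where D="\<lambda>j. superposition w a b (nth_deriv j \<phi>)"]; use * in simp)+
qed

lemma superposition_test_function:
  assumes w: "continuous_on UNIV w" and \<phi>: "\<phi> \<in> test_functions_on {c..d}"
  shows "superposition w a b \<phi> \<in> test_functions_on {c + a..d + b}"
proof -
  have "superposition w a b \<phi> y = 0" if "y \<notin> {c + a..d + b}" for y
  proof -
    have "superposition w a b \<phi> y = integral {a..b} (\<lambda>s. 0)" unfolding superposition_def
    proof (rule Henstock_Kurzweil_Integration.integral_cong)
      fix s assume "s \<in> {a..b}"
      then have "y - s \<notin> {c..d}" using that by auto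
      then show "w s * \<phi> (y - s) = 0" using test_functions_onD(2)[OF \<phi>] by simp
    qed
    then show ?thesis by simp
  qed
  then show ?thesis using superposition_smooth(1)[OF w test_functions_onD(1)[OF \<phi>]] by (simp add: test_functions_on_def)
qed

lemma superposition_in_test_functions:
  assumes w: "continuous_on UNIV w" and \<phi>: "\<phi> \<in> test_functions"
  shows "superposition w a b \<phi> \<in> test_functions"
  by (metis test_functions_supportE[OF \<phi>] superposition_test_function[OF w] test_functions_on_subset compact_Icc)

lemma integral_increment_bound:
  fixes F :: "real \<Rightarrow> 'x::banach"
  assumes F: "continuous_on {a..b} F" and t: "t \<in> {a..b}" and y: "y \<in> {a..b}"
    and M: "\<And>s. s \<in> {a..b} \<Longrightarrow> \<bar>s - t\<bar> \<le> \<bar>y - t\<bar> \<Longrightarrow> norm (F s - F t) \<le> M"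
  shows "norm (integral {a..y} F - integral {a..t} F - (y - t) *\<^sub>R F t) \<le> M * \<bar>y - t\<bar>"
proof -
  have int: "F integrable_on {u..v}" if "a \<le> u" "v \<le> b" for u v
    by (intro integrable_continuous_real continuous_on_subset[OF F]) (use that in auto)
  have main: "norm (integral {u..v} F - (v - u) *\<^sub>R F t) \<le> M * (v - u)"
    if uv: "a \<le> u" "u \<le> v" "v \<le> b" "\<And>s. s \<in> {u..v} \<Longrightarrow> \<bar>s - t\<bar> \<le> \<bar>y - t\<bar>" for u v
  proof -
    have "integral {u..v} F - (v - u) *\<^sub>R F t = integral {u..v} (\<lambda>s. F s - F t)"
      using has_integral_diff[OF integrable_integral[OF int[OF uv(1,3)]] has_integral_const_real[of "F t" u v]] uv(2)
      by (simp add: integral_unique)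
    also have "norm \<dots> \<le> M * (v - u)"
      by (rule integral_bound) (use uv M in \<open>auto intro!: continuous_intros continuous_on_subset[OF F]\<close>)
    finally show ?thesis .
  qed
  show ?thesis
  proof (cases "t \<le> y")
    case True
    have "integral {a..t} F + integral {t..y} F = integral {a..y} F"
      using True t y int by (intro Henstock_Kurzweil_Integration.integral_combine) auto
    then have "integral {a..y} F - integral {a..t} F - (y - t) *\<^sub>R F t = integral {t..y} F - (y - t) *\<^sub>R F t"
      by (metis add_diff_cancel_left')
    then show ?thesis using main[of t y] True t y by simp
  next
    case False
    have "integral {a..y} F + integral {y..t} F = integral {a..t} F"
      using False t y int by (intro Henstock_Kurzweil_Integration.integral_combine) auto
    then have "integral {a..y} F - integral {a..t} F - (y - t) *\<^sub>R F t = - (integral {y..t} F - (t - y) *\<^sub>R F t)"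
      by (simp add: algebra_simps)
    then show ?thesis using main[of y t] False t y by (simp only: norm_minus_cancel) auto
  qed
qed

lemma smooth_Lipschitz:
  assumes \<phi>: "smooth \<phi>" and B: "\<And>x. norm (nth_deriv (Suc j) \<phi> x) \<le> B"
  shows "norm (nth_deriv j \<phi> x - nth_deriv j \<phi> y) \<le> B * \<bar>x - y\<bar>"
proof -
  have "norm (nth_deriv j \<phi> x - nth_deriv j \<phi> y) \<le> B * norm (x - y)"
  proof (rule differentiable_bound[of UNIV])
    show "(nth_deriv j \<phi> has_derivative (\<lambda>h. h *\<^sub>R nth_deriv (Suc j) \<phi> x)) (at x within UNIV)" for x
      using smooth_has_vector_derivative[OF \<phi>, of j x] by (simp add: has_vector_derivative_def)
    show "onorm (\<lambda>h. h *\<^sub>R nth_deriv (Suc j) \<phi> x) \<le> B" for x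
      by (rule onorm_le) (use mult_right_mono[OF B abs_ge_zero] in \<open>simp add: mult.commute\<close>)
  qed auto
  then show ?thesis by simp
qed

text \<open>
  A distribution may be moved under the integral: as a function of the upper limit \<open>t\<close>, the value
  \<open>G t = T (superposition w a t \<phi>)\<close> has derivative \<open>w t *\<^sub>C T (shift (- t) \<phi>)\<close>, since the difference quotients of the
  superposition converge together with all derivatives and with supports in a fixed compact set. The
  fundamental theorem of calculus does the rest.
\<close>

theorem distribution_superposition:
  fixes T :: "(real \<Rightarrow> complex) \<Rightarrow> 'x::complex_banach"
  assumes T: "T \<in> distributions" and w: "continuous_on UNIV w" and \<phi>: "\<phi> \<in> test_functions" and ab: "a \<le> b"
  shows "((\<lambda>s. w s *\<^sub>C T (shift (- s) \<phi>)) has_integral T (superposition w a b \<phi>)) {a..b}"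
proof -
  have lin: "linear_on_tests T" by (rule distributions_linear[OF T])
  define G where "G = (\<lambda>t. T (superposition w a t \<phi>))"
  have "(G has_vector_derivative w t *\<^sub>C T (shift (- t) \<phi>)) (at t within {a..b})" if t: "t \<in> {a..b}" for t
    unfolding has_vector_derivative_def has_derivative_within_alt
  proof (intro conjI allI impI bounded_linear_scaleR_left)
    fix e :: real assume e: "e > 0"
    obtain R where R: "R > 0" "\<phi> \<in> test_functions_on {-R..R}" by (rule test_functions_supportE[OF \<phi>])
    define R' where "R' = R + \<bar>a\<bar> + \<bar>b\<bar>"
    obtain k C where C: "C > 0" "order_bound T {-R'..R'} k C"
      using distributions_order_bound[OF T compact_Icc] by blast
    obtain B where B: "B > 0" "\<And>j x. j \<le> Suc k \<Longrightarrow> norm (nth_deriv j \<phi> x) \<le> B"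
      using test_functions_bounded[OF \<phi>, of "Suc k"] by blast
    have "bounded (w ` {a..b})"
      by (intro compact_imp_bounded compact_continuous_image continuous_on_subset[OF w]) auto
    then obtain W where W: "W > 0" "\<And>s. s \<in> {a..b} \<Longrightarrow> norm (w s) \<le> W" unfolding bounded_pos by auto
    define \<eta> where "\<eta> = e / (C * (B * (1 + W)))"
    have P: "C * (B * (1 + W)) > 0" using C B W by simp
    have "C * (\<eta> * B + W * \<eta> * B) = \<eta> * (C * (B * (1 + W)))" by (simp add: algebra_simps)
    also have "\<dots> = e" unfolding \<eta>_def using P by (metis less_irrefl nonzero_eq_divide_eq)
    finally have \<eta>: "\<eta> > 0" "C * (\<eta> * B + W * \<eta> * B) = e" using divide_pos_pos[OF e P] by (simp_all only: \<eta>_def)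
    have "isCont w t" using w by (simp add: continuous_on_eq_continuous_at)
    then obtain d0 where d0: "d0 > 0" "\<And>s. \<bar>s - t\<bar> < d0 \<Longrightarrow> norm (w s - w t) < \<eta>"
      using \<eta>(1) unfolding continuous_at_eps_delta by (auto simp: dist_norm)
    define d where "d = min d0 \<eta>"
    show "\<exists>d>0. \<forall>y\<in>{a..b}. norm (y - t) < d \<longrightarrow> norm (G y - G t - (y - t) *\<^sub>R w t *\<^sub>C T (shift (- t) \<phi>)) \<le> e * norm (y - t)"
    proof (intro exI[of _ d] conjI ballI impI)
      show "d > 0" using d0 \<eta> by (simp add: d_def)
      fix y assume y: "y \<in> {a..b}" and yt: "norm (y - t) < d"
      define c where "c = complex_of_real (y - t) * w t"
      (* The error of the difference quotient, times y - t; its derivatives up to order k are of size \<eta> * |y - t|. *)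
      define \<zeta> where "\<zeta> = (\<lambda>z. (superposition w a y \<phi> z - superposition w a t \<phi> z) - c * shift (- t) \<phi> z)"
      have sup: "superposition w a u \<phi> \<in> test_functions_on {-R'..R'}" if "u \<in> {a..b}" for u
        by (rule set_mp[OF test_functions_on_mono superposition_test_function[OF w R(2)]]) (use that in \<open>auto simp: R'_def\<close>)
      have sh: "(\<lambda>z. c * shift (- t) \<phi> z) \<in> test_functions_on {-R'..R'}"
        by (rule test_functions_on_cmult, rule set_mp[OF test_functions_on_mono test_functions_on_shift[OF R(2)]])
           (use t in \<open>auto simp: R'_def\<close>)
      note tf = test_functions_on_subset[OF compact_Icc]
      have sm: "smooth \<phi>" by (rule test_functions_smooth[OF \<phi>])
      have "T \<zeta> = T (\<lambda>z. superposition w a y \<phi> z - superposition w a t \<phi> z) - T (\<lambda>z. c * shift (- t) \<phi> z)"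
        unfolding \<zeta>_def by (intro linear_on_tests_diff[OF lin] test_functions_diff tf[OF sup] tf[OF sh] t y)
      also have "T (\<lambda>z. superposition w a y \<phi> z - superposition w a t \<phi> z) = T (superposition w a y \<phi>) - T (superposition w a t \<phi>)"
        by (intro linear_on_tests_diff[OF lin] tf[OF sup] t y)
      also have "T (\<lambda>z. c * shift (- t) \<phi> z) = c *\<^sub>C T (shift (- t) \<phi>)"
        by (intro linear_on_tests_cmult[OF lin] test_functions_shift[OF \<phi>])
      finally have "T \<zeta> = T (superposition w a y \<phi>) - T (superposition w a t \<phi>) - c *\<^sub>C T (shift (- t) \<phi>)" .
      then have eq: "G y - G t - (y - t) *\<^sub>R w t *\<^sub>C T (shift (- t) \<phi>) = T \<zeta>"
        by (simp only: G_def c_def scaleC_scaleC[symmetric] scaleC_of_real)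
      have "norm (T \<zeta>) \<le> C * ((\<eta> * B + W * \<eta> * B) * \<bar>y - t\<bar>)"
      proof (rule order_boundD[OF C(2)])
        show "\<zeta> \<in> test_functions_on {-R'..R'}"
          unfolding \<zeta>_def by (intro test_functions_on_diff sup sh t y)
        fix j z assume j: "j \<le> k"
        define F where "F = (\<lambda>s. w s * nth_deriv j \<phi> (z - s))"
        have "nth_deriv j \<zeta> z = (nth_deriv j (superposition w a y \<phi>) z - nth_deriv j (superposition w a t \<phi>) z) - c * nth_deriv j (shift (- t) \<phi>) z"
          unfolding \<zeta>_def
          by (simp add: smooth_diff smooth_cmult superposition_smooth(1)[OF w sm] smooth_shift(1)[OF sm])
        also have "\<dots> = integral {a..y} F - integral {a..t} F - (y - t) *\<^sub>R F t"
          unfolding superposition_smooth(2)[OF w sm] smooth_shift(2)[OF sm]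
          by (simp add: superposition_def F_def shift_def c_def scaleR_conv_of_real)
        also have "norm \<dots> \<le> (\<eta> * B + W * \<eta> * B) * \<bar>y - t\<bar>"
        proof (rule integral_increment_bound[OF _ t y])
          show "continuous_on {a..b} F" unfolding F_def by (rule continuous_on_translates[OF w sm])
          fix s assume s: "s \<in> {a..b}" "\<bar>s - t\<bar> \<le> \<bar>y - t\<bar>"
          then have st: "\<bar>s - t\<bar> < d0" "\<bar>s - t\<bar> \<le> \<eta>" using yt by (auto simp: d_def)
          have "norm (nth_deriv j \<phi> (z - s) - nth_deriv j \<phi> (z - t)) \<le> B * \<bar>(z - s) - (z - t)\<bar>"
            using B(2) j by (intro smooth_Lipschitz[OF sm]) auto
          also have "\<dots> \<le> B * \<eta>" using st B by (intro mult_left_mono) auto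
          finally have lip: "norm (nth_deriv j \<phi> (z - s) - nth_deriv j \<phi> (z - t)) \<le> B * \<eta>" .
          have "F s - F t = (w s - w t) * nth_deriv j \<phi> (z - s) + w t * (nth_deriv j \<phi> (z - s) - nth_deriv j \<phi> (z - t))"
            by (simp add: F_def algebra_simps)
          also have "norm \<dots> \<le> norm (w s - w t) * norm (nth_deriv j \<phi> (z - s)) + norm (w t) * norm (nth_deriv j \<phi> (z - s) - nth_deriv j \<phi> (z - t))"
            by (metis norm_mult norm_triangle_ineq)
          also have "\<dots> \<le> \<eta> * B + W * (B * \<eta>)"
            using d0(2)[OF st(1)] B(2)[of j] j W t lip \<eta> W B by (intro add_mono mult_mono) auto
          finally show "norm (F s - F t) \<le> \<eta> * B + W * \<eta> * B" by (simp add: mult_ac)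
        qed
        finally show "norm (nth_deriv j \<zeta> z) \<le> (\<eta> * B + W * \<eta> * B) * \<bar>y - t\<bar>" .
      qed
      also have "\<dots> = e * norm (y - t)" using \<eta>(2) by (simp add: mult.assoc[symmetric])
      finally show "norm (G y - G t - (y - t) *\<^sub>R w t *\<^sub>C T (shift (- t) \<phi>)) \<le> e * norm (y - t)" unfolding eq .
    qed
  qed
  from fundamental_theorem_of_calculus[OF ab this]
  have "((\<lambda>s. w s *\<^sub>C T (shift (- s) \<phi>)) has_integral (G b - G a)) {a..b}" by simp
  moreover have "G a = 0" using linear_on_tests_zero[OF lin] by (simp add: G_def superposition_def)
  ultimately show ?thesis by (simp add: G_def)
qed

section \<open>Orbits under translation\<close>

text \<open>
  The values of \<open>T\<close> on all translates of one test function: this is the convolution of \<open>T\<close> with the reflected test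
  function, and it is more convenient than the convolution because only translations occur.
\<close>

definition orbit :: "((real \<Rightarrow> complex) \<Rightarrow> 'x) \<Rightarrow> (real \<Rightarrow> complex) \<Rightarrow> real \<Rightarrow> 'x" where
  "orbit T \<phi> = (\<lambda>x. T (shift (- x) \<phi>))"

lemma dist_conv_eq_orbit: "dist_conv T \<phi> = orbit T (\<lambda>y. \<phi> (- y))"
  by (simp add: dist_conv_def orbit_def shift_def)

lemma orbit_eq_dist_conv: "orbit T \<phi> = dist_conv T (\<lambda>y. \<phi> (- y))"
  by (simp add: dist_conv_eq_orbit)

lemma orbit_shift: "orbit T (shift a \<phi>) x = orbit T \<phi> (x - a)"
  by (simp add: orbit_def shift_def algebra_simps)

lemma orbit_continuous:
  fixes T :: "(real \<Rightarrow> complex) \<Rightarrow> 'x::complex_banach"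
  assumes T: "T \<in> distributions" and \<phi>: "\<phi> \<in> test_functions"
  shows "continuous_on S (orbit T \<phi>)"
proof (rule continuous_at_imp_continuous_on, rule ballI)
  fix x
  have lin: "linear_on_tests T" by (rule distributions_linear[OF T])
  obtain R where R: "R > 0" "\<phi> \<in> test_functions_on {-R..R}" by (rule test_functions_supportE[OF \<phi>])
  define R' where "R' = R + \<bar>x\<bar> + 1"
  obtain k C where C: "C > 0" "order_bound T {-R'..R'} k C"
    using distributions_order_bound[OF T compact_Icc] by blast
  obtain B where B: "B > 0" "\<And>j x. j \<le> Suc k \<Longrightarrow> norm (nth_deriv j \<phi> x) \<le> B"
    using test_functions_bounded[OF \<phi>, of "Suc k"] by blast
  have sm: "smooth \<phi>" by (rule test_functions_smooth[OF \<phi>])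
  have lip: "norm (orbit T \<phi> y - orbit T \<phi> x) \<le> C * (B * \<bar>y - x\<bar>)" if y: "\<bar>y - x\<bar> < 1" for y
  proof -
    have "orbit T \<phi> y - orbit T \<phi> x = T (\<lambda>z. shift (- y) \<phi> z - shift (- x) \<phi> z)"
      by (simp add: orbit_def linear_on_tests_diff[OF lin] test_functions_shift[OF \<phi>])
    also have "norm \<dots> \<le> C * (B * \<bar>y - x\<bar>)"
    proof (rule order_boundD[OF C(2)])
      have "shift (- u) \<phi> \<in> test_functions_on {-R'..R'}" if "\<bar>u - x\<bar> < 1" for u
        by (rule set_mp[OF test_functions_on_mono test_functions_on_shift[OF R(2)]]) (use that in \<open>auto simp: R'_def\<close>)
      then show "(\<lambda>z. shift (- y) \<phi> z - shift (- x) \<phi> z) \<in> test_functions_on {-R'..R'}"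
        using y by (intro test_functions_on_diff) auto
      fix j z assume "j \<le> k"
      then have "norm (nth_deriv j \<phi> (z - y) - nth_deriv j \<phi> (z - x)) \<le> B * \<bar>(z - y) - (z - x)\<bar>"
        using B(2) by (intro smooth_Lipschitz[OF sm]) auto
      then show "norm (nth_deriv j (\<lambda>z. shift (- y) \<phi> z - shift (- x) \<phi> z) z) \<le> B * \<bar>y - x\<bar>"
        unfolding smooth_diff(2)[OF smooth_shift(1)[OF sm] smooth_shift(1)[OF sm]] smooth_shift(2)[OF sm]
        by (simp add: shift_def abs_minus_commute)
    qed
    finally show ?thesis .
  qed
  show "isCont (orbit T \<phi>) x"
  proof (unfold isCont_def, rule LIM_zero_cancel, rule Lim_null_comparison)
    show "\<forall>\<^sub>F y in at x. norm (orbit T \<phi> y - orbit T \<phi> x) \<le> C * (B * \<bar>y - x\<bar>)"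
      unfolding eventually_at by (rule exI[of _ 1]) (use lip in \<open>auto simp: dist_real_def\<close>)
    have "((\<lambda>y. C * (B * \<bar>y - x\<bar>)) \<longlongrightarrow> C * (B * \<bar>x - x\<bar>)) (at x)" by (intro tendsto_intros)
    then show "((\<lambda>y. C * (B * \<bar>y - x\<bar>)) \<longlongrightarrow> 0) (at x)" by simp
  qed
qed

lemma smooth_reflected_integral:
  assumes sm: "smooth \<phi>" and ab: "a \<le> b"
  shows "((\<lambda>t. nth_deriv 1 \<phi> (y - t)) has_integral (\<phi> (y - a) - \<phi> (y - b))) {a..b}"
proof -
  have "((\<lambda>t. nth_deriv 1 \<phi> (y - t)) has_integral ((- \<phi> (y - b)) - (- \<phi> (y - a)))) {a..b}"
  proof (rule fundamental_theorem_of_calculus[OF ab])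
    fix t
    have "((\<lambda>s. \<phi> ((-1) * s + y)) has_vector_derivative (-1) ^ 1 *\<^sub>R nth_deriv 1 \<phi> ((-1) * t + y)) (at t within {a..b})"
      using smooth_has_vector_derivative[OF smooth_affine(1)[OF sm, where c="-1" and a=y], of 0 t]
      unfolding smooth_affine(2)[OF sm] by (simp add: has_vector_derivative_at_within)
    then show "((\<lambda>s. - \<phi> (y - s)) has_vector_derivative nth_deriv 1 \<phi> (y - t)) (at t within {a..b})"
      using has_vector_derivative_minus by fastforce
  qed
  then show ?thesis by simp
qed

text \<open>
  The orbit of \<open>\<phi>'\<close> is minus the derivative of the orbit of \<open>\<phi>\<close>, in integrated form.
\<close>

lemma orbit_integral:
  fixes T :: "(real \<Rightarrow> complex) \<Rightarrow> 'x::complex_banach"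
  assumes T: "T \<in> distributions" and \<phi>: "\<phi> \<in> test_functions" and h: "h \<ge> 0"
  shows "integral {x..x+h} (orbit T (nth_deriv 1 \<phi>)) = orbit T \<phi> x - orbit T \<phi> (x + h)"
proof -
  have sm: "smooth \<phi>" by (rule test_functions_smooth[OF \<phi>])
  have "superposition (\<lambda>_. 1) x (x + h) (nth_deriv 1 \<phi>) z = shift (- x) \<phi> z - shift (- (x + h)) \<phi> z" for z
  proof -
    have "((\<lambda>s. nth_deriv 1 \<phi> (z - s)) has_integral (\<phi> (z - x) - \<phi> (z - (x + h)))) {x..x+h}"
      by (rule smooth_reflected_integral[OF sm]) (use h in simp)
    from integral_unique[OF this] show ?thesis by (simp add: superposition_def shift_def algebra_simps)
  qed
  then have "T (superposition (\<lambda>_. 1) x (x + h) (nth_deriv 1 \<phi>)) = T (\<lambda>z. shift (- x) \<phi> z - shift (- (x + h)) \<phi> z)" by presburger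
  also have "\<dots> = orbit T \<phi> x - orbit T \<phi> (x + h)"
    by (simp only: orbit_def linear_on_tests_diff[OF distributions_linear[OF T]] test_functions_shift[OF \<phi>])
  finally show ?thesis
    using distribution_superposition[OF T _ test_functions_nth_deriv[OF \<phi>], of "\<lambda>_. 1" x "x + h" 1] h
    by (simp add: orbit_def integral_unique)
qed

section \<open>Orbits of ergodic distributions are bounded\<close>

lemma has_ergodic_mean_iff:
  fixes f :: "real \<Rightarrow> 'x::banach"
  assumes f: "locally_bochner_integrable f"
  shows "has_ergodic_mean f m \<longleftrightarrow>
    (\<forall>\<epsilon>>0. \<exists>H>0. \<forall>h\<ge>H. \<forall>x. norm ((1 / h) *\<^sub>R integral {x..x+h} f - m) \<le> \<epsilon>)"
proof -
  define N where "N = (\<lambda>h x. norm ((1 / h) *\<^sub>R integral {x..x+h} f - m))"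
  have "has_ergodic_mean f m \<longleftrightarrow> ((\<lambda>h. SUP x. ennreal (N h x)) \<longlongrightarrow> 0) at_top"
    unfolding has_ergodic_mean_def N_def bochner_int_shifted_interval[OF f] ..
  also have "\<dots> \<longleftrightarrow> (\<forall>\<epsilon>>0. \<exists>H>0. \<forall>h\<ge>H. \<forall>x. N h x \<le> \<epsilon>)"
  proof
    assume lim: "((\<lambda>h. SUP x. ennreal (N h x)) \<longlongrightarrow> 0) at_top"
    show "\<forall>\<epsilon>>0. \<exists>H>0. \<forall>h\<ge>H. \<forall>x. N h x \<le> \<epsilon>"
    proof (intro allI impI)
      fix \<epsilon> :: real assume e: "\<epsilon> > 0"
      obtain H where H: "\<And>h. h \<ge> H \<Longrightarrow> (SUP x. ennreal (N h x)) < ennreal \<epsilon>"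
        using order_tendstoD(2)[OF lim, of "ennreal \<epsilon>"] e by (auto simp: eventually_at_top_linorder)
      have "N h x \<le> \<epsilon>" if "h \<ge> max H 1" for h x
      proof -
        have "ennreal (N h x) \<le> (SUP x. ennreal (N h x))" by (rule SUP_upper) simp
        also have "\<dots> < ennreal \<epsilon>" using H that by simp
        finally show ?thesis using e by (simp add: ennreal_less_iff N_def)
      qed
      then show "\<exists>H>0. \<forall>h\<ge>H. \<forall>x. N h x \<le> \<epsilon>" by (intro exI[of _ "max H 1"]) auto
    qed
  next
    assume R: "\<forall>\<epsilon>>0. \<exists>H>0. \<forall>h\<ge>H. \<forall>x. N h x \<le> \<epsilon>"
    show "((\<lambda>h. SUP x. ennreal (N h x)) \<longlongrightarrow> 0) at_top"
    proof (rule order_tendstoI)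
      fix a :: ennreal assume "0 < a"
      then obtain b where b: "0 < b" "b < a" using dense by blast
      then obtain \<epsilon> where \<epsilon>: "b = ennreal \<epsilon>" "\<epsilon> \<ge> 0" by (cases b) auto
      then have "\<epsilon> > 0" using b by (cases "\<epsilon> = 0") auto
      then obtain H where H: "\<And>h x. h \<ge> H \<Longrightarrow> N h x \<le> \<epsilon>" using R by metis
      show "\<forall>\<^sub>F h in at_top. (SUP x. ennreal (N h x)) < a"
        unfolding eventually_at_top_linorder
      proof (intro exI allI impI)
        fix h assume "h \<ge> H"
        then have "(SUP x. ennreal (N h x)) \<le> ennreal \<epsilon>" using H by (intro SUP_least ennreal_leI) auto
        then show "(SUP x. ennreal (N h x)) < a" using b \<epsilon> by (metis le_less_trans)
      qed
    qed simp
  qed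
  finally show ?thesis unfolding N_def .
qed

lemma ergodic_distributions_orbit:
  assumes "T \<in> ergodic_distributions" "\<phi> \<in> test_functions"
  shows "\<exists>m. has_ergodic_mean (orbit T \<phi>) m"
  using assms test_functions_reflect[OF assms(2)]
  unfolding orbit_eq_dist_conv ergodic_distributions_def ergodic_functions_def by auto

lemma ergodic_distributions_distribution: "T \<in> ergodic_distributions \<Longrightarrow> T \<in> distributions"
  by (simp add: ergodic_distributions_def)

lemma orbit_locally_bochner_integrable:
  "T \<in> distributions \<Longrightarrow> \<phi> \<in> test_functions \<Longrightarrow> locally_bochner_integrable (orbit T \<phi>)"
  by (intro locally_bochner_integrable_continuous orbit_continuous)

text \<open>
  An ergodic function may be unbounded, but an orbit \<open>g\<close> cannot be. The orbit of \<open>\<phi>'\<close> is ergodic as well, which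
  bounds the increments of \<open>g\<close> over every long interval, uniformly in the position. A short increment is the
  difference of two long ones with the same left end, so \<open>g\<close> oscillates boundedly on an interval of fixed
  length \<open>L\<close>. As the mean of \<open>g\<close> over such an interval is bounded too, so is \<open>g\<close>.
\<close>

theorem ergodic_orbit_bounded:
  fixes T :: "(real \<Rightarrow> complex) \<Rightarrow> 'x::complex_banach"
  assumes T: "T \<in> ergodic_distributions" and \<phi>: "\<phi> \<in> test_functions"
  shows "\<exists>B. \<forall>x. norm (orbit T \<phi> x) \<le> B"
proof -
  note T' = ergodic_distributions_distribution[OF T]
  note \<phi>' = test_functions_nth_deriv[OF \<phi>, of 1]
  define g where "g = orbit T \<phi>"
  define g' where "g' = orbit T (nth_deriv 1 \<phi>)"
  obtain m where m: "has_ergodic_mean g m" using ergodic_distributions_orbit[OF T \<phi>] g_def by blast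
  obtain m' where m': "has_ergodic_mean g' m'" using ergodic_distributions_orbit[OF T \<phi>'] g'_def by blast
  obtain H where H: "H > 0" "\<And>h x. h \<ge> H \<Longrightarrow> norm ((1 / h) *\<^sub>R integral {x..x+h} g - m) \<le> 1"
    using m[unfolded g_def, THEN has_ergodic_mean_iff[OF orbit_locally_bochner_integrable[OF T' \<phi>], THEN iffD1]]
    unfolding g_def using zero_less_one by blast
  obtain H' where H': "H' > 0" "\<And>h x. h \<ge> H' \<Longrightarrow> norm ((1 / h) *\<^sub>R integral {x..x+h} g' - m') \<le> 1"
    using m'[unfolded g'_def, THEN has_ergodic_mean_iff[OF orbit_locally_bochner_integrable[OF T' \<phi>'], THEN iffD1]]
    unfolding g'_def using zero_less_one by blast
  define L where "L = max H H'"
  define c where "c = norm m' + 1"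
  have L: "L > 0" "L \<ge> H" "L \<ge> H'" using H by (auto simp: L_def)
  have c: "c > 0" by (simp add: c_def add_nonneg_pos)
  have incr: "norm (g (x + h) - g x) \<le> c * h" if h: "h \<ge> L" for x h
  proof -
    have hp: "h > 0" using h L by simp
    have "norm ((1 / h) *\<^sub>R integral {x..x+h} g') \<le> c"
      using H'(2)[of h x] h L norm_triangle_ineq[of "(1 / h) *\<^sub>R integral {x..x+h} g' - m'" m'] by (simp add: c_def)
    then have "norm (integral {x..x+h} g') \<le> c * h" using hp by (simp add: field_simps)
    moreover have "integral {x..x+h} g' = g x - g (x + h)"
      unfolding g_def g'_def by (rule orbit_integral[OF T' \<phi>]) (use hp in simp)
    ultimately show ?thesis by (simp add: norm_minus_commute)
  qed
  (* Both increments below start at x - L and are therefore long. *)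
  have osc: "norm (g (x + s) - g x) \<le> 3 * L * c" if s: "0 \<le> s" "s \<le> L" for x s
  proof -
    have "norm (g (x + s) - g (x - L)) \<le> c * (s + L)" using incr[of "s + L" "x - L"] s by simp
    moreover have "norm (g x - g (x - L)) \<le> c * L" using incr[of L "x - L"] by simp
    moreover have "c * s \<le> c * L" using s c by simp
    ultimately show ?thesis
      using norm_triangle_ineq4[of "g (x + s) - g (x - L)" "g x - g (x - L)"] by (simp add: algebra_simps)
  qed
  have "norm (g x) \<le> norm m + 1 + 3 * L * c" for x
  proof -
    have gi: "g integrable_on {x..x+L}" unfolding g_def by (intro integrable_continuous_real orbit_continuous[OF T' \<phi>])
    have "((\<lambda>s. g s - g x) has_integral (integral {x..x+L} g - L *\<^sub>R g x)) {x..x+L}"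
      using has_integral_diff[OF integrable_integral[OF gi] has_integral_const_real[of "g x" x "x + L"]] L by simp
    then have "norm (integral {x..x+L} g - L *\<^sub>R g x) \<le> 3 * L * c * measure lborel {x..x+L}"
    proof (rule has_integral_bound_real[where S="{}", rotated 2])
      show "0 \<le> 3 * L * c" "finite ({} :: real set)" using L c by simp_all
      show "norm (g s - g x) \<le> 3 * L * c" if "s \<in> {x..x+L} - {}" for s using osc[of "s - x" x] that by simp
    qed
    then have "(1 / L) * norm (integral {x..x+L} g - L *\<^sub>R g x) \<le> (1 / L) * (3 * L * c * L)"
      using L by (intro mult_left_mono) auto
    also have "\<dots> = 3 * L * c" using L by simp
    also have "(1 / L) * norm (integral {x..x+L} g - L *\<^sub>R g x) = norm ((1 / L) *\<^sub>R (integral {x..x+L} g - L *\<^sub>R g x))"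
      using L by simp
    also have "(1 / L) *\<^sub>R (integral {x..x+L} g - L *\<^sub>R g x) = (1 / L) *\<^sub>R integral {x..x+L} g - g x"
      using L by (simp add: scaleR_diff_right)
    finally have "norm ((1 / L) *\<^sub>R integral {x..x+L} g - g x) \<le> 3 * L * c" .
    moreover have "norm ((1 / L) *\<^sub>R integral {x..x+L} g) \<le> norm m + 1"
      using H(2)[of L x] L norm_triangle_ineq[of "(1 / L) *\<^sub>R integral {x..x+L} g - m" m] by simp
    ultimately show ?thesis
      using norm_triangle_ineq4[of "(1 / L) *\<^sub>R integral {x..x+L} g" "(1 / L) *\<^sub>R integral {x..x+L} g - g x"] by simp
  qed
  then show ?thesis unfolding g_def by blast
qed

section \<open>Uniform order along all translates\<close>

lemma test_functions_on_complete:
  fixes \<phi> :: "nat \<Rightarrow> real \<Rightarrow> complex"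
  assumes K: "closed K" and \<phi>: "\<And>n. \<phi> n \<in> test_functions_on K"
    and cauchy: "\<And>j \<epsilon>. \<epsilon> > 0 \<Longrightarrow> \<exists>N. \<forall>m\<ge>N. \<forall>n\<ge>N. \<forall>x. norm (nth_deriv j (\<phi> m) x - nth_deriv j (\<phi> n) x) \<le> \<epsilon>"
  shows "\<exists>\<psi>\<in>test_functions_on K. \<forall>j. \<forall>\<epsilon>>0. \<exists>N. \<forall>n\<ge>N. \<forall>x. norm (nth_deriv j (\<phi> n) x - nth_deriv j \<psi> x) \<le> \<epsilon>"
proof -
  define g where "g = (\<lambda>j x. lim (\<lambda>n. nth_deriv j (\<phi> n) x))"
  have sm: "smooth (\<phi> n)" for n using test_functions_onD(1)[OF \<phi>] .
  have lim: "(\<lambda>n. nth_deriv j (\<phi> n) x) \<longlonglongrightarrow> g j x" for j x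
  proof -
    have "Cauchy (\<lambda>n. nth_deriv j (\<phi> n) x)"
    proof (rule metric_CauchyI)
      fix e :: real assume "e > 0"
      then have e2: "e / 2 > 0" "e / 2 < e" by auto
      obtain N where N: "\<And>m n. m \<ge> N \<Longrightarrow> n \<ge> N \<Longrightarrow> norm (nth_deriv j (\<phi> m) x - nth_deriv j (\<phi> n) x) \<le> e / 2"
        using cauchy[OF e2(1), of j] by blast
      have "dist (nth_deriv j (\<phi> m) x) (nth_deriv j (\<phi> n) x) < e" if "m \<ge> N" "n \<ge> N" for m n
        unfolding dist_norm by (rule le_less_trans[OF N[OF that] e2(2)])
      then show "\<exists>M. \<forall>m\<ge>M. \<forall>n\<ge>M. dist (nth_deriv j (\<phi> m) x) (nth_deriv j (\<phi> n) x) < e" by blast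
    qed
    then show ?thesis unfolding g_def by (simp add: Cauchy_convergent_iff convergent_LIMSEQ_iff)
  qed
  have unif: "\<exists>N. \<forall>n\<ge>N. \<forall>x. norm (nth_deriv j (\<phi> n) x - g j x) \<le> \<epsilon>" if e: "\<epsilon> > 0" for j \<epsilon>
  proof -
    obtain N where N: "\<And>m n x. m \<ge> N \<Longrightarrow> n \<ge> N \<Longrightarrow> norm (nth_deriv j (\<phi> m) x - nth_deriv j (\<phi> n) x) \<le> \<epsilon>"
      using cauchy[OF e, of j] by blast
    have "norm (nth_deriv j (\<phi> n) x - g j x) \<le> \<epsilon>" if "n \<ge> N" for n x
    proof (rule Lim_bounded)
      show "(\<lambda>m. norm (nth_deriv j (\<phi> n) x - nth_deriv j (\<phi> m) x)) \<longlonglongrightarrow> norm (nth_deriv j (\<phi> n) x - g j x)"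
        by (intro tendsto_intros lim)
      show "\<forall>m\<ge>N. norm (nth_deriv j (\<phi> n) x - nth_deriv j (\<phi> m) x) \<le> \<epsilon>" using N that by blast
    qed
    then show ?thesis by blast
  qed
  have deriv: "(g j has_vector_derivative g (Suc j) x) (at x)" for j x
  proof -
    have "\<exists>G. \<forall>x\<in>UNIV. (\<lambda>n. nth_deriv j (\<phi> n) x) \<longlonglongrightarrow> G x \<and> (G has_derivative (\<lambda>h. h *\<^sub>R g (Suc j) x)) (at x within UNIV)"
    proof (rule has_derivative_sequence[where f'="\<lambda>n x h. h *\<^sub>R nth_deriv (Suc j) (\<phi> n) x"])
      show "(nth_deriv j (\<phi> n) has_derivative (\<lambda>h. h *\<^sub>R nth_deriv (Suc j) (\<phi> n) x)) (at x within UNIV)" for n x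
        using smooth_has_vector_derivative[OF sm[of n], of j x] by (simp add: has_vector_derivative_def)
      show "(\<lambda>n. nth_deriv j (\<phi> n) 0) \<longlonglongrightarrow> g j 0" by (rule lim)
      fix e :: real assume "e > 0"
      then obtain N where N: "\<And>n x. n \<ge> N \<Longrightarrow> norm (nth_deriv (Suc j) (\<phi> n) x - g (Suc j) x) \<le> e"
        using unif[of e "Suc j"] by blast
      show "\<forall>\<^sub>F n in sequentially. \<forall>x\<in>UNIV. \<forall>h. norm (h *\<^sub>R nth_deriv (Suc j) (\<phi> n) x - h *\<^sub>R g (Suc j) x) \<le> e * norm h"
        unfolding eventually_sequentially
      proof (intro exI allI impI ballI)
        fix n x and h :: real assume "n \<ge> N"
        have "norm (h *\<^sub>R nth_deriv (Suc j) (\<phi> n) x - h *\<^sub>R g (Suc j) x) = \<bar>h\<bar> * norm (nth_deriv (Suc j) (\<phi> n) x - g (Suc j) x)"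
          by (simp flip: scaleR_diff_right)
        also have "\<dots> \<le> \<bar>h\<bar> * e" by (rule mult_left_mono[OF N[OF \<open>n \<ge> N\<close>] abs_ge_zero])
        finally show "norm (h *\<^sub>R nth_deriv (Suc j) (\<phi> n) x - h *\<^sub>R g (Suc j) x) \<le> e * norm h" by (simp add: mult.commute)
      qed
    qed auto
    then obtain G where G': "\<forall>x\<in>UNIV. (\<lambda>n. nth_deriv j (\<phi> n) x) \<longlonglongrightarrow> G x \<and> (G has_derivative (\<lambda>h. h *\<^sub>R g (Suc j) x)) (at x within UNIV)"
      by (rule exE)
    have G: "(\<lambda>n. nth_deriv j (\<phi> n) x) \<longlonglongrightarrow> G x" "(G has_derivative (\<lambda>h. h *\<^sub>R g (Suc j) x)) (at x)" for x
      using bspec[OF G' UNIV_I, of x] by simp_all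
    have "G = g j" using LIMSEQ_unique[OF G(1) lim] by (rule ext)
    then show ?thesis using G(2)[of x] by (simp add: has_vector_derivative_def)
  qed
  have chain: "smooth (g 0)" "nth_deriv j (g 0) = g j" for j
    by (rule smooth_chain[of g]; use deriv in simp)+
  have zero: "g 0 x = 0" if "x \<notin> K" for x
  proof -
    have "(\<lambda>n. nth_deriv 0 (\<phi> n) x) = (\<lambda>n. 0)" using test_functions_onD(2)[OF \<phi> that] by simp
    then show ?thesis using lim[of 0 x] by (simp add: LIMSEQ_const_iff)
  qed
  show ?thesis
  proof (intro bexI[of _ "g 0"] allI impI)
    show "g 0 \<in> test_functions_on K" using chain(1) zero by (simp add: test_functions_on_def)
    show "\<exists>N. \<forall>n\<ge>N. \<forall>x. norm (nth_deriv j (\<phi> n) x - nth_deriv j (g 0) x) \<le> \<epsilon>" if "\<epsilon> > 0" for j \<epsilon>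
      unfolding chain(2) by (rule unif[OF that])
  qed
qed

lemma orbit_linear:
  assumes "T \<in> distributions"
  shows "linear_on_tests (\<lambda>\<phi>. orbit T \<phi> x)"
proof -
  have lin: "linear_on_tests T" by (rule distributions_linear[OF assms])
  show ?thesis
    unfolding linear_on_tests_def orbit_def
  proof (intro conjI ballI allI)
    fix \<phi> \<psi> c assume t: "\<phi> \<in> test_functions"
    show "T (shift (- x) (\<lambda>x. c * \<phi> x)) = c *\<^sub>C T (shift (- x) \<phi>)"
      using linear_on_tests_cmult[OF lin test_functions_shift[OF t, of "- x"], of c] by (simp add: shift_def)
    assume t': "\<psi> \<in> test_functions"
    show "T (shift (- x) (\<lambda>x. \<phi> x + \<psi> x)) = T (shift (- x) \<phi>) + T (shift (- x) \<psi>)"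
      using linear_on_tests_add[OF lin test_functions_shift[OF t, of "- x"] test_functions_shift[OF t', of "- x"]] by (simp add: shift_def)
  qed
qed

lemma orbit_order_bound:
  assumes T: "T \<in> distributions" and K: "compact K"
  shows "\<exists>k C. C > 0 \<and> order_bound (\<lambda>\<phi>. orbit T \<phi> x) K k C"
proof -
  obtain R where R: "R > 0" "\<And>t. t \<in> K \<Longrightarrow> \<bar>t\<bar> \<le> R"
    using compact_imp_bounded[OF K] unfolding bounded_pos by auto
  obtain k C where C: "C > 0" "order_bound T {-R+x..R+x} k C"
    using distributions_order_bound[OF T compact_Icc] by blast
  have "order_bound (\<lambda>\<phi>. orbit T \<phi> x) K k C"
    unfolding order_bound_def orbit_def
  proof (intro ballI allI impI)
    fix \<phi> B assume \<phi>: "\<phi> \<in> test_functions_on K" and B: "\<forall>j\<le>k. \<forall>y. norm (nth_deriv j \<phi> y) \<le> B"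
    have "K \<subseteq> {-R..R}"
    proof
      show "t \<in> {-R..R}" if "t \<in> K" for t using R(2)[OF that] by (simp add: abs_le_iff)
    qed
    then have "\<phi> \<in> test_functions_on {-R..R}" using \<phi> test_functions_on_mono by blast
    then have "shift (- x) \<phi> \<in> test_functions_on {-R+x..R+x}" using test_functions_on_shift[of \<phi> "-R" R "-x"] by simp
    then show "norm (T (shift (- x) \<phi>)) \<le> C * B"
    proof (rule order_boundD[OF C(2)])
      show "norm (nth_deriv j (shift (- x) \<phi>) y) \<le> B" if "j \<le> k" for j y
        unfolding smooth_shift(2)[OF test_functions_onD(1)[OF \<phi>]] using B that by (simp add: shift_def)
    qed
  qed
  then show ?thesis using C(1) by blast
qed

text \<open>
  Uniform boundedness principle for the family of all translates of \<open>T\<close>, on the Frechet space of test functions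
  supported in \<open>K\<close>. If no common order bound exists, then every ball of this space contains a smaller ball on
  which some translate exceeds a prescribed number. Nested balls shrink to a test function whose orbit is
  unbounded.
\<close>

theorem orbit_uniform_order_bound:
  fixes T :: "(real \<Rightarrow> complex) \<Rightarrow> 'x::complex_banach"
  assumes T: "T \<in> distributions" and K: "compact K"
    and bounded: "\<And>\<phi>. \<phi> \<in> test_functions_on K \<Longrightarrow> \<exists>B. \<forall>x. norm (orbit T \<phi> x) \<le> B"
  shows "\<exists>k C. \<forall>x. order_bound (\<lambda>\<phi>. orbit T \<phi> x) K k C"
proof (rule ccontr)
  assume contra: "\<not> ?thesis"
  (* Balls of the Frechet space: \<epsilon>-closeness of the derivatives up to order k. *)
  define nb where "nb = (\<lambda>(\<phi>, k, \<epsilon>::real). {\<psi> \<in> test_functions_on K. \<forall>j\<le>k. \<forall>x. norm (nth_deriv j \<psi> x - nth_deriv j \<phi> x) \<le> \<epsilon>})"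
  (* In stage n the order is at least n and the radius at most 1 / (n + 1), so the centres form a Cauchy sequence. *)
  define P where "P = (\<lambda>n::nat. \<lambda>(\<phi>, k, \<epsilon>). \<phi> \<in> test_functions_on K \<and> 0 < \<epsilon> \<and> \<epsilon> \<le> inverse (Suc n) \<and> n \<le> k)"
  (* The next ball is contained in the previous one, and on all of it some translate exceeds n. *)
  define Q where "Q = (\<lambda>n::nat. \<lambda>s s'. nb s' \<subseteq> nb s \<and> (\<forall>\<psi>\<in>nb s'. \<exists>x. norm (orbit T \<psi> x) > n))"
  have "\<exists>s. \<forall>n. P n (s n) \<and> Q n (s n) (s (Suc n))"
  proof (rule dependent_nat_choice)
    show "\<exists>s. P 0 s" by (rule exI[of _ "(\<lambda>x. 0, 0, 1)"]) (simp add: P_def zero_test_function)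
    fix s n assume "P n s"
    then obtain \<phi> k \<epsilon> where s: "s = (\<phi>, k, \<epsilon>)" and \<phi>: "\<phi> \<in> test_functions_on K" and \<epsilon>: "\<epsilon> > 0"
      by (cases s) (auto simp: P_def)
    have "\<exists>\<phi>' x. \<phi>' \<in> nb (\<phi>, k, \<epsilon>/2) \<and> norm (orbit T \<phi>' x) > real n + 1"
    proof (rule ccontr)
      assume no: "\<not> ?thesis"
      have "order_bound (\<lambda>\<phi>. orbit T \<phi> x) K k (2 * (real n + 1) / (\<epsilon> / 2))" for x
      proof (rule order_bound_scaling[OF orbit_linear[OF T] K])
        fix \<psi> assume \<psi>: "\<psi> \<in> test_functions_on K" and sm: "\<And>j x. j \<le> k \<Longrightarrow> norm (nth_deriv j \<psi> x) \<le> \<epsilon> / 2"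
        have "(\<lambda>x. \<phi> x + \<psi> x) \<in> nb (\<phi>, k, \<epsilon>/2)"
          using \<phi> \<psi> sm test_functions_onD(1)[OF \<phi>] test_functions_onD(1)[OF \<psi>]
          by (simp add: nb_def test_functions_on_add smooth_add(2))
        then have "norm (orbit T (\<lambda>x. \<phi> x + \<psi> x) x) \<le> real n + 1" using no by (meson not_le)
        moreover have "\<phi> \<in> nb (\<phi>, k, \<epsilon>/2)" using \<phi> \<epsilon> by (simp add: nb_def)
        then have "norm (orbit T \<phi> x) \<le> real n + 1" using no by (meson not_le)
        moreover have "orbit T (\<lambda>x. \<phi> x + \<psi> x) x = orbit T \<phi> x + orbit T \<psi> x"
          by (rule linear_on_tests_add[OF orbit_linear[OF T] test_functions_on_subset[OF K \<phi>] test_functions_on_subset[OF K \<psi>]])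
        ultimately show "norm (orbit T \<psi> x) \<le> 2 * (real n + 1)"
          using norm_triangle_ineq4[of "orbit T \<phi> x + orbit T \<psi> x" "orbit T \<phi> x"] by simp
      qed (use \<epsilon> in simp)
      then show False using contra by blast
    qed
    then obtain \<phi>' x where \<phi>': "\<phi>' \<in> nb (\<phi>, k, \<epsilon>/2)" and big: "norm (orbit T \<phi>' x) > real n + 1" by blast
    have \<phi>'K: "\<phi>' \<in> test_functions_on K" using \<phi>' by (simp add: nb_def)
    obtain l C where C: "C > 0" "order_bound (\<lambda>\<phi>. orbit T \<phi> x) K l C" using orbit_order_bound[OF T K] by blast
    (* The radius 1 / C keeps the value of the translate by x within 1 of its value at the centre. *)
    define k' where "k' = Max {Suc n, k, l}"
    define \<epsilon>' where "\<epsilon>' = Min {inverse (Suc (Suc n)), \<epsilon> / 2, 1 / C}"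
    have k': "Suc n \<le> k'" "k \<le> k'" "l \<le> k'" by (auto simp: k'_def)
    have \<epsilon>': "0 < \<epsilon>'" "\<epsilon>' \<le> inverse (Suc (Suc n))" "\<epsilon>' \<le> \<epsilon> / 2" "\<epsilon>' \<le> 1 / C"
      using \<epsilon> C unfolding \<epsilon>'_def by (auto simp del: of_nat_Suc)
    show "\<exists>s'. P (Suc n) s' \<and> Q n s s'"
    proof (intro exI[of _ "(\<phi>', k', \<epsilon>')"] conjI)
      show "P (Suc n) (\<phi>', k', \<epsilon>')" using \<phi>'K k' \<epsilon>' by (simp add: P_def del: of_nat_Suc)
      show "Q n s (\<phi>', k', \<epsilon>')" unfolding Q_def
      proof (intro conjI subsetI ballI)
        fix \<psi> assume \<psi>: "\<psi> \<in> nb (\<phi>', k', \<epsilon>')"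
        then have \<psi>K: "\<psi> \<in> test_functions_on K" and \<psi>\<phi>': "\<And>j x. j \<le> k' \<Longrightarrow> norm (nth_deriv j \<psi> x - nth_deriv j \<phi>' x) \<le> \<epsilon>'"
          by (auto simp: nb_def)
        have "norm (nth_deriv j \<psi> y - nth_deriv j \<phi> y) \<le> \<epsilon>" if "j \<le> k" for j y
        proof -
          have "norm (nth_deriv j \<psi> y - nth_deriv j \<phi>' y) \<le> \<epsilon> / 2"
            using \<psi>\<phi>'[of j y] that k' \<epsilon>' by linarith
          moreover have "norm (nth_deriv j \<phi>' y - nth_deriv j \<phi> y) \<le> \<epsilon> / 2" using \<phi>' that by (simp add: nb_def)
          ultimately show ?thesis
            using norm_triangle_ineq[of "nth_deriv j \<psi> y - nth_deriv j \<phi>' y" "nth_deriv j \<phi>' y - nth_deriv j \<phi> y"] by simp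
        qed
        then show "\<psi> \<in> nb s" using \<psi>K by (simp add: nb_def s)
        have "norm (orbit T (\<lambda>y. \<psi> y - \<phi>' y) x) \<le> C * \<epsilon>'"
        proof (rule order_boundD[OF C(2)])
          show "norm (nth_deriv j (\<lambda>y. \<psi> y - \<phi>' y) y) \<le> \<epsilon>'" if "j \<le> l" for j y
            using \<psi>\<phi>'[of j y] that k' by (simp add: smooth_diff(2) test_functions_onD(1)[OF \<psi>K] test_functions_onD(1)[OF \<phi>'K])
        qed (intro test_functions_on_diff \<psi>K \<phi>'K)
        also have "\<dots> \<le> 1" using \<epsilon>' C by (simp add: field_simps)
        also have "orbit T (\<lambda>y. \<psi> y - \<phi>' y) x = orbit T \<psi> x - orbit T \<phi>' x"
          by (rule linear_on_tests_diff[OF orbit_linear[OF T] test_functions_on_subset[OF K \<psi>K] test_functions_on_subset[OF K \<phi>'K]])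
        finally have "norm (orbit T \<psi> x) > real n"
          using big norm_triangle_ineq2[of "orbit T \<phi>' x" "orbit T \<psi> x"] by (simp add: norm_minus_commute)
        then show "\<exists>x. norm (orbit T \<psi> x) > real n" by blast
      qed
    qed
  qed
  then obtain s where s: "\<And>n. P n (s n)" "\<And>n. Q n (s n) (s (Suc n))" by blast
  define \<phi> where "\<phi> = (\<lambda>n. fst (s n))"
  have P: "\<phi> n \<in> test_functions_on K" "snd (snd (s n)) > 0" "snd (snd (s n)) \<le> inverse (Suc n)" "n \<le> fst (snd (s n))" for n
    using s(1)[of n] by (auto simp: P_def \<phi>_def split: prod.splits)
  have mem: "\<psi> \<in> nb (s n) \<longleftrightarrow> \<psi> \<in> test_functions_on K \<and>
      (\<forall>j\<le>fst (snd (s n)). \<forall>x. norm (nth_deriv j \<psi> x - nth_deriv j (\<phi> n) x) \<le> snd (snd (s n)))" for \<psi> n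
    by (simp add: nb_def \<phi>_def split_def)
  have anti: "nb (s m) \<subseteq> nb (s n)" if "n \<le> m" for m n
    using that
  proof (induction m rule: dec_induct)
    case (step m)
    have "nb (s (Suc m)) \<subseteq> nb (s m)" using s(2)[of m] unfolding Q_def by (rule conjunct1)
    then show ?case using step.IH by (rule order_trans)
  qed simp
  have close: "norm (nth_deriv j (\<phi> m) x - nth_deriv j (\<phi> n) x) \<le> snd (snd (s n))" if "n \<le> m" "j \<le> n" for m n j x
  proof -
    have "\<phi> m \<in> nb (s m)" using P[of m] by (simp add: mem)
    then have "\<phi> m \<in> nb (s n)" using anti[OF that(1)] by blast
    then show ?thesis using that P(4)[of n] by (auto simp: mem)
  qed
  have cauchy: "\<exists>N. \<forall>m\<ge>N. \<forall>n\<ge>N. \<forall>x. norm (nth_deriv j (\<phi> m) x - nth_deriv j (\<phi> n) x) \<le> \<epsilon>" if \<epsilon>: "\<epsilon> > 0" for j \<epsilon>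
  proof -
    obtain N0 where N0: "inverse (real (Suc N0)) < \<epsilon> / 2" using reals_Archimedean[of "\<epsilon>/2"] \<epsilon> by auto
    define N where "N = max N0 j"
    have "inverse (real (Suc N)) \<le> inverse (real (Suc N0))" by (rule le_imp_inverse_le) (auto simp: N_def)
    then have N: "snd (snd (s N)) \<le> \<epsilon> / 2" using P(3)[of N] N0 by linarith
    have "norm (nth_deriv j (\<phi> m) x - nth_deriv j (\<phi> n) x) \<le> \<epsilon>" if "m \<ge> N" "n \<ge> N" for m n x
      using close[of N m j x] close[of N n j x] that N
        norm_triangle_ineq4[of "nth_deriv j (\<phi> m) x - nth_deriv j (\<phi> N) x" "nth_deriv j (\<phi> n) x - nth_deriv j (\<phi> N) x"]
      by (simp add: N_def)
    then show ?thesis by blast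
  qed
  have "\<exists>\<psi>\<in>test_functions_on K. \<forall>j. \<forall>\<epsilon>>0. \<exists>N. \<forall>n\<ge>N. \<forall>x. norm (nth_deriv j (\<phi> n) x - nth_deriv j \<psi> x) \<le> \<epsilon>"
    by (rule test_functions_on_complete[OF compact_imp_closed[OF K] P(1)]) (rule cauchy)
  then obtain \<psi> where \<psi>: "\<psi> \<in> test_functions_on K"
    "\<forall>j. \<forall>\<epsilon>>0. \<exists>N. \<forall>n\<ge>N. \<forall>x. norm (nth_deriv j (\<phi> n) x - nth_deriv j \<psi> x) \<le> \<epsilon>"
    by (elim bexE)
  have \<psi>nb: "\<psi> \<in> nb (s n)" for n
    unfolding mem
  proof (intro conjI allI impI \<psi>(1))
    fix j x assume j: "j \<le> fst (snd (s n))"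
    show "norm (nth_deriv j \<psi> x - nth_deriv j (\<phi> n) x) \<le> snd (snd (s n))"
    proof (rule field_le_epsilon)
      fix e :: real assume "e > 0"
      then obtain N where N: "\<And>m x. m \<ge> N \<Longrightarrow> norm (nth_deriv j (\<phi> m) x - nth_deriv j \<psi> x) \<le> e"
        using \<psi>(2)[rule_format, of e j] by auto
      define m where "m = max N n"
      have "\<phi> m \<in> nb (s m)" using P[of m] by (simp add: mem)
      then have "\<phi> m \<in> nb (s n)" using anti[of n m] by (auto simp: m_def)
      then have "norm (nth_deriv j (\<phi> m) x - nth_deriv j (\<phi> n) x) \<le> snd (snd (s n))" using j by (auto simp: mem)
      then show "norm (nth_deriv j \<psi> x - nth_deriv j (\<phi> n) x) \<le> snd (snd (s n)) + e"
        using N[of m x] norm_triangle_ineq4[of "nth_deriv j (\<phi> m) x - nth_deriv j (\<phi> n) x" "nth_deriv j (\<phi> m) x - nth_deriv j \<psi> x"]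
        by (simp add: m_def)
    qed
  qed
  obtain B where B: "\<And>x. norm (orbit T \<psi> x) \<le> B" using bounded[OF \<psi>(1)] by blast
  obtain n :: nat where n: "B \<le> real n" using real_arch_simple by blast
  have "\<exists>x. norm (orbit T \<psi> x) > real n" using s(2)[of n] \<psi>nb[of "Suc n"] by (auto simp: Q_def)
  then show False using B n by (meson not_le order_trans)
qed

section \<open>An L1 bound of finite order\<close>

definition l1 :: "(real \<Rightarrow> complex) \<Rightarrow> real" where
  "l1 f = integral UNIV (\<lambda>x. norm (f x))"

definition sobolev_norm :: "nat \<Rightarrow> (real \<Rightarrow> complex) \<Rightarrow> real" where
  "sobolev_norm k \<psi> = (\<Sum>j\<le>k. l1 (nth_deriv j \<psi>))"

lemma test_function_norm_integral:
  assumes \<phi>: "\<phi> \<in> test_functions_on {a..b}"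
  shows "((\<lambda>x. norm (\<phi> x)) has_integral l1 \<phi>) UNIV" "l1 \<phi> = integral {a..b} (\<lambda>x. norm (\<phi> x))"
proof -
  have "(\<lambda>x. norm (\<phi> x)) integrable_on {a..b}"
    using smooth_continuous_on[OF test_functions_onD(1)[OF \<phi>], of "{a..b}" 0]
    by (intro integrable_continuous_real continuous_intros) simp
  then have "((\<lambda>x. norm (\<phi> x)) has_integral integral {a..b} (\<lambda>x. norm (\<phi> x))) {a..b}" by (rule integrable_integral)
  then have *: "((\<lambda>x. norm (\<phi> x)) has_integral integral {a..b} (\<lambda>x. norm (\<phi> x))) UNIV"
    by (rule has_integral_on_superset) (use test_functions_onD(2)[OF \<phi>] in auto)
  then show "l1 \<phi> = integral {a..b} (\<lambda>x. norm (\<phi> x))" by (simp add: l1_def integral_unique)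
  with * show "((\<lambda>x. norm (\<phi> x)) has_integral l1 \<phi>) UNIV" by simp
qed

lemma l1_has_integral: "\<phi> \<in> test_functions \<Longrightarrow> ((\<lambda>x. norm (\<phi> x)) has_integral l1 \<phi>) UNIV"
  by (metis test_functions_supportE test_function_norm_integral(1))

lemma l1_nonneg: "\<phi> \<in> test_functions \<Longrightarrow> l1 \<phi> \<ge> 0"
  by (rule has_integral_nonneg[OF l1_has_integral]) auto

lemma nn_integral_eq_l1: "\<phi> \<in> test_functions \<Longrightarrow> (\<integral>\<^sup>+x. norm (\<phi> x) \<partial>lebesgue) = ennreal (l1 \<phi>)"
  using l1_has_integral[of \<phi>] by (subst (asm) has_integral_iff_nn_integral_lebesgue) auto

lemma sobolev_norm_nonneg: "\<phi> \<in> test_functions \<Longrightarrow> sobolev_norm k \<phi> \<ge> 0"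
  unfolding sobolev_norm_def by (intro sum_nonneg l1_nonneg test_functions_nth_deriv)

lemma l1_shift:
  assumes "\<phi> \<in> test_functions"
  shows "l1 (shift a \<phi>) = l1 \<phi>"
proof -
  obtain R where R: "R > 0" "\<phi> \<in> test_functions_on {-R..R}" by (rule test_functions_supportE[OF assms])
  have "(\<lambda>x. norm (\<phi> x)) integrable_on {-R..R}"
    using smooth_continuous_on[OF test_functions_onD(1)[OF R(2)], of "{-R..R}" 0]
    by (intro integrable_continuous_real continuous_intros) simp
  then have "((\<lambda>s. norm (\<phi> (a + s))) has_integral integral {-R..R} (\<lambda>x. norm (\<phi> x))) {-R-a..R-a}"
    using has_integral_translation[of "\<lambda>x. norm (\<phi> x)" a "-R-a" "R-a"] by simp
  then have "integral {-R-a..R-a} (\<lambda>s. norm (shift a \<phi> s)) = integral {-R..R} (\<lambda>x. norm (\<phi> x))"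
    by (simp add: shift_def add.commute integral_unique)
  then show ?thesis
    using test_function_norm_integral(2)[OF R(2)] test_function_norm_integral(2)[OF test_functions_on_shift[OF R(2), of a]] by simp
qed

lemma sup_le_l1_deriv:
  assumes \<phi>: "\<phi> \<in> test_functions"
  shows "norm (\<phi> x) \<le> l1 (nth_deriv 1 \<phi>)"
proof -
  obtain R where R: "R > 0" "\<phi> \<in> test_functions_on {-R..R}" by (rule test_functions_supportE[OF \<phi>])
  define a where "a = min x (-R) - 1"
  have a: "a \<le> x" "a \<notin> {-R..R}" using R by (auto simp: a_def)
  have sm: "smooth \<phi>" by (rule test_functions_smooth[OF \<phi>])
  note c = smooth_continuous_on[OF sm]
  have "(nth_deriv 1 \<phi> has_integral (\<phi> x - \<phi> a)) {a..x}"
    by (rule fundamental_theorem_of_calculus[OF a(1)])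
       (use smooth_has_vector_derivative[OF sm, of 0] in \<open>simp add: has_vector_derivative_at_within\<close>)
  then have "(nth_deriv 1 \<phi> has_integral \<phi> x) {a..x}" using test_functions_onD(2)[OF R(2) a(2)] by simp
  then have "norm (\<phi> x) = norm (integral {a..x} (nth_deriv 1 \<phi>))" by (simp add: integral_unique)
  also have "\<dots> \<le> integral {a..x} (\<lambda>x. norm (nth_deriv 1 \<phi> x))"
    by (rule integral_norm_bound_integral) (auto intro!: integrable_continuous_real continuous_intros c)
  also have "\<dots> \<le> l1 (nth_deriv 1 \<phi>)"
    by (rule has_integral_subset_le[OF _ integrable_integral l1_has_integral[OF test_functions_nth_deriv[OF \<phi>]]])
       (auto intro!: integrable_continuous_real continuous_intros c)
  finally show ?thesis .
qed

lemma sum_unit_integrals: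
  fixes g :: "real \<Rightarrow> real"
  assumes "continuous_on UNIV g"
  shows "(\<Sum>i<n. integral {a + real i..a + real i + 1} g) = integral {a..a + real n} g"
proof (induction n)
  case (Suc n)
  have "integral {a..a + real n} g + integral {a + real n..a + real n + 1} g = integral {a..a + real n + 1} g"
    by (intro Henstock_Kurzweil_Integration.integral_combine integrable_continuous_real continuous_on_subset[OF assms]) auto
  then show ?case using Suc by (simp add: algebra_simps)
qed simp

text \<open>
  Cut \<open>\<psi>\<close> into pieces supported in intervals of length 2 around the integers. Translated back to \<open>{-1..1}\<close>, each
  piece obeys the order bound common to all translates, and the sup norms in that bound are dominated by L1 norms
  of one more derivative over the interval of the piece. Each point lies in only two of these intervals, so the
  sum over all pieces costs a factor 2.
\<close>

theorem L1_order_bound: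
  fixes T :: "(real \<Rightarrow> complex) \<Rightarrow> 'x::complex_banach"
  assumes T: "T \<in> distributions"
    and bounded: "\<And>\<phi>. \<phi> \<in> test_functions \<Longrightarrow> \<exists>B. \<forall>x. norm (orbit T \<phi> x) \<le> B"
  shows "\<exists>k C. C \<ge> 0 \<and> (\<forall>\<psi>\<in>test_functions. norm (T \<psi>) \<le> C * sobolev_norm k \<psi>)"
proof -
  obtain k C where C: "\<And>x. order_bound (\<lambda>\<phi>. orbit T \<phi> x) {-1..1} k C"
    using orbit_uniform_order_bound[OF T, of "{-1..1}"] bounded test_functions_on_subset by blast
  obtain \<beta> where \<beta>: "mollifier 1 \<beta>" using mollifier_exists[of 1] by auto
  have \<rho>: "(\<lambda>x. complex_of_real (\<beta> x)) \<in> test_functions_on {0..1}" using \<beta> by (simp add: mollifier_def)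
  obtain \<theta> where \<theta>: "smooth \<theta>" "\<And>x. x \<le> 0 \<Longrightarrow> \<theta> x = 0" "\<And>x. x \<ge> 1 \<Longrightarrow> \<theta> x = 1"
    using test_functions_antiderivative[OF \<rho> zero_le_one] integral_unique[OF mollifier_integral(2)[OF \<beta>]] by auto
  (* The integer translates of this difference of smooth steps telescope to 1. *)
  define \<zeta>' where "\<zeta>' = (\<lambda>x. shift 1 \<theta> x - \<theta> x)"
  have \<zeta>: "\<zeta>' \<in> test_functions_on {-1..1}"
    using smooth_diff(1)[OF smooth_shift(1)[OF \<theta>(1), of 1] \<theta>(1)] \<theta>(2,3)
    by (auto simp: test_functions_on_def \<zeta>'_def shift_def not_le)
  obtain X where X: "X > 0" "\<And>j x. j \<le> Suc k \<Longrightarrow> norm (nth_deriv j \<zeta>' x) \<le> X"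
    using test_functions_on_bounded[OF \<zeta> compact_Icc, of "Suc k"] by blast
  define D where "D = \<bar>C\<bar> * (2 ^ Suc k * X)"
  have D: "D \<ge> 0" using X by (simp add: D_def)
  have "norm (T \<psi>) \<le> (D * 2) * sobolev_norm (Suc k) \<psi>" if \<psi>: "\<psi> \<in> test_functions" for \<psi>
  proof -
    have sm: "smooth \<psi>" by (rule test_functions_smooth[OF \<psi>])
    obtain R where R: "R > 0" "\<psi> \<in> test_functions_on {-R..R}" by (rule test_functions_supportE[OF \<psi>])
    obtain N :: nat where "R \<le> real N" using real_arch_simple by blast
    then have N: "\<psi> \<in> test_functions_on {-real N..real N}" by (rule test_functions_on_enlarge[OF R(2)])
    (* The centres -N, ..., N of the pieces. *)
    define c where "c = (\<lambda>i. real i - real N)"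
    define p where "p = (\<lambda>i x. \<psi> x * shift (- c i) \<zeta>' x)"
    define g where "g = (\<lambda>x. \<Sum>j\<le>Suc k. norm (nth_deriv j \<psi> x))"
    have gc: "continuous_on S g" for S unfolding g_def by (intro continuous_intros smooth_continuous_on[OF sm])
    have g0: "g x \<ge> 0" for x unfolding g_def by (intro sum_nonneg) auto
    have gi: "(g has_integral sobolev_norm (Suc k) \<psi>) UNIV"
      unfolding g_def sobolev_norm_def by (intro has_integral_sum l1_has_integral test_functions_nth_deriv \<psi>) auto
    have gle: "integral {a..b} g \<le> sobolev_norm (Suc k) \<psi>" for a b
      by (rule has_integral_subset_le[OF _ integrable_integral gi]) (auto intro!: integrable_continuous_real gc g0)
    have p: "p i \<in> test_functions" for i
    proof (rule test_functions_on_subset[OF compact_Icc])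
      show "p i \<in> test_functions_on {-real N..real N}"
        using smooth_mult[OF sm smooth_shift(1)[OF test_functions_onD(1)[OF \<zeta>], of "- c i"]] test_functions_onD(2)[OF N]
        unfolding test_functions_on_def p_def by auto
    qed
    have sum: "(\<Sum>i<2*N+1. p i x) = \<psi> x" for x
    proof (cases "x \<in> {-real N..real N}")
      case True
      (* One cut-off is u i - u (i + 1); on {-N..N} the outermost steps are 1 and 0. *)
      define u where "u = (\<lambda>i. \<theta> (x + real N + 1 - real i))"
      have "(\<Sum>i<2*N+1. shift (- c i) \<zeta>' x) = (\<Sum>i<2*N+1. u i - u (Suc i))"
        by (rule sum.cong) (auto simp: u_def \<zeta>'_def shift_def c_def algebra_simps)
      also have "\<dots> = u 0 - u (2*N+1)" by (rule sum_lessThan_telescope')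
      also have "\<dots> = 1" using \<theta>(2)[of "x - real N"] \<theta>(3)[of "x + real N + 1"] True by (simp add: u_def algebra_simps)
      finally show ?thesis by (simp add: p_def sum_distrib_left[symmetric])
    next
      case False
      then show ?thesis using test_functions_onD(2)[OF N False] by (simp add: p_def)
    qed
    have piece: "norm (T (p i)) \<le> D * integral {c i - 1..c i + 1} g" for i
    proof -
      define \<phi> where "\<phi> = shift (c i) (p i)"
      have \<phi>eq: "\<phi> = (\<lambda>x. shift (c i) \<psi> x * \<zeta>' x)" by (simp add: \<phi>_def p_def shift_def)
      have sms: "smooth (shift (c i) \<psi>)" by (rule smooth_shift(1)[OF sm])
      have \<phi>t: "\<phi> \<in> test_functions_on {-1..1}"
        using smooth_mult[OF sms test_functions_onD(1)[OF \<zeta>]] test_functions_onD(2)[OF \<zeta>]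
        unfolding \<phi>eq test_functions_on_def by auto
      have "norm (orbit T \<phi> (c i)) \<le> C * (2 ^ Suc k * X * integral {c i - 1..c i + 1} g)"
      proof (rule order_boundD[OF C \<phi>t])
        fix j x assume j: "j \<le> k"
        have int: "((\<lambda>t. g (c i + t)) has_integral integral {c i - 1..c i + 1} g) {-1..1}"
          using has_integral_translation[of g "c i" "-1" 1] integrable_continuous_real[OF gc] by simp
        have "norm (nth_deriv j \<phi> x) \<le> l1 (nth_deriv 1 (nth_deriv j \<phi>))"
          by (intro sup_le_l1_deriv test_functions_nth_deriv test_functions_on_subset[OF compact_Icc \<phi>t])
        also have "\<dots> = integral {-1..1} (\<lambda>t. norm (nth_deriv (Suc j) \<phi> t))"
          using test_function_norm_integral(2)[OF test_functions_on_nth_deriv[OF \<phi>t, of "Suc j"]] by (simp add: nth_deriv_nth_deriv)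
        also have "\<dots> \<le> integral {-1..1} (\<lambda>t. 2 ^ Suc k * X * g (c i + t))"
        proof (rule integral_le)
          show "(\<lambda>t. norm (nth_deriv (Suc j) \<phi> t)) integrable_on {-1..1}"
            by (intro integrable_continuous_real continuous_intros smooth_continuous_on test_functions_onD(1)[OF \<phi>t])
          show "(\<lambda>t. 2 ^ Suc k * X * g (c i + t)) integrable_on {-1..1}"
            using has_integral_mult_right[OF int] by blast
          fix t
          have "norm (nth_deriv (Suc j) \<phi> t) \<le> 2 ^ Suc j * (g (c i + t) * X)"
            unfolding \<phi>eq
          proof (rule nth_deriv_mult_bound[OF sms test_functions_onD(1)[OF \<zeta>]])
            fix l assume l: "l \<le> Suc j"
            show "norm (nth_deriv l \<zeta>' t) \<le> X" using X(2) l j by simp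
            have "norm (nth_deriv l \<psi> (c i + t)) \<le> g (c i + t)"
              unfolding g_def by (rule member_le_sum[of l "{..Suc k}" "\<lambda>l. norm (nth_deriv l \<psi> (c i + t))"]) (use l j in auto)
            then show "norm (nth_deriv l (shift (c i) \<psi>) t) \<le> g (c i + t)"
              unfolding smooth_shift(2)[OF sm] by (simp add: shift_def add.commute)
          qed
          also have "\<dots> \<le> 2 ^ Suc k * (g (c i + t) * X)"
            using j g0 X by (intro mult_right_mono power_increasing mult_nonneg_nonneg) (auto simp: less_imp_le)
          finally show "norm (nth_deriv (Suc j) \<phi> t) \<le> 2 ^ Suc k * X * g (c i + t)" by (simp add: mult_ac)
        qed
        also have "\<dots> = 2 ^ Suc k * X * integral {c i - 1..c i + 1} g"
          using has_integral_mult_right[OF int, of "2 ^ Suc k * X"] by (rule integral_unique)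
        finally show "norm (nth_deriv j \<phi> x) \<le> 2 ^ Suc k * X * integral {c i - 1..c i + 1} g" .
      qed
      also have "\<dots> \<le> \<bar>C\<bar> * (2 ^ Suc k * X * integral {c i - 1..c i + 1} g)"
        using X by (intro mult_right_mono mult_nonneg_nonneg Henstock_Kurzweil_Integration.integral_nonneg integrable_continuous_real gc) (auto simp: g0)
      also have "orbit T \<phi> (c i) = T (p i)" by (simp add: \<phi>_def orbit_shift) (simp add: orbit_def shift_def)
      finally show ?thesis by (simp add: D_def mult_ac)
    qed
    have split: "integral {c i - 1..c i + 1} g = integral {(- real N - 1) + real i..(- real N - 1) + real i + 1} g + integral {- real N + real i..- real N + real i + 1} g" for i
    proof -
      have "integral {c i - 1..c i} g + integral {c i..c i + 1} g = integral {c i - 1..c i + 1} g"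
        by (intro Henstock_Kurzweil_Integration.integral_combine integrable_continuous_real gc) auto
      then show ?thesis by (simp add: c_def algebra_simps)
    qed
    have "T \<psi> = T (\<lambda>x. \<Sum>i<2*N+1. p i x)" by (simp only: sum)
    also have "\<dots> = (\<Sum>i<2*N+1. T (p i))" using linear_on_tests_sum[OF distributions_linear[OF T], of "{..<2*N+1}" p] p by blast
    also have "norm \<dots> \<le> (\<Sum>i<2*N+1. D * integral {c i - 1..c i + 1} g)" by (rule sum_norm_le) (rule piece)
    also have "\<dots> = D * ((\<Sum>i<2*N+1. integral {(- real N - 1) + real i..(- real N - 1) + real i + 1} g) + (\<Sum>i<2*N+1. integral {- real N + real i..- real N + real i + 1} g))"
      unfolding split by (simp only: sum_distrib_left[symmetric] sum.distrib)
    also have "\<dots> \<le> D * (sobolev_norm (Suc k) \<psi> + sobolev_norm (Suc k) \<psi>)"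
      unfolding sum_unit_integrals[OF gc] by (intro mult_left_mono add_mono gle D)
    finally show ?thesis by (simp add: mult_ac)
  qed
  then show ?thesis using D by (intro exI[of _ "Suc k"] exI[of _ "D * 2"]) auto
qed

section \<open>Mollification and averaging in L1\<close>

lemma averaged_norm_integral:
  assumes \<phi>: "\<phi> \<in> test_functions_on {-R..R}" and r: "r \<ge> 0"
  shows "integral {-R..R+r} (\<lambda>y. integral {0..r} (\<lambda>s. norm (\<phi> (y - s)))) = r * l1 \<phi>"
proof -
  have c: "continuous_on UNIV \<phi>" using smooth_continuous_on[OF test_functions_onD(1)[OF \<phi>], of UNIV 0] by simp
  have "integral (cbox (-R) (R+r)) (\<lambda>y. integral (cbox 0 r) (\<lambda>s. norm (\<phi> (y - s)))) =
        integral (cbox 0 r) (\<lambda>s. integral (cbox (-R) (R+r)) (\<lambda>y. norm (\<phi> (y - s))))"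
  proof (rule integral_swap_continuous)
    show "continuous_on (cbox (-R, 0) (R+r, r)) (\<lambda>(y, s). norm (\<phi> (y - s)))"
      unfolding split_def by (intro continuous_intros continuous_on_compose2[OF c]) auto
  qed
  also have "\<dots> = integral (cbox 0 r) (\<lambda>s. l1 \<phi>)"
  proof (rule Henstock_Kurzweil_Integration.integral_cong)
    fix s assume s: "s \<in> cbox 0 r"
    have "shift (-s) \<phi> \<in> test_functions_on {-R..R+r}"
      by (rule set_mp[OF test_functions_on_mono test_functions_on_shift[OF \<phi>]]) (use s in auto)
    from test_function_norm_integral(2)[OF this]
    show "integral (cbox (-R) (R+r)) (\<lambda>y. norm (\<phi> (y - s))) = l1 \<phi>"
      using l1_shift[OF test_functions_on_subset[OF compact_Icc \<phi>], of "-s"] by (simp add: shift_def)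
  qed
  finally show ?thesis using r by simp
qed

lemma l1_le_averaged_norm:
  assumes \<phi>: "\<phi> \<in> test_functions_on {-R..R}" and r: "r \<ge> 0" and \<psi>: "\<psi> \<in> test_functions_on {-R..R+r}"
    and c: "c \<ge> 0" and le: "\<And>y. norm (\<psi> y) \<le> c * integral {0..r} (\<lambda>s. norm (\<phi> (y - s)))"
  shows "l1 \<psi> \<le> c * (r * l1 \<phi>)"
proof -
  have cp: "continuous_on UNIV \<phi>" using smooth_continuous_on[OF test_functions_onD(1)[OF \<phi>], of UNIV 0] by simp
  have "continuous_on {-R..R+r} (\<lambda>y. integral (cbox 0 r) (\<lambda>s. norm (\<phi> (y - s))))"
    by (rule integral_continuous_on_param) (auto simp: split_def intro!: continuous_intros continuous_on_compose2[OF cp])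
  then have G: "(\<lambda>y. c * integral {0..r} (\<lambda>s. norm (\<phi> (y - s)))) integrable_on {-R..R+r}"
    by (intro integrable_continuous_real continuous_intros) simp
  have "l1 \<psi> = integral {-R..R+r} (\<lambda>y. norm (\<psi> y))" by (rule test_function_norm_integral(2)[OF \<psi>])
  also have "\<dots> \<le> integral {-R..R+r} (\<lambda>y. c * integral {0..r} (\<lambda>s. norm (\<phi> (y - s))))"
    using smooth_continuous_on[OF test_functions_onD(1)[OF \<psi>], of "{-R..R+r}" 0]
    by (intro integral_le G le integrable_continuous_real continuous_intros) simp
  also have "\<dots> = c * (r * l1 \<phi>)" using averaged_norm_integral[OF \<phi> r] by simp
  finally show ?thesis .
qed

lemma back_average_eq_superposition:
  assumes "smooth \<phi>"
  shows "back_average h \<phi> = superposition (\<lambda>_. complex_of_real (1 / h)) 0 h \<phi>"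
proof (rule ext)
  fix t
  have c: "continuous_on {0..h} (\<lambda>s. \<phi> (t - s))"
    using continuous_on_translates[of "\<lambda>_. 1" \<phi> "{0..h}" 0 t] assms by simp
  have "set_lebesgue_integral lebesgue {0..h} (\<lambda>s. \<phi> (t - s)) = integral {0..h} (\<lambda>s. \<phi> (t - s))"
    by (rule set_lebesgue_integral_eq_integral(2)[OF absolutely_integrable_continuous_real[OF c]])
  then show "back_average h \<phi> t = superposition (\<lambda>_. complex_of_real (1 / h)) 0 h \<phi> t"
    by (simp add: back_average_def superposition_def scaleR_conv_of_real)
qed

lemma back_average_test_function: "\<phi> \<in> test_functions \<Longrightarrow> back_average h \<phi> \<in> test_functions"
  by (simp add: back_average_eq_superposition test_functions_smooth superposition_in_test_functions)

lemma nth_deriv_back_average: "smooth \<phi> \<Longrightarrow> nth_deriv j (back_average h \<phi>) = back_average h (nth_deriv j \<phi>)"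
  by (simp add: back_average_eq_superposition superposition_smooth(2) smooth_nth_deriv)

lemma sobolev_norm_back_average:
  assumes \<phi>: "\<phi> \<in> test_functions" and h: "h > 0"
  shows "sobolev_norm k (back_average h \<phi>) \<le> sobolev_norm k \<phi>"
proof -
  have "l1 (back_average h \<phi>) \<le> l1 \<phi>" if \<phi>: "\<phi> \<in> test_functions" for \<phi>
  proof -
    obtain R where R: "R > 0" "\<phi> \<in> test_functions_on {-R..R}" by (rule test_functions_supportE[OF \<phi>])
    have eq: "back_average h \<phi> = superposition (\<lambda>_. complex_of_real (1 / h)) 0 h \<phi>"
      by (rule back_average_eq_superposition[OF test_functions_smooth[OF \<phi>]])
    have "l1 (back_average h \<phi>) \<le> (1 / h) * (h * l1 \<phi>)"
    proof (rule l1_le_averaged_norm[OF R(2)])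
      show "back_average h \<phi> \<in> test_functions_on {-R..R+h}"
        unfolding eq using superposition_test_function[OF _ R(2), of "\<lambda>_. complex_of_real (1 / h)" 0 h] by simp
      fix y
      have c: "continuous_on {0..h} (\<lambda>s. \<phi> (y - s))"
        using continuous_on_translates[of "\<lambda>_. 1" \<phi> "{0..h}" 0 y] test_functions_smooth[OF \<phi>] by simp
      have "norm (integral {0..h} (\<lambda>s. complex_of_real (1 / h) * \<phi> (y - s))) \<le> integral {0..h} (\<lambda>s. (1 / h) * norm (\<phi> (y - s)))"
        by (rule integral_norm_bound_integral)
           (use h in \<open>auto simp: norm_mult norm_divide intro!: integrable_continuous_real continuous_intros c\<close>)
      then show "norm (back_average h \<phi> y) \<le> (1 / h) * integral {0..h} (\<lambda>s. norm (\<phi> (y - s)))"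
        unfolding eq superposition_def by simp
    qed (use h in auto)
    then show ?thesis using h by simp
  qed
  then show ?thesis
    unfolding sobolev_norm_def nth_deriv_back_average[OF test_functions_smooth[OF \<phi>]]
    by (intro sum_mono) (use test_functions_nth_deriv[OF \<phi>] in auto)
qed

text \<open>
  Convolution is commutative. The first form is the one on which a distribution can be evaluated through an orbit,
  the second one shows that mollifying commutes with differentiation of \<open>\<psi>\<close>.
\<close>

lemma superposition_commute:
  assumes \<rho>: "\<rho> \<in> test_functions_on {0..r}" and \<psi>: "\<psi> \<in> test_functions_on {-R..R}"
  shows "superposition \<psi> (-R) R \<rho> = superposition \<rho> 0 r \<psi>"
proof (rule ext)
  fix y
  define f where "f = (\<lambda>s. \<rho> s * \<psi> (y - s))"
  have "continuous_on UNIV \<rho>" using smooth_continuous_on[OF test_functions_onD(1)[OF \<rho>], of UNIV 0] by simp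
  from continuous_on_translates[OF this test_functions_onD(1)[OF \<psi>], of _ 0 y]
  have fc: "continuous_on S f" for S by (simp add: f_def)
  have fi: "f integrable_on {a..b}" for a b by (rule integrable_continuous_real[OF fc])
  have "superposition \<psi> (-R) R \<rho> y = integral {-R..R} (\<lambda>s. f (y - s))"
    by (simp add: superposition_def f_def mult.commute)
  also have "\<dots> = integral {-R..R} (\<lambda>s. f (y + s))"
    using Henstock_Kurzweil_Integration.integral_reflect_real[where a="-R" and b=R and f="\<lambda>s. f (y + s)"] by simp
  also have "\<dots> = integral {y + - R..y + R} f" by (rule integral_unique[OF has_integral_translation[OF fi]])
  also have "\<dots> = integral {0..r} f"
  proof (rule has_integral_unique[of f _ UNIV])
    show "(f has_integral integral {y + - R..y + R} f) UNIV"
    proof (rule has_integral_on_superset[OF integrable_integral[OF fi]])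
      show "f s = 0" if "s \<notin> {y + - R..y + R}" for s
        using test_functions_onD(2)[OF \<psi>, of "y - s"] that by (auto simp: f_def)
    qed auto
    show "(f has_integral integral {0..r} f) UNIV"
      by (rule has_integral_on_superset[OF integrable_integral[OF fi]])
         (use test_functions_onD(2)[OF \<rho>] in \<open>auto simp: f_def\<close>)
  qed
  finally show "superposition \<psi> (-R) R \<rho> y = superposition \<rho> 0 r \<psi> y"
    by (simp add: superposition_def f_def)
qed

definition mollify :: "(real \<Rightarrow> real) \<Rightarrow> real \<Rightarrow> (real \<Rightarrow> complex) \<Rightarrow> real \<Rightarrow> complex" where
  "mollify \<beta> r \<psi> = superposition (\<lambda>x. complex_of_real (\<beta> x)) 0 r \<psi>"

text \<open>
  The mollifier has mass 1 on \<open>{0..r}\<close>, and \<open>norm (\<phi> y - \<phi> (y - s))\<close> is at most the integral of \<open>norm \<phi>'\<close> over the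
  preceding interval of length \<open>r\<close>. Integrating over \<open>y\<close> costs a factor \<open>r\<close> and one derivative.
\<close>

lemma sobolev_norm_mollify:
  assumes \<beta>: "mollifier r \<beta>" and \<psi>: "\<psi> \<in> test_functions" and r: "r > 0"
  shows "sobolev_norm k (\<lambda>x. \<psi> x - mollify \<beta> r \<psi> x) \<le> r * sobolev_norm (Suc k) \<psi>"
proof -
  have \<beta>c: "continuous_on UNIV (\<lambda>x. complex_of_real (\<beta> x))" and \<beta>c': "continuous_on S \<beta>" and \<beta>0: "\<beta> x \<ge> 0" for x S
    using \<beta> by (auto simp: mollifier_def intro: continuous_intros continuous_on_subset)
  have "l1 (\<lambda>x. \<phi> x - mollify \<beta> r \<phi> x) \<le> r * l1 (nth_deriv 1 \<phi>)" if \<phi>: "\<phi> \<in> test_functions" for \<phi>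
  proof -
    have sm: "smooth \<phi>" by (rule test_functions_smooth[OF \<phi>])
    obtain R where R: "R > 0" "\<phi> \<in> test_functions_on {-R..R}" by (rule test_functions_supportE[OF \<phi>])
    have dc: "continuous_on S (\<lambda>s. nth_deriv j \<phi> (y - s))" for S j y
      using continuous_on_translates[of "\<lambda>_. 1" \<phi> S j y] sm by simp
    have "l1 (\<lambda>x. \<phi> x - mollify \<beta> r \<phi> x) \<le> 1 * (r * l1 (nth_deriv 1 \<phi>))"
    proof (rule l1_le_averaged_norm[of _ R])
      show "nth_deriv 1 \<phi> \<in> test_functions_on {-R..R}" by (rule test_functions_on_nth_deriv[OF R(2)]) simp
      show "(\<lambda>x. \<phi> x - mollify \<beta> r \<phi> x) \<in> test_functions_on {-R..R+r}"
        unfolding mollify_def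
        using superposition_test_function[OF \<beta>c R(2), of 0 r] test_functions_on_mono[of "{-R..R}" "{-R..R+r}"] R(2) r
        by (intro test_functions_on_diff) auto
      fix y
      define G where "G = integral {0..r} (\<lambda>s. norm (nth_deriv 1 \<phi> (y - s)))"
      have Gi: "(\<lambda>s. norm (nth_deriv 1 \<phi> (y - s))) integrable_on {a..b}" for a b
        by (intro integrable_continuous_real continuous_intros dc)
      have near: "norm (\<phi> y - \<phi> (y - s)) \<le> G" if s: "s \<in> {0..r}" for s
      proof -
        have "((\<lambda>t. nth_deriv 1 \<phi> (y - t)) has_integral (\<phi> (y - 0) - \<phi> (y - s))) {0..s}"
          by (rule smooth_reflected_integral[OF sm]) (use s in simp)
        from integral_unique[OF this]
        have "norm (\<phi> y - \<phi> (y - s)) = norm (integral {0..s} (\<lambda>t. nth_deriv 1 \<phi> (y - t)))"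
          by simp
        also have "\<dots> \<le> integral {0..s} (\<lambda>t. norm (nth_deriv 1 \<phi> (y - t)))"
          by (rule integral_norm_bound_integral[OF integrable_continuous_real[OF dc] Gi order_refl])
        also have "\<dots> \<le> G" unfolding G_def
          by (rule integral_subset_le) (use s Gi in auto)
        finally show ?thesis .
      qed
      have i1: "((\<lambda>s. complex_of_real (\<beta> s) * \<phi> y) has_integral 1 * \<phi> y) {0..r}"
        by (rule has_integral_mult_left[OF mollifier_integral(2)[OF \<beta>]])
      have i2: "(\<lambda>s. complex_of_real (\<beta> s) * \<phi> (y - s)) integrable_on {0..r}"
        using integrable_continuous_real[OF continuous_on_translates[OF \<beta>c sm, of _ 0 y]] by simp
      have "((\<lambda>s. complex_of_real (\<beta> s) * \<phi> y - complex_of_real (\<beta> s) * \<phi> (y - s)) has_integral (\<phi> y - mollify \<beta> r \<phi> y)) {0..r}"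
        using has_integral_diff[OF i1 integrable_integral[OF i2]] by (simp add: mollify_def superposition_def)
      then have "norm (\<phi> y - mollify \<beta> r \<phi> y) \<le> integral {0..r} (\<lambda>s. \<beta> s * G)"
      proof (subst (asm) has_integral_iff, elim conjE)
        assume a: "(\<lambda>s. complex_of_real (\<beta> s) * \<phi> y - complex_of_real (\<beta> s) * \<phi> (y - s)) integrable_on {0..r}"
          and b: "integral {0..r} (\<lambda>s. complex_of_real (\<beta> s) * \<phi> y - complex_of_real (\<beta> s) * \<phi> (y - s)) = \<phi> y - mollify \<beta> r \<phi> y"
        show ?thesis unfolding b[symmetric]
        proof (rule integral_norm_bound_integral[OF a])
          show "(\<lambda>s. \<beta> s * G) integrable_on {0..r}" by (intro integrable_continuous_real continuous_intros \<beta>c')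
          show "norm (complex_of_real (\<beta> s) * \<phi> y - complex_of_real (\<beta> s) * \<phi> (y - s)) \<le> \<beta> s * G" if "s \<in> {0..r}" for s
            using near[OF that] \<beta>0[of s] by (simp add: right_diff_distrib[symmetric] norm_mult mult_left_mono)
        qed
      qed
      also have "\<dots> = G" by (simp add: integral_unique[OF mollifier_integral(1)[OF \<beta>]])
      finally show "norm (\<phi> y - mollify \<beta> r \<phi> y) \<le> 1 * integral {0..r} (\<lambda>s. norm (nth_deriv 1 \<phi> (y - s)))"
        by (simp add: G_def)
    qed (use r in auto)
    then show ?thesis by simp
  qed
  note step = this
  have sm: "smooth \<psi>" by (rule test_functions_smooth[OF \<psi>])
  have "nth_deriv j (\<lambda>x. \<psi> x - mollify \<beta> r \<psi> x) = (\<lambda>x. nth_deriv j \<psi> x - mollify \<beta> r (nth_deriv j \<psi>) x)" for j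
    unfolding mollify_def by (simp add: smooth_diff(2)[OF sm superposition_smooth(1)[OF \<beta>c sm]] superposition_smooth(2)[OF \<beta>c sm])
  then have "sobolev_norm k (\<lambda>x. \<psi> x - mollify \<beta> r \<psi> x) \<le> (\<Sum>j\<le>k. r * l1 (nth_deriv (Suc j) \<psi>))"
    unfolding sobolev_norm_def using step[OF test_functions_nth_deriv[OF \<psi>]]
    by (intro sum_mono) (simp add: nth_deriv_nth_deriv)
  also have "\<dots> = r * (\<Sum>j\<le>k. l1 (nth_deriv (Suc j) \<psi>))" by (simp add: sum_distrib_left)
  also have "\<dots> \<le> r * sobolev_norm (Suc k) \<psi>"
    unfolding sobolev_norm_def sum.atMost_Suc_shift using r l1_nonneg[OF \<psi>] by (intro mult_left_mono) auto
  finally show ?thesis .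
qed

lemma DL1_bounded_sobolev_norm:
  assumes "DL1_bounded U"
  shows "\<exists>M>0. \<forall>\<psi>\<in>U. sobolev_norm k \<psi> \<le> M"
proof -
  have U: "U \<subseteq> test_functions" and fin: "\<And>j. (SUP \<phi>\<in>U. \<integral>\<^sup>+x. norm (nth_deriv j \<phi> x) \<partial>lebesgue) < \<infinity>"
    using assms by (auto simp: DL1_bounded_def)
  have "\<exists>M\<ge>0. \<forall>\<psi>\<in>U. l1 (nth_deriv j \<psi>) \<le> M" for j
  proof -
    obtain M where M: "M \<ge> 0" "(SUP \<phi>\<in>U. \<integral>\<^sup>+x. norm (nth_deriv j \<phi> x) \<partial>lebesgue) = ennreal M"
      using fin[of j] by (cases "SUP \<phi>\<in>U. \<integral>\<^sup>+x. norm (nth_deriv j \<phi> x) \<partial>lebesgue") auto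
    have "l1 (nth_deriv j \<psi>) \<le> M" if "\<psi> \<in> U" for \<psi>
    proof -
      have "ennreal (l1 (nth_deriv j \<psi>)) \<le> ennreal M"
        unfolding M(2)[symmetric] using U that
        by (subst nn_integral_eq_l1[symmetric]) (auto intro!: test_functions_nth_deriv SUP_upper)
      then show ?thesis using M(1) by (simp add: ennreal_le_iff)
    qed
    then show ?thesis using M by blast
  qed
  then obtain M where M: "\<And>j. M j \<ge> 0" "\<And>j \<psi>. \<psi> \<in> U \<Longrightarrow> l1 (nth_deriv j \<psi>) \<le> M j" by metis
  have "sobolev_norm k \<psi> \<le> (\<Sum>j\<le>k. M j) + 1" if "\<psi> \<in> U" for \<psi>
    unfolding sobolev_norm_def using sum_mono[of "{..k}" "\<lambda>j. l1 (nth_deriv j \<psi>)" M] M(2)[OF that] by simp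
  moreover have "(\<Sum>j\<le>k. M j) + 1 > 0" using M(1) by (simp add: add_nonneg_pos sum_nonneg)
  ultimately show ?thesis by blast
qed

section \<open>Ergodic means\<close>

lemma ergodic_means_close:
  fixes f g :: "real \<Rightarrow> 'x::banach"
  assumes f: "locally_bochner_integrable f" and g: "locally_bochner_integrable g"
    and m: "has_ergodic_mean f m" and n: "has_ergodic_mean g n" and B: "\<And>x. norm (f x - g x) \<le> B"
  shows "norm (m - n) \<le> B"
proof (rule field_le_epsilon)
  fix e :: real assume "e > 0"
  then have e: "e / 2 > 0" by simp
  obtain H1 where H1: "H1 > 0" "\<And>h x. h \<ge> H1 \<Longrightarrow> norm ((1 / h) *\<^sub>R integral {x..x+h} f - m) \<le> e / 2"
    using m[unfolded has_ergodic_mean_iff[OF f]] e by blast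
  obtain H2 where H2: "H2 > 0" "\<And>h x. h \<ge> H2 \<Longrightarrow> norm ((1 / h) *\<^sub>R integral {x..x+h} g - n) \<le> e / 2"
    using n[unfolded has_ergodic_mean_iff[OF g]] e by blast
  define h where "h = max H1 H2"
  have h: "h > 0" "h \<ge> H1" "h \<ge> H2" using H1(1) by (auto simp: h_def)
  have B0: "B \<ge> 0" using B[of 0] norm_ge_zero order_trans by blast
  note fi = locally_bochner_integrableD(1)[OF f, of 0 h] and gi = locally_bochner_integrableD(1)[OF g, of 0 h]
  have "norm (integral {0..h} f - integral {0..h} g) \<le> B * measure lborel {0..h}"
    using has_integral_bound_real[OF B0 finite.emptyI has_integral_diff[OF integrable_integral[OF fi] integrable_integral[OF gi]]] B by simp
  then have "norm (integral {0..h} f - integral {0..h} g) \<le> B * h" using h by simp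
  then have "(1 / h) * norm (integral {0..h} f - integral {0..h} g) \<le> (1 / h) * (B * h)"
    using h by (intro mult_left_mono) auto
  also have "\<dots> = B" using h by simp
  also have "(1 / h) * norm (integral {0..h} f - integral {0..h} g) = norm ((1 / h) *\<^sub>R (integral {0..h} f - integral {0..h} g))"
    using h by simp
  finally have "norm ((1 / h) *\<^sub>R integral {0..h} f - (1 / h) *\<^sub>R integral {0..h} g) \<le> B" by (simp only: scaleR_diff_right)
  moreover have "norm ((1 / h) *\<^sub>R integral {0..h} f - m) \<le> e / 2" "norm ((1 / h) *\<^sub>R integral {0..h} g - n) \<le> e / 2"
    using H1(2)[OF h(2), of 0] H2(2)[OF h(3), of 0] by simp_all
  ultimately show "norm (m - n) \<le> B + e"
    using norm_triangle_ineq4[of "(1 / h) *\<^sub>R integral {0..h} f - (1 / h) *\<^sub>R integral {0..h} g"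
       "((1 / h) *\<^sub>R integral {0..h} f - m) - ((1 / h) *\<^sub>R integral {0..h} g - n)"]
      norm_triangle_ineq4[of "(1 / h) *\<^sub>R integral {0..h} f - m" "(1 / h) *\<^sub>R integral {0..h} g - n"]
    by simp
qed

lemma ergodic_mean_eq:
  fixes f :: "real \<Rightarrow> 'x::banach"
  assumes f: "locally_bochner_integrable f" and m: "has_ergodic_mean f m"
  shows "ergodic_mean f = m"
  unfolding ergodic_mean_def
proof (rule the_equality[of "has_ergodic_mean f", OF m])
  show "n = m" if "has_ergodic_mean f n" for n
    using ergodic_means_close[OF f f that m, of 0] by simp
qed

lemma has_ergodic_mean_add:
  fixes f g :: "real \<Rightarrow> 'x::banach"
  assumes f: "continuous_on UNIV f" and g: "continuous_on UNIV g"
    and m: "has_ergodic_mean f m" and n: "has_ergodic_mean g n"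
  shows "has_ergodic_mean (\<lambda>x. f x + g x) (m + n)"
proof -
  have fg: "continuous_on UNIV (\<lambda>x. f x + g x)" by (intro continuous_intros f g)
  note loc = locally_bochner_integrable_continuous
  show ?thesis
    unfolding has_ergodic_mean_iff[OF loc[OF fg]]
  proof (intro allI impI)
    fix \<epsilon> :: real assume "\<epsilon> > 0"
    then have e: "\<epsilon> / 2 > 0" by simp
    obtain H1 where H1: "H1 > 0" "\<And>h x. h \<ge> H1 \<Longrightarrow> norm ((1 / h) *\<^sub>R integral {x..x+h} f - m) \<le> \<epsilon> / 2"
      using m[unfolded has_ergodic_mean_iff[OF loc[OF f]]] e by blast
    obtain H2 where H2: "H2 > 0" "\<And>h x. h \<ge> H2 \<Longrightarrow> norm ((1 / h) *\<^sub>R integral {x..x+h} g - n) \<le> \<epsilon> / 2"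
      using n[unfolded has_ergodic_mean_iff[OF loc[OF g]]] e by blast
    have "norm ((1 / h) *\<^sub>R integral {x..x+h} (\<lambda>x. f x + g x) - (m + n)) \<le> \<epsilon>" if h: "h \<ge> max H1 H2" for h x
    proof -
      have "integral {x..x+h} (\<lambda>x. f x + g x) = integral {x..x+h} f + integral {x..x+h} g"
        by (rule Henstock_Kurzweil_Integration.integral_add) (intro locally_bochner_integrableD(1)[OF loc] f g)+
      then have "(1 / h) *\<^sub>R integral {x..x+h} (\<lambda>x. f x + g x) - (m + n)
          = ((1 / h) *\<^sub>R integral {x..x+h} f - m) + ((1 / h) *\<^sub>R integral {x..x+h} g - n)"
        by (simp add: scaleR_add_right)
      also have "norm \<dots> \<le> \<epsilon> / 2 + \<epsilon> / 2"
        by (rule norm_triangle_mono) (use H1(2)[of h x] H2(2)[of h x] h in auto)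
      finally show ?thesis by simp
    qed
    then show "\<exists>H>0. \<forall>h\<ge>H. \<forall>x. norm ((1 / h) *\<^sub>R integral {x..x+h} (\<lambda>x. f x + g x) - (m + n)) \<le> \<epsilon>"
      using H1(1) by (intro exI[of _ "max H1 H2"]) auto
  qed
qed

lemma has_ergodic_mean_scaleC:
  fixes f :: "real \<Rightarrow> 'x::complex_banach"
  assumes f: "continuous_on UNIV f" and m: "has_ergodic_mean f m"
  shows "has_ergodic_mean (\<lambda>x. c *\<^sub>C f x) (c *\<^sub>C m)"
proof -
  have bl: "bounded_linear (\<lambda>x. c *\<^sub>C (x::'x))" by (rule scaleC.bounded_linear_right)
  have cf: "continuous_on UNIV (\<lambda>x. c *\<^sub>C f x)" by (rule bounded_linear.continuous_on[OF bl f])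
  note loc = locally_bochner_integrable_continuous
  show ?thesis
    unfolding has_ergodic_mean_iff[OF loc[OF cf]]
  proof (intro allI impI)
    fix \<epsilon> :: real assume "\<epsilon> > 0"
    then have e: "\<epsilon> / (norm c + 1) > 0" by (simp add: add_nonneg_pos)
    obtain H where H: "H > 0" "\<And>h x. h \<ge> H \<Longrightarrow> norm ((1 / h) *\<^sub>R integral {x..x+h} f - m) \<le> \<epsilon> / (norm c + 1)"
      using m[unfolded has_ergodic_mean_iff[OF loc[OF f]]] e by blast
    have "norm ((1 / h) *\<^sub>R integral {x..x+h} (\<lambda>x. c *\<^sub>C f x) - c *\<^sub>C m) \<le> \<epsilon>" if h: "h \<ge> H" for h x
    proof -
      have "integral {x..x+h} (\<lambda>x. c *\<^sub>C f x) = c *\<^sub>C integral {x..x+h} f"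
        using integral_linear[OF locally_bochner_integrableD(1)[OF loc[OF f]] bl] by (simp add: o_def)
      then have "(1 / h) *\<^sub>R integral {x..x+h} (\<lambda>x. c *\<^sub>C f x) - c *\<^sub>C m = c *\<^sub>C ((1 / h) *\<^sub>R integral {x..x+h} f - m)"
        by (simp add: scaleC.diff_right scaleC_scaleR_right)
      also have "norm \<dots> = norm c * norm ((1 / h) *\<^sub>R integral {x..x+h} f - m)" by (rule norm_scaleC)
      also have "\<dots> \<le> norm c * (\<epsilon> / (norm c + 1))" using H(2)[OF h] by (intro mult_left_mono) auto
      also have "\<dots> \<le> (norm c + 1) * (\<epsilon> / (norm c + 1))" using e by (intro mult_right_mono) auto
      also have "\<dots> = \<epsilon>" by (simp add: add_nonneg_eq_0_iff)
      finally show ?thesis .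
    qed
    then show "\<exists>H>0. \<forall>h\<ge>H. \<forall>x. norm ((1 / h) *\<^sub>R integral {x..x+h} (\<lambda>x. c *\<^sub>C f x) - c *\<^sub>C m) \<le> \<epsilon>"
      using H(1) by blast
  qed
qed

lemma has_ergodic_mean_translate:
  assumes "has_ergodic_mean f m"
  shows "has_ergodic_mean (\<lambda>x. f (x + a)) m"
proof -
  define N where "N = (\<lambda>T x. ennreal (norm ((1 / T) *\<^sub>R bochner_int lebesgue (\<lambda>s. indicator {0..T} s *\<^sub>R f (x + s)) - m)))"
  have "(SUP x. N T (x + a)) = (SUP x. N T x)" for T
  proof -
    have "(\<lambda>x. N T (x + a)) ` UNIV = N T ` UNIV"
    proof
      show "N T ` UNIV \<subseteq> (\<lambda>x. N T (x + a)) ` UNIV"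
      proof
        fix y assume "y \<in> N T ` UNIV"
        then obtain x where "y = N T x" by blast
        then have "y = N T ((x - a) + a)" by simp
        then show "y \<in> (\<lambda>x. N T (x + a)) ` UNIV" by blast
      qed
    qed auto
    then show ?thesis by simp
  qed
  then show ?thesis
    using assms unfolding has_ergodic_mean_def N_def by (simp add: add.assoc add.left_commute add.commute)
qed

lemma ergodic_distributionsI:
  assumes T: "T \<in> distributions" and m: "\<And>\<phi>. \<phi> \<in> test_functions \<Longrightarrow> \<exists>m. has_ergodic_mean (orbit T \<phi>) m"
  shows "T \<in> ergodic_distributions"
  using T m[OF test_functions_reflect] orbit_locally_bochner_integrable[OF T test_functions_reflect]
  by (auto simp: ergodic_distributions_def ergodic_functions_def dist_conv_eq_orbit)

section \<open>Locally integrable functions as distributions\<close>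

lemma dist_of_eq_integral:
  fixes f :: "real \<Rightarrow> 'x::complex_banach"
  assumes f: "locally_bochner_integrable f" and \<phi>: "\<phi> \<in> test_functions_on {a..b}"
  shows "dist_of f \<phi> = integral {a..b} (\<lambda>t. \<phi> t *\<^sub>C f t)" "(\<lambda>t. \<phi> t *\<^sub>C f t) integrable_on {c..d}"
proof -
  have "continuous_on UNIV \<phi>" using smooth_continuous_on[OF test_functions_onD(1)[OF \<phi>], of UNIV 0] by simp
  then have loc: "locally_bochner_integrable (\<lambda>t. \<phi> t *\<^sub>C f t)" by (rule locally_bochner_integrable_scaleC[OF f])
  show "(\<lambda>t. \<phi> t *\<^sub>C f t) integrable_on {c..d}" by (rule locally_bochner_integrableD(1)[OF loc])
  have "bochner_int lebesgue (\<lambda>t. \<phi> t *\<^sub>C f t) = integral {a..b} (\<lambda>t. \<phi> t *\<^sub>C f t)"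
    by (rule bochner_int_compact_support[OF loc]) (simp add: test_functions_onD(2)[OF \<phi>] scaleC.zero_left)
  then show "dist_of f \<phi> = integral {a..b} (\<lambda>t. \<phi> t *\<^sub>C f t)"
    using test_functions_on_subset[OF compact_Icc \<phi>] by (simp add: dist_of_def on_tests_def)
qed

lemma dist_of_distribution:
  fixes f :: "real \<Rightarrow> 'x::complex_banach"
  assumes f: "locally_bochner_integrable f"
  shows "dist_of f \<in> distributions"
proof (rule distributionsI)
  show "dist_of f \<phi> = 0" if "\<phi> \<notin> test_functions" for \<phi> using that by (simp add: dist_of_def on_tests_def)
  show "linear_on_tests (dist_of f)" unfolding linear_on_tests_def
  proof (intro conjI ballI allI)
    fix \<phi> \<psi> :: "real \<Rightarrow> complex" assume "\<phi> \<in> test_functions" "\<psi> \<in> test_functions"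
    then obtain R where R: "\<phi> \<in> test_functions_on {-R..R}" "\<psi> \<in> test_functions_on {-R..R}"
      by (metis test_functions_common_support)
    show "dist_of f (\<lambda>x. \<phi> x + \<psi> x) = dist_of f \<phi> + dist_of f \<psi>"
      unfolding dist_of_eq_integral(1)[OF f test_functions_on_add[OF R]] dist_of_eq_integral(1)[OF f R(1)] dist_of_eq_integral(1)[OF f R(2)]
      unfolding scaleC_add_left
      by (rule Henstock_Kurzweil_Integration.integral_add[OF dist_of_eq_integral(2)[OF f R(1)] dist_of_eq_integral(2)[OF f R(2)]])
  next
    fix \<phi> :: "real \<Rightarrow> complex" and c assume "\<phi> \<in> test_functions"
    then obtain R where R: "\<phi> \<in> test_functions_on {-R..R}" by (metis test_functions_supportE)
    show "dist_of f (\<lambda>x. c * \<phi> x) = c *\<^sub>C dist_of f \<phi>"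
      unfolding dist_of_eq_integral(1)[OF f test_functions_on_cmult[OF R]] dist_of_eq_integral(1)[OF f R]
      using integral_linear[OF dist_of_eq_integral(2)[OF f R] scaleC.bounded_linear_right[of c]]
      by (simp add: o_def scaleC_scaleC)
  qed
  fix R :: real
  have "order_bound (dist_of f) {-R..R} 0 (integral {-R..R} (\<lambda>t. norm (f t)))"
    unfolding order_bound_def
  proof (intro ballI allI impI)
    fix \<phi> B assume \<phi>: "\<phi> \<in> test_functions_on {-R..R}" and "\<forall>j\<le>0. \<forall>x. norm (nth_deriv j \<phi> x) \<le> B"
    then have B: "norm (\<phi> x) \<le> B" for x by simp
    note fn = locally_bochner_integrableD(2)[OF f, of "-R" R]
    have "norm (integral {-R..R} (\<lambda>t. \<phi> t *\<^sub>C f t)) \<le> integral {-R..R} (\<lambda>t. B * norm (f t))"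
      by (rule integral_norm_bound_integral[OF dist_of_eq_integral(2)[OF f \<phi>] integrable_on_mult_right[OF fn]])
         (simp add: norm_scaleC B mult_right_mono)
    then show "norm (dist_of f \<phi>) \<le> integral {-R..R} (\<lambda>t. norm (f t)) * B"
      using fn by (simp add: dist_of_eq_integral(1)[OF f \<phi>] mult.commute)
  qed
  then show "\<exists>k C. order_bound (dist_of f) {-R..R} k C" by blast
qed

text \<open>
  Along a fine partition of \<open>{a..b}\<close> the increments of \<open>A\<close> telescope, so the total increment of \<open>F\<close> is at most
  \<open>\<epsilon> * (A b - A a)\<close> for every \<open>\<epsilon>\<close>. This takes the place of a vanishing derivative when \<open>F\<close> is not differentiable everywhere.
\<close>

lemma increment_criterion:
  fixes F :: "real \<Rightarrow> 'x::real_normed_vector" and A :: "real \<Rightarrow> real"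
  assumes ab: "a \<le> b"
    and small: "\<And>\<epsilon>. \<epsilon> > 0 \<Longrightarrow> \<exists>\<delta>>0. \<forall>s t. a \<le> s \<and> s \<le> t \<and> t \<le> b \<and> t - s < \<delta> \<longrightarrow> norm (F t - F s) \<le> \<epsilon> * (A t - A s)"
  shows "F b = F a"
proof -
  have "norm (F b - F a) \<le> \<epsilon> * (A b - A a)" if e: "\<epsilon> > 0" for \<epsilon>
  proof -
    obtain \<delta> where \<delta>: "\<delta> > 0" and st: "\<And>s t. a \<le> s \<Longrightarrow> s \<le> t \<Longrightarrow> t \<le> b \<Longrightarrow> t - s < \<delta> \<Longrightarrow> norm (F t - F s) \<le> \<epsilon> * (A t - A s)"
      using small[OF e] by blast
    have "norm (F t - F a) \<le> \<epsilon> * (A t - A a)" if "a \<le> t" "t \<le> b" "t - a \<le> real n * (\<delta> / 2)" for n t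
      using that
    proof (induction n arbitrary: t)
      case 0
      then have "t = a" by simp
      then show ?case by simp
    next
      case (Suc n)
      define s where "s = max a (t - \<delta> / 2)"
      have s: "a \<le> s" "s \<le> t" "s \<le> b" "t - s < \<delta>" "s - a \<le> real n * (\<delta> / 2)"
        using Suc.prems \<delta> by (auto simp: s_def algebra_simps max_def)
      have "norm (F t - F a) \<le> norm (F t - F s) + norm (F s - F a)"
        using norm_triangle_ineq[of "F t - F s" "F s - F a"] by simp
      also have "\<dots> \<le> \<epsilon> * (A t - A s) + \<epsilon> * (A s - A a)"
        by (intro add_mono st Suc.IH s Suc.prems)
      finally show ?case by (simp add: algebra_simps)
    qed
    moreover obtain n where "b - a \<le> real n * (\<delta> / 2)" using reals_Archimedean3[of "\<delta>/2"] \<delta> by (metis half_gt_zero less_imp_le)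
    ultimately show ?thesis using ab by blast
  qed
  note le = this
  have "norm (F b - F a) \<le> 0 + e" if e: "e > 0" for e
  proof -
    have "norm (F b - F a) \<le> (e / (\<bar>A b - A a\<bar> + 1)) * (A b - A a)" by (rule le) (use e in \<open>simp add: add_nonneg_pos\<close>)
    also have "\<dots> \<le> (e / (\<bar>A b - A a\<bar> + 1)) * (\<bar>A b - A a\<bar> + 1)" using e by (intro mult_left_mono) (auto simp: add_nonneg_pos)
    also have "\<dots> = e" by (simp add: add_nonneg_eq_0_iff)
    finally show ?thesis by simp
  qed
  then have "norm (F b - F a) \<le> 0" by (rule field_le_epsilon)
  then show ?thesis by simp
qed

lemma primitive_exists:
  fixes f :: "real \<Rightarrow> 'x::banach"
  assumes f: "\<And>a b. f integrable_on {a..b}"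
  shows "\<exists>P. continuous_on UNIV P \<and> (\<forall>a b. a \<le> b \<longrightarrow> P b - P a = integral {a..b} f)"
proof -
  define P where "P = (\<lambda>t. if t \<ge> 0 then integral {0..t} f else - integral {t..0} f)"
  have comb: "integral {a..c} f + integral {c..b} f = integral {a..b} f" if "a \<le> c" "c \<le> b" for a b c
    by (rule Henstock_Kurzweil_Integration.integral_combine[OF that f])
  have diff: "P b - P a = integral {a..b} f" if ab: "a \<le> b" for a b
  proof (cases "0 \<le> a")
    case True
    then show ?thesis using comb[of 0 a b] ab by (simp add: P_def algebra_simps)
  next
    case False
    show ?thesis
    proof (cases "0 \<le> b")
      case True
      then show ?thesis using comb[of a 0 b] False by (simp add: P_def add.commute)
    next
      case b: False
      then show ?thesis using comb[of a b 0] ab False by (simp add: P_def algebra_simps)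
    qed
  qed
  have "isCont P t" for t
  proof -
    have "continuous_on {t-1..t+1} (\<lambda>s. P (t-1) + integral {t-1..s} f)"
      by (intro continuous_intros indefinite_integral_continuous_1 f)
    then have "continuous_on {t-1..t+1} P"
    proof (rule continuous_on_eq)
      fix s assume "s \<in> {t-1..t+1}"
      then have "t - 1 \<le> s" by simp
      from diff[OF this, symmetric] show "P (t-1) + integral {t-1..s} f = P s" by simp
    qed
    then have "continuous_on {t-1<..<t+1} P" by (rule continuous_on_subset) auto
    then show ?thesis by (simp add: continuous_on_eq_continuous_at)
  qed
  then show ?thesis using diff by (intro exI[of _ P]) (auto intro: continuous_at_imp_continuous_on)
qed

text \<open>
  Integration by parts. The primitive \<open>P\<close> need not be differentiable at every point, so the difference of the two
  sides is followed through its increments: over a short interval from \<open>s\<close> to \<open>t\<close> the boundary terms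
  cancel and there remain the integrals of \<open>(\<psi> r - \<psi> s) *\<^sub>C f r\<close> and of \<open>\<psi>' r *\<^sub>C (P r - P t)\<close>, in which the
  differences are uniformly small.
\<close>

lemma dist_of_primitive:
  fixes f :: "real \<Rightarrow> 'x::complex_banach"
  assumes f: "locally_bochner_integrable f" and P: "continuous_on UNIV P" "\<And>a b. a \<le> b \<Longrightarrow> P b - P a = integral {a..b} f"
    and \<psi>: "\<psi> \<in> test_functions"
  shows "dist_of f \<psi> = - dist_of P (nth_deriv 1 \<psi>)"
proof -
  have Pl: "locally_bochner_integrable P" by (rule locally_bochner_integrable_continuous[OF P(1)])
  obtain R where R: "R > 0" "\<psi> \<in> test_functions_on {-R..R}" by (rule test_functions_supportE[OF \<psi>])
  (* Slightly beyond the support, so that the boundary terms vanish. *)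
  define a b where "a = - (R + 1)" and "b = R + 1"
  have ab: "a \<le> b" using R by (simp add: a_def b_def)
  have \<psi>ab: "\<psi> \<in> test_functions_on {a..b}" unfolding a_def b_def by (rule test_functions_on_enlarge[OF R(2)]) simp
  have zero: "\<psi> a = 0" "\<psi> b = 0" using test_functions_onD(2)[OF R(2)] by (auto simp: a_def b_def)
  have sm: "smooth \<psi>" by (rule test_functions_smooth[OF \<psi>])
  define \<psi>' where "\<psi>' = nth_deriv 1 \<psi>"
  have \<psi>'ab: "\<psi>' \<in> test_functions_on {a..b}" unfolding \<psi>'_def by (rule test_functions_on_nth_deriv[OF \<psi>ab]) simp
  have \<psi>'c: "continuous_on S \<psi>'" for S unfolding \<psi>'_def by (rule smooth_continuous_on[OF sm])
  have \<psi>c: "continuous_on S \<psi>" for S using smooth_continuous_on[OF sm, of S 0] by simp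
  have i1: "(\<lambda>t. \<psi> t *\<^sub>C f t) integrable_on {c..d}" for c d by (rule dist_of_eq_integral(2)[OF f \<psi>ab])
  have i2: "(\<lambda>t. \<psi>' t *\<^sub>C P t) integrable_on {c..d}" for c d by (rule dist_of_eq_integral(2)[OF Pl \<psi>'ab])
  have i3: "f integrable_on {c..d}" "(\<lambda>t. norm (f t)) integrable_on {c..d}" for c d
    using locally_bochner_integrableD[OF f] by blast+
  have i4: "(\<lambda>t. norm (\<psi>' t)) integrable_on {c..d}" for c d by (intro integrable_continuous_real continuous_intros \<psi>'c)
  define F where "F = (\<lambda>t. integral {a..t} (\<lambda>t. \<psi> t *\<^sub>C f t) - \<psi> t *\<^sub>C P t + integral {a..t} (\<lambda>t. \<psi>' t *\<^sub>C P t))"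
  define A where "A = (\<lambda>t. integral {a..t} (\<lambda>t. norm (f t)) + integral {a..t} (\<lambda>t. norm (\<psi>' t)))"
  have "F b = F a"
  proof (rule increment_criterion[OF ab, of F A])
    fix \<epsilon> :: real assume e: "\<epsilon> > 0"
    have "uniformly_continuous_on {a..b} \<psi>" "uniformly_continuous_on {a..b} P"
      using \<psi>c P(1) by (auto intro!: compact_uniformly_continuous intro: continuous_on_subset)
    then obtain d1 d2 where d1: "d1 > 0" "\<And>x y. x \<in> {a..b} \<Longrightarrow> y \<in> {a..b} \<Longrightarrow> dist y x < d1 \<Longrightarrow> dist (\<psi> y) (\<psi> x) < \<epsilon>"
      and d2: "d2 > 0" "\<And>x y. x \<in> {a..b} \<Longrightarrow> y \<in> {a..b} \<Longrightarrow> dist y x < d2 \<Longrightarrow> dist (P y) (P x) < \<epsilon>"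
      unfolding uniformly_continuous_on_def using e by metis
    show "\<exists>\<delta>>0. \<forall>s t. a \<le> s \<and> s \<le> t \<and> t \<le> b \<and> t - s < \<delta> \<longrightarrow> norm (F t - F s) \<le> \<epsilon> * (A t - A s)"
    proof (intro exI[of _ "min d1 d2"] conjI allI impI)
      show "min d1 d2 > 0" using d1 d2 by simp
      fix s t assume "a \<le> s \<and> s \<le> t \<and> t \<le> b \<and> t - s < min d1 d2"
      then have st: "a \<le> s" "s \<le> t" "t \<le> b" "t - s < d1" "t - s < d2" by auto
      have comb: "integral {a..t} g - integral {a..s} g = integral {s..t} g" if "\<And>c d. g integrable_on {c..d}" for g :: "real \<Rightarrow> 'y::banach"
        using Henstock_Kurzweil_Integration.integral_combine[OF st(1,2) that] by (simp add: algebra_simps)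
      have At: "A t - A s = integral {s..t} (\<lambda>t. norm (f t)) + integral {s..t} (\<lambda>t. norm (\<psi>' t))"
        unfolding A_def using comb[OF i3(2)] comb[OF i4] by simp
      have Ft: "F t - F s = integral {s..t} (\<lambda>t. \<psi> t *\<^sub>C f t) - (\<psi> t *\<^sub>C P t - \<psi> s *\<^sub>C P s) + integral {s..t} (\<lambda>t. \<psi>' t *\<^sub>C P t)"
        unfolding F_def comb[OF i1, symmetric] comb[OF i2, symmetric] by simp
      have h1: "((\<lambda>r. (\<psi> r - \<psi> s) *\<^sub>C f r) has_integral (integral {s..t} (\<lambda>t. \<psi> t *\<^sub>C f t) - \<psi> s *\<^sub>C (P t - P s))) {s..t}"
        unfolding scaleC.diff_left P(2)[OF st(2)]
        by (intro has_integral_diff integrable_integral i1 has_integral_linear[OF integrable_integral[OF i3(1)] scaleC.bounded_linear_right, unfolded o_def])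
      have d\<psi>: "(\<psi>' has_integral (\<psi> t - \<psi> s)) {s..t}"
        unfolding \<psi>'_def
        by (rule fundamental_theorem_of_calculus[OF st(2)])
           (use smooth_has_vector_derivative[OF sm, of 0] in \<open>simp add: has_vector_derivative_at_within\<close>)
      have h2: "((\<lambda>r. \<psi>' r *\<^sub>C (P r - P t)) has_integral (integral {s..t} (\<lambda>t. \<psi>' t *\<^sub>C P t) - (\<psi> t - \<psi> s) *\<^sub>C P t)) {s..t}"
        unfolding scaleC.diff_right
        by (intro has_integral_diff integrable_integral i2 has_integral_linear[OF d\<psi> scaleC.bounded_linear_left, unfolded o_def])
      have "F t - F s = integral {s..t} (\<lambda>r. (\<psi> r - \<psi> s) *\<^sub>C f r) + integral {s..t} (\<lambda>r. \<psi>' r *\<^sub>C (P r - P t))"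
        unfolding Ft integral_unique[OF h1] integral_unique[OF h2] by (simp add: scaleC.diff_left scaleC.diff_right algebra_simps)
      also have "norm \<dots> \<le> integral {s..t} (\<lambda>r. \<epsilon> * norm (f r)) + integral {s..t} (\<lambda>r. \<epsilon> * norm (\<psi>' r))"
      proof (rule norm_triangle_mono)
        show "norm (integral {s..t} (\<lambda>r. (\<psi> r - \<psi> s) *\<^sub>C f r)) \<le> integral {s..t} (\<lambda>r. \<epsilon> * norm (f r))"
        proof (rule integral_norm_bound_integral)
          show "(\<lambda>r. (\<psi> r - \<psi> s) *\<^sub>C f r) integrable_on {s..t}" using h1 by blast
          show "(\<lambda>r. \<epsilon> * norm (f r)) integrable_on {s..t}" by (intro integrable_on_mult_right i3)
          show "norm ((\<psi> r - \<psi> s) *\<^sub>C f r) \<le> \<epsilon> * norm (f r)" if "r \<in> {s..t}" for r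
            unfolding norm_scaleC
            by (rule mult_right_mono) (use d1(2)[of s r] that st in \<open>auto simp: dist_norm\<close>)
        qed
        show "norm (integral {s..t} (\<lambda>r. \<psi>' r *\<^sub>C (P r - P t))) \<le> integral {s..t} (\<lambda>r. \<epsilon> * norm (\<psi>' r))"
        proof (rule integral_norm_bound_integral)
          show "(\<lambda>r. \<psi>' r *\<^sub>C (P r - P t)) integrable_on {s..t}" using h2 by blast
          show "(\<lambda>r. \<epsilon> * norm (\<psi>' r)) integrable_on {s..t}" by (intro integrable_on_mult_right i4)
          show "norm (\<psi>' r *\<^sub>C (P r - P t)) \<le> \<epsilon> * norm (\<psi>' r)" if "r \<in> {s..t}" for r
            unfolding norm_scaleC mult.commute[of \<epsilon>]
            by (rule mult_left_mono) (use d2(2)[of t r] that st in \<open>auto simp: dist_norm\<close>)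
        qed
      qed
      also have "\<dots> = \<epsilon> * (A t - A s)" unfolding At by (simp add: distrib_left)
      finally show "norm (F t - F s) \<le> \<epsilon> * (A t - A s)" .
    qed
  qed
  then have "integral {a..b} (\<lambda>t. \<psi> t *\<^sub>C f t) = - integral {a..b} (\<lambda>t. \<psi>' t *\<^sub>C P t)"
    by (simp add: F_def zero scaleC.zero_left eq_neg_iff_add_eq_0)
  then show ?thesis
    unfolding \<psi>'_def[symmetric] dist_of_eq_integral(1)[OF f \<psi>ab] dist_of_eq_integral(1)[OF Pl \<psi>'ab] .
qed

lemma smeared_mean_close:
  fixes g :: "real \<Rightarrow> 'x::complex_banach"
  assumes \<phi>: "\<phi> \<in> test_functions_on {a..b}" and i: "(\<lambda>t. \<phi> t *\<^sub>C g t) integrable_on {a..b}"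
    and close: "\<And>t. norm (g t - m) \<le> \<eta>"
  shows "norm (integral {a..b} (\<lambda>t. \<phi> t *\<^sub>C g t) - (LINT x|lebesgue. \<phi> x) *\<^sub>C m) \<le> \<eta> * l1 \<phi>"
proof -
  have \<phi>i: "\<phi> integrable_on {a..b}"
    using smooth_continuous_on[OF test_functions_onD(1)[OF \<phi>], of _ 0] by (intro integrable_continuous_real) simp
  have "((\<lambda>t. \<phi> t *\<^sub>C (g t - m)) has_integral (integral {a..b} (\<lambda>t. \<phi> t *\<^sub>C g t) - (LINT x|lebesgue. \<phi> x) *\<^sub>C m)) {a..b}"
    unfolding LINT_test_function[OF \<phi>] scaleC.diff_right
    by (intro has_integral_diff integrable_integral i has_integral_linear[OF integrable_integral[OF \<phi>i] scaleC.bounded_linear_left, unfolded o_def])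
  moreover have "norm (integral {a..b} (\<lambda>t. \<phi> t *\<^sub>C (g t - m))) \<le> integral {a..b} (\<lambda>t. \<eta> * norm (\<phi> t))"
  proof (rule integral_norm_bound_integral)
    show "(\<lambda>t. \<phi> t *\<^sub>C (g t - m)) integrable_on {a..b}" using calculation by blast
    show "(\<lambda>t. \<eta> * norm (\<phi> t)) integrable_on {a..b}"
      using smooth_continuous_on[OF test_functions_onD(1)[OF \<phi>], of _ 0]
      by (intro integrable_on_mult_right integrable_continuous_real continuous_intros) simp
    show "norm (\<phi> t *\<^sub>C (g t - m)) \<le> \<eta> * norm (\<phi> t)" for t
      unfolding norm_scaleC mult.commute[of \<eta>] by (rule mult_left_mono[OF close]) simp
  qed
  ultimately show ?thesis
    unfolding test_function_norm_integral(2)[OF \<phi>] by (simp add: integral_unique)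
qed

text \<open>
  The orbit of \<open>\<phi>\<close> under \<open>f\<close> has the orbit under the primitive \<open>P\<close> as an antiderivative. Its mean over \<open>{x..x+h}\<close> is
  therefore \<open>(P (x + t + h) - P (x + t)) / h\<close> smeared with \<open>\<phi> t\<close>, and these quotients are the means of \<open>f\<close> over complete
  windows of length \<open>h\<close>, which converge uniformly. That only complete windows occur is essential: ergodicity gives no uniform
  bound on the integral of \<open>norm f\<close> over short intervals at the ends of a window.
\<close>

theorem dist_of_ergodic_mean:
  fixes f :: "real \<Rightarrow> 'x::complex_banach"
  assumes f: "locally_bochner_integrable f" and m: "has_ergodic_mean f m" and \<phi>: "\<phi> \<in> test_functions"
  shows "has_ergodic_mean (orbit (dist_of f) \<phi>) ((LINT x|lebesgue. \<phi> x) *\<^sub>C m)"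
proof -
  note fD = dist_of_distribution[OF f]
  obtain P where P: "continuous_on UNIV P" "\<And>a b. a \<le> b \<Longrightarrow> P b - P a = integral {a..b} f"
    using primitive_exists[OF locally_bochner_integrableD(1)[OF f]] by blast
  have Pl: "locally_bochner_integrable P" by (rule locally_bochner_integrable_continuous[OF P(1)])
  note PD = dist_of_distribution[OF Pl]
  obtain R where R: "R > 0" "\<phi> \<in> test_functions_on {-R..R}" by (rule test_functions_supportE[OF \<phi>])
  have orb: "orbit (dist_of f) \<phi> = (\<lambda>x. - orbit (dist_of P) (nth_deriv 1 \<phi>) x)"
    using dist_of_primitive[OF f P test_functions_shift[OF \<phi>]]
    by (simp add: orbit_def fun_eq_iff smooth_shift(2)[OF test_functions_smooth[OF \<phi>]])
  have \<phi>c: "continuous_on UNIV \<phi>" using smooth_continuous_on[OF test_functions_smooth[OF \<phi>], of UNIV 0] by simp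
  have Pc: "continuous_on S (\<lambda>t. \<phi> t *\<^sub>C P (x + t))" for x S
    by (intro scaleC.continuous_on continuous_on_subset[OF \<phi>c] continuous_on_compose2[OF P(1)] continuous_intros) auto
  have orbP: "orbit (dist_of P) \<phi> x = integral {-R..R} (\<lambda>t. \<phi> t *\<^sub>C P (x + t))" for x
  proof -
    have sh: "shift (- x) \<phi> \<in> test_functions_on {x + - R..x + R}"
      using test_functions_on_shift[OF R(2), of "- x"] by (simp add: add.commute)
    have "orbit (dist_of P) \<phi> x = integral {x + - R..x + R} (\<lambda>t. shift (- x) \<phi> t *\<^sub>C P t)"
      unfolding orbit_def by (rule dist_of_eq_integral(1)[OF Pl sh])
    then show ?thesis
      using integral_unique[OF has_integral_translation[OF dist_of_eq_integral(2)[OF Pl sh], of x "-R" R]] by (simp add: shift_def)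
  qed
  have int: "(1 / h) *\<^sub>R integral {x..x+h} (orbit (dist_of f) \<phi>)
      = integral {-R..R} (\<lambda>t. \<phi> t *\<^sub>C ((1 / h) *\<^sub>R integral {x + t..x + t + h} f))"
    and inti: "(\<lambda>t. \<phi> t *\<^sub>C ((1 / h) *\<^sub>R integral {x + t..x + t + h} f)) integrable_on {-R..R}" if h: "h > 0" for x h
  proof -
    have eq: "\<phi> t *\<^sub>C ((1 / h) *\<^sub>R integral {x + t..x + t + h} f) = (1 / h) *\<^sub>R (\<phi> t *\<^sub>C P ((x + h) + t) - \<phi> t *\<^sub>C P (x + t))" for t
      using P(2)[of "x + t" "x + t + h"] h by (simp add: scaleC.diff_right scaleC_scaleR_right add_ac flip: P(2))
    have i: "(\<lambda>t. \<phi> t *\<^sub>C P (y + t)) integrable_on {-R..R}" for y by (rule integrable_continuous_real[OF Pc])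
    have hi: "((\<lambda>t. \<phi> t *\<^sub>C ((1 / h) *\<^sub>R integral {x + t..x + t + h} f)) has_integral
        (1 / h) *\<^sub>R (orbit (dist_of P) \<phi> (x + h) - orbit (dist_of P) \<phi> x)) {-R..R}"
      unfolding eq orbP by (intro has_integral_cmul has_integral_diff integrable_integral i)
    have "integral {x..x+h} (orbit (dist_of f) \<phi>) = - integral {x..x+h} (orbit (dist_of P) (nth_deriv 1 \<phi>))"
      unfolding orb by simp
    also have "\<dots> = orbit (dist_of P) \<phi> (x + h) - orbit (dist_of P) \<phi> x"
      using orbit_integral[OF PD \<phi>, of h x] h by simp
    finally show "(1 / h) *\<^sub>R integral {x..x+h} (orbit (dist_of f) \<phi>)
      = integral {-R..R} (\<lambda>t. \<phi> t *\<^sub>C ((1 / h) *\<^sub>R integral {x + t..x + t + h} f))"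
      by (simp add: integral_unique[OF hi])
    show "(\<lambda>t. \<phi> t *\<^sub>C ((1 / h) *\<^sub>R integral {x + t..x + t + h} f)) integrable_on {-R..R}" using hi by blast
  qed
  show ?thesis
    unfolding has_ergodic_mean_iff[OF orbit_locally_bochner_integrable[OF fD \<phi>]]
  proof (intro allI impI)
    fix \<epsilon> :: real assume e: "\<epsilon> > 0"
    have l: "l1 \<phi> \<ge> 0" by (rule l1_nonneg[OF \<phi>])
    define \<eta> where "\<eta> = \<epsilon> / (l1 \<phi> + 1)"
    have \<eta>: "\<eta> > 0" using e l by (simp add: \<eta>_def)
    have "\<eta> * l1 \<phi> \<le> \<eta> * (l1 \<phi> + 1)" using \<eta> by simp
    also have "\<dots> = \<epsilon>" using l by (simp add: \<eta>_def)
    finally have \<eta>l: "\<eta> * l1 \<phi> \<le> \<epsilon>" .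
    obtain H where H: "H > 0" "\<And>h x. h \<ge> H \<Longrightarrow> norm ((1 / h) *\<^sub>R integral {x..x+h} f - m) \<le> \<eta>"
      using m[unfolded has_ergodic_mean_iff[OF f]] \<eta> by blast
    have "norm ((1 / h) *\<^sub>R integral {x..x+h} (orbit (dist_of f) \<phi>) - (LINT x|lebesgue. \<phi> x) *\<^sub>C m) \<le> \<epsilon>" if h: "h \<ge> H" for h x
    proof -
      have hp: "h > 0" using h H by simp
      show ?thesis unfolding int[OF hp]
        by (rule order_trans[OF smeared_mean_close[OF R(2) inti[OF hp] H(2)[OF h]] \<eta>l])
    qed
    then show "\<exists>H>0. \<forall>h\<ge>H. \<forall>x. norm ((1 / h) *\<^sub>R integral {x..x+h} (orbit (dist_of f) \<phi>) - (LINT x|lebesgue. \<phi> x) *\<^sub>C m) \<le> \<epsilon>"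
      using H(1) by blast
  qed
qed

lemma dist_of_ergodic:
  fixes f :: "real \<Rightarrow> 'x::complex_banach"
  assumes "f \<in> ergodic_functions"
  shows "dist_of f \<in> ergodic_distributions"
  using assms dist_of_ergodic_mean[of f]
  by (intro ergodic_distributionsI) (auto simp: ergodic_functions_def intro: dist_of_distribution)

section \<open>The extended mean\<close>

text \<open>
  A mollifier chosen once and for all for each width; width 1 defines the extended mean and widths tending to 0
  approximate a distribution by its orbits.
\<close>

definition kernel :: "real \<Rightarrow> real \<Rightarrow> complex" where
  "kernel r = (\<lambda>x. complex_of_real ((SOME \<beta>. mollifier r \<beta>) x))"

lemma kernelE:
  assumes "r > 0"
  obtains \<beta> where "mollifier r \<beta>" "kernel r = (\<lambda>x. complex_of_real (\<beta> x))"
  using someI_ex[OF mollifier_exists[OF assms]] that unfolding kernel_def by blast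

lemma mollifier_test_function:
  assumes "mollifier r \<beta>"
  shows "(\<lambda>x. complex_of_real (\<beta> x)) \<in> test_functions_on {0..r}" "(\<lambda>x. complex_of_real (\<beta> x)) \<in> test_functions"
    "(LINT x|lebesgue. complex_of_real (\<beta> x)) = 1"
proof -
  show *: "(\<lambda>x. complex_of_real (\<beta> x)) \<in> test_functions_on {0..r}" using assms by (simp add: mollifier_def)
  show "(\<lambda>x. complex_of_real (\<beta> x)) \<in> test_functions" by (rule test_functions_on_subset[OF compact_Icc *])
  show "(LINT x|lebesgue. complex_of_real (\<beta> x)) = 1"
    unfolding LINT_test_function[OF *] by (rule integral_unique[OF mollifier_integral(2)[OF assms]])
qed

lemma kernel_test_function:
  assumes "r > 0"
  shows "kernel r \<in> test_functions" "(LINT x|lebesgue. kernel r x) = 1"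
proof -
  obtain \<beta> where \<beta>: "mollifier r \<beta>" "kernel r = (\<lambda>x. complex_of_real (\<beta> x))" by (rule kernelE[OF assms])
  show "kernel r \<in> test_functions" "(LINT x|lebesgue. kernel r x) = 1"
    unfolding \<beta>(2) using mollifier_test_function(2,3)[OF \<beta>(1)] by simp_all
qed

definition extended_mean :: "((real \<Rightarrow> complex) \<Rightarrow> 'x::complex_banach) \<Rightarrow> 'x" where
  "extended_mean T = ergodic_mean (orbit T (kernel 1))"

lemma has_extended_mean:
  "T \<in> ergodic_distributions \<Longrightarrow> has_ergodic_mean (orbit T (kernel 1)) (extended_mean T)"
  unfolding extended_mean_def
  using ergodic_distributions_orbit[of T "kernel 1"] kernel_test_function(1)[of 1]
    ergodic_mean_eq[OF orbit_locally_bochner_integrable[OF ergodic_distributions_distribution]]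
  by auto

text \<open>
  The function \<open>\<phi> - c * kernel 1\<close> with \<open>c\<close> the integral of \<open>\<phi>\<close> has integral 0, hence is the derivative of a test
  function \<open>\<theta>\<close>. Means of the orbit of \<open>\<theta>'\<close> over intervals of length \<open>h\<close> are increments of the bounded orbit of \<open>\<theta>\<close>
  divided by \<open>h\<close>, so they tend to 0 uniformly.
\<close>

theorem orbit_mean_eq_extended_mean:
  fixes T :: "(real \<Rightarrow> complex) \<Rightarrow> 'x::complex_banach"
  assumes T: "T \<in> ergodic_distributions" and \<phi>: "\<phi> \<in> test_functions"
  shows "has_ergodic_mean (orbit T \<phi>) ((LINT x|lebesgue. \<phi> x) *\<^sub>C extended_mean T)"
proof -
  note TD = ergodic_distributions_distribution[OF T]
  have k1: "kernel 1 \<in> test_functions" by (rule kernel_test_function) simp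
  obtain R where R: "R > 0" "\<phi> \<in> test_functions_on {-R..R}" "kernel 1 \<in> test_functions_on {-R..R}"
    using test_functions_common_support[OF \<phi> k1] by blast
  define c where "c = (LINT x|lebesgue. \<phi> x)"
  define \<psi> where "\<psi> = (\<lambda>x. \<phi> x - c * kernel 1 x)"
  have ck: "(\<lambda>x. c * kernel 1 x) \<in> test_functions" by (rule test_functions_cmult[OF k1])
  have \<psi>R: "\<psi> \<in> test_functions_on {-R..R}"
    unfolding \<psi>_def by (intro test_functions_on_diff test_functions_on_cmult R)
  have ci: "f integrable_on {-R..R}" if "f \<in> test_functions_on {-R..R}" for f :: "real \<Rightarrow> complex"
    using smooth_continuous_on[OF test_functions_onD(1)[OF that], of "{-R..R}" 0] by (intro integrable_continuous_real) simp
  have "integral {-R..R} \<psi> = integral {-R..R} \<phi> - c * integral {-R..R} (kernel 1)"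
    unfolding \<psi>_def using ci[OF R(2)] ci[OF R(3)]
    by (simp add: Henstock_Kurzweil_Integration.integral_diff integrable_on_mult_right)
  also have "\<dots> = 0" using kernel_test_function(2)[of 1] unfolding c_def LINT_test_function[OF R(2)] LINT_test_function[OF R(3)] by simp
  finally have "integral {-R..R} \<psi> = 0" .
  then obtain \<theta> where \<theta>: "smooth \<theta>" "nth_deriv 1 \<theta> = \<psi>" "\<And>x. x \<le> -R \<Longrightarrow> \<theta> x = 0" "\<And>x. x \<ge> R \<Longrightarrow> \<theta> x = 0"
    using test_functions_antiderivative[OF \<psi>R] R(1) by auto
  have "\<theta> \<in> test_functions_on {-R..R}" using \<theta>(1,3,4) by (auto simp: test_functions_on_def not_le)
  then have \<theta>t: "\<theta> \<in> test_functions" by (rule test_functions_on_subset[OF compact_Icc])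
  obtain B where B: "\<And>x. norm (orbit T \<theta> x) \<le> B" using ergodic_orbit_bounded[OF T \<theta>t] by blast
  have \<psi>t: "\<psi> \<in> test_functions" by (rule test_functions_on_subset[OF compact_Icc \<psi>R])
  have B0: "B \<ge> 0" using B[of 0] norm_ge_zero order_trans by blast
  have zero: "has_ergodic_mean (orbit T \<psi>) 0"
    unfolding has_ergodic_mean_iff[OF orbit_locally_bochner_integrable[OF TD \<psi>t]]
  proof (intro allI impI)
    fix \<epsilon> :: real assume e: "\<epsilon> > 0"
    (* The increments of the orbit of \<theta> are at most 2 * B. *)
    define H where "H = 2 * B / \<epsilon> + 1"
    have H: "H > 0" using e B0 by (simp add: H_def add_nonneg_pos)
    have "norm ((1 / h) *\<^sub>R integral {x..x+h} (orbit T \<psi>) - 0) \<le> \<epsilon>" if h: "h \<ge> H" for h x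
    proof -
      have hp: "h > 0" using h H by simp
      have "norm (integral {x..x+h} (orbit T \<psi>)) = norm (orbit T \<theta> x - orbit T \<theta> (x + h))"
        using orbit_integral[OF TD \<theta>t, of h x] hp \<theta>(2) by simp
      also have "\<dots> \<le> 2 * B" using B[of x] B[of "x + h"] norm_triangle_ineq4[of "orbit T \<theta> x" "orbit T \<theta> (x + h)"] by simp
      also have "\<dots> \<le> \<epsilon> * H" using e by (simp add: H_def field_simps)
      also have "\<dots> \<le> \<epsilon> * h" using e h by simp
      finally show ?thesis using hp by (simp add: field_simps)
    qed
    then show "\<exists>H>0. \<forall>h\<ge>H. \<forall>x. norm ((1 / h) *\<^sub>R integral {x..x+h} (orbit T \<psi>) - 0) \<le> \<epsilon>" using H by blast
  qed
  have "has_ergodic_mean (\<lambda>x. orbit T \<psi> x + c *\<^sub>C orbit T (kernel 1) x) (0 + c *\<^sub>C extended_mean T)"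
    by (intro has_ergodic_mean_add zero has_ergodic_mean_scaleC has_extended_mean T orbit_continuous TD \<psi>t k1
      bounded_linear.continuous_on[OF scaleC.bounded_linear_right])
  moreover have "orbit T \<psi> x + c *\<^sub>C orbit T (kernel 1) x = orbit T \<phi> x" for x
    unfolding \<psi>_def linear_on_tests_diff[OF orbit_linear[OF TD] \<phi> ck] linear_on_tests_cmult[OF orbit_linear[OF TD] k1] by simp
  ultimately show ?thesis by (simp add: c_def)
qed

lemma LINT_reflect:
  assumes "\<phi> \<in> test_functions"
  shows "(LINT x|lebesgue. \<phi> (- x)) = (LINT x|lebesgue. \<phi> x)"
proof -
  obtain R where R: "\<phi> \<in> test_functions_on {-R..R}" by (metis assms test_functions_supportE)
  have "(\<lambda>x. \<phi> (- x)) \<in> test_functions_on {-R..R}" using test_functions_on_reflect[OF R] by simp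
  then show ?thesis
    using Henstock_Kurzweil_Integration.integral_reflect_real[where a="-R" and b=R and f=\<phi>]
    by (simp add: LINT_test_function[OF R] LINT_test_function)
qed

lemma dist_conv_mean:
  fixes T :: "(real \<Rightarrow> complex) \<Rightarrow> 'x::complex_banach"
  assumes T: "T \<in> ergodic_distributions" and \<phi>: "\<phi> \<in> test_functions"
  shows "ergodic_mean (dist_conv T \<phi>) = (LINT x|lebesgue. \<phi> x) *\<^sub>C extended_mean T"
proof -
  note \<phi>' = test_functions_reflect[OF \<phi>]
  show ?thesis
    unfolding dist_conv_eq_orbit LINT_reflect[OF \<phi>, symmetric]
    by (rule ergodic_mean_eq[OF orbit_locally_bochner_integrable[OF ergodic_distributions_distribution[OF T] \<phi>'] orbit_mean_eq_extended_mean[OF T \<phi>']])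
qed

lemma extended_mean_eqI:
  assumes "T \<in> distributions" "has_ergodic_mean (orbit T (kernel 1)) m"
  shows "extended_mean T = m"
  unfolding extended_mean_def
  by (rule ergodic_mean_eq[OF orbit_locally_bochner_integrable assms(2)]) (use assms kernel_test_function in auto)

lemma extended_mean_translate:
  fixes T :: "(real \<Rightarrow> complex) \<Rightarrow> 'x::complex_banach"
  assumes T: "T \<in> ergodic_distributions"
  shows "extended_mean (translate a T) = extended_mean T"
proof -
  have k1: "kernel 1 \<in> test_functions" by (rule kernel_test_function) simp
  have eq: "orbit (translate a T) (kernel 1) = (\<lambda>x. orbit T (kernel 1) (x + a))"
    using test_functions_shift[OF k1] by (simp add: orbit_def translate_def on_tests_def fun_eq_iff) (simp add: shift_def algebra_simps)
  have "continuous_on UNIV (\<lambda>x. orbit T (kernel 1) (x + a))"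
    by (intro continuous_on_compose2[OF orbit_continuous[OF ergodic_distributions_distribution[OF T] k1, of UNIV]] continuous_intros) auto
  then show ?thesis
    unfolding extended_mean_def[of "translate a T"] eq
    by (intro ergodic_mean_eq locally_bochner_integrable_continuous has_ergodic_mean_translate has_extended_mean T)
qed

lemma ergodic_L1_bound:
  fixes T :: "(real \<Rightarrow> complex) \<Rightarrow> 'x::complex_banach"
  assumes "T \<in> ergodic_distributions"
  shows "\<exists>k C. C \<ge> 0 \<and> (\<forall>\<psi>\<in>test_functions. norm (T \<psi>) \<le> C * sobolev_norm k \<psi>)"
  by (rule L1_order_bound[OF ergodic_distributions_distribution[OF assms]]) (rule ergodic_orbit_bounded[OF assms])

lemma mollify_test_function:
  assumes "mollifier r \<beta>" "\<phi> \<in> test_functions"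
  shows "mollify \<beta> r \<phi> \<in> test_functions"
  unfolding mollify_def using assms
  by (intro superposition_in_test_functions) (auto simp: mollifier_def intro: continuous_intros)

text \<open>
  By the L1 bound the error is at most a constant times a Sobolev norm of \<open>\<phi> - mollify \<beta> r \<phi>\<close>, which is of size \<open>r\<close> uniformly
  on sets bounded in all these norms; averaging does not increase it.
\<close>

lemma mollification_uniformly_close:
  fixes T :: "(real \<Rightarrow> complex) \<Rightarrow> 'x::complex_banach"
  assumes T: "T \<in> ergodic_distributions" and U: "DL1_bounded U" and e: "\<epsilon> > 0"
  shows "\<exists>r0>0. \<forall>r \<beta>. 0 < r \<and> r \<le> r0 \<and> mollifier r \<beta> \<longrightarrow> (\<forall>\<phi>\<in>U. norm (T (\<lambda>x. \<phi> x - mollify \<beta> r \<phi> x)) \<le> \<epsilon> \<and>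
     (\<forall>h>0. norm (T (back_average h (\<lambda>x. \<phi> x - mollify \<beta> r \<phi> x))) \<le> \<epsilon>))"
proof -
  obtain k C where C: "C \<ge> 0" "\<And>\<psi>. \<psi> \<in> test_functions \<Longrightarrow> norm (T \<psi>) \<le> C * sobolev_norm k \<psi>"
    using ergodic_L1_bound[OF T] by blast
  obtain M where M: "M > 0" "\<And>\<psi>. \<psi> \<in> U \<Longrightarrow> sobolev_norm (Suc k) \<psi> \<le> M" using DL1_bounded_sobolev_norm[OF U] by blast
  define r0 where "r0 = \<epsilon> / ((C + 1) * M)"
  have D: "(C + 1) * M > 0" using C M by simp
  have r0: "r0 > 0" "C * (r0 * M) \<le> \<epsilon>"
  proof -
    show "r0 > 0" unfolding r0_def by (rule divide_pos_pos[OF e D])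
    then have "C * (r0 * M) \<le> (C + 1) * (r0 * M)" using M by (intro mult_right_mono) auto
    also have "\<dots> = r0 * ((C + 1) * M)" by simp
    also have "\<dots> = \<epsilon>" unfolding r0_def using D by (metis less_irrefl nonzero_eq_divide_eq)
    finally show "C * (r0 * M) \<le> \<epsilon>" .
  qed
  show ?thesis
  proof (intro exI[of _ r0] conjI allI impI ballI r0(1))
    fix r \<beta> \<phi> assume r: "0 < r \<and> r \<le> r0 \<and> mollifier r \<beta>" and \<phi>U: "\<phi> \<in> U"
    then have \<phi>: "\<phi> \<in> test_functions" using U by (auto simp: DL1_bounded_def)
    define \<zeta> where "\<zeta> = (\<lambda>x. \<phi> x - mollify \<beta> r \<phi> x)"
    have \<zeta>: "\<zeta> \<in> test_functions"
      unfolding \<zeta>_def using r by (intro test_functions_diff \<phi> mollify_test_function) auto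
    have "sobolev_norm k \<zeta> \<le> r * sobolev_norm (Suc k) \<phi>"
      unfolding \<zeta>_def by (rule sobolev_norm_mollify[OF _ \<phi>]) (use r in auto)
    also have "\<dots> \<le> r0 * M" using r M \<phi>U sobolev_norm_nonneg[OF \<phi>] by (intro mult_mono) auto
    finally have s: "sobolev_norm k \<zeta> \<le> r0 * M" .
    have bound: "norm (T \<psi>) \<le> \<epsilon>" if "\<psi> \<in> test_functions" "sobolev_norm k \<psi> \<le> r0 * M" for \<psi>
      by (rule order_trans[OF C(2)[OF that(1)] order_trans[OF mult_left_mono[OF that(2) C(1)] r0(2)]])
    show "norm (T (\<lambda>x. \<phi> x - mollify \<beta> r \<phi> x)) \<le> \<epsilon>" using bound[OF \<zeta> s] by (simp add: \<zeta>_def)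
    fix h :: real assume "h > 0"
    then have "norm (T (back_average h \<zeta>)) \<le> \<epsilon>"
      by (intro bound back_average_test_function \<zeta> order_trans[OF sobolev_norm_back_average[OF \<zeta>] s])
    then show "norm (T (back_average h (\<lambda>x. \<phi> x - mollify \<beta> r \<phi> x))) \<le> \<epsilon>" by (simp add: \<zeta>_def)
  qed
qed

lemma mollified_value:
  fixes T :: "(real \<Rightarrow> complex) \<Rightarrow> 'x::complex_banach"
  assumes T: "T \<in> distributions" and \<beta>: "mollifier r \<beta>" and r: "r > 0" and \<phi>: "\<phi> \<in> test_functions_on {-R..R}" and R: "R > 0"
  shows "((\<lambda>s. \<phi> s *\<^sub>C orbit T (\<lambda>x. complex_of_real (\<beta> x)) s) has_integral T (mollify \<beta> r \<phi>)) {-R..R}"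
proof -
  have c: "continuous_on UNIV \<phi>" using smooth_continuous_on[OF test_functions_onD(1)[OF \<phi>], of UNIV 0] by simp
  have "superposition \<phi> (-R) R (\<lambda>x. complex_of_real (\<beta> x)) = mollify \<beta> r \<phi>"
    unfolding mollify_def by (rule superposition_commute[OF mollifier_test_function(1)[OF \<beta>] \<phi>])
  then show ?thesis
    using distribution_superposition[OF T c mollifier_test_function(2)[OF \<beta>], of "-R" R] R by (simp add: orbit_def)
qed

lemma DL1_dual_limitI:
  assumes l: "l \<in> ergodic_distributions" and f: "\<forall>\<^sub>F h in G. f h \<in> ergodic_distributions"
    and close: "\<And>U \<epsilon>. DL1_bounded U \<Longrightarrow> \<epsilon> > 0 \<Longrightarrow> \<forall>\<^sub>F h in G. \<forall>\<phi>\<in>U. norm (f h \<phi> - l \<phi>) \<le> \<epsilon>"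
  shows "limitin DL1_dual_topology f l G"
  unfolding limitin_def
proof (intro conjI allI impI)
  show "l \<in> topspace DL1_dual_topology" using l by (simp add: DL1_dual_topology_def)
  fix W assume "openin DL1_dual_topology W \<and> l \<in> W"
  then have W: "openin DL1_dual_topology W" and lW: "l \<in> W" by auto
  obtain F \<epsilon> where e: "\<epsilon> > 0" and F: "finite F" "F \<subseteq> {\<lambda>T. SUP \<phi>\<in>U. ennreal (norm (T \<phi>)) | U. DL1_bounded U}"
    and sub: "{g \<in> ergodic_distributions. \<forall>p\<in>F. p (\<lambda>x. g x - l x) < ennreal \<epsilon>} \<subseteq> W"
    using openin_seminorm_topologyD[OF W[unfolded DL1_dual_topology_def] lW] by blast
  have "\<forall>\<^sub>F h in G. p (\<lambda>x. f h x - l x) < ennreal \<epsilon>" if "p \<in> F" for p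
  proof -
    obtain U where p: "p = (\<lambda>T. SUP \<phi>\<in>U. ennreal (norm (T \<phi>)))" and U: "DL1_bounded U" using F(2) \<open>p \<in> F\<close> by blast
    from close[OF U, of "\<epsilon> / 2"] e have "\<forall>\<^sub>F h in G. \<forall>\<phi>\<in>U. norm (f h \<phi> - l \<phi>) \<le> \<epsilon> / 2" by simp
    then show ?thesis
    proof (rule eventually_mono)
      fix h assume h: "\<forall>\<phi>\<in>U. norm (f h \<phi> - l \<phi>) \<le> \<epsilon> / 2"
      have "p (\<lambda>x. f h x - l x) \<le> ennreal (\<epsilon> / 2)" unfolding p using h by (intro SUP_least ennreal_leI) auto
      also have "\<dots> < ennreal \<epsilon>" using e by (intro ennreal_lessI) auto
      finally show "p (\<lambda>x. f h x - l x) < ennreal \<epsilon>" .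
    qed
  qed
  then have "\<forall>\<^sub>F h in G. \<forall>p\<in>F. p (\<lambda>x. f h x - l x) < ennreal \<epsilon>" by (intro eventually_ball_finite[OF F(1)]) blast
  with f show "\<forall>\<^sub>F h in G. f h \<in> W" by eventually_elim (use sub in blast)
qed

text \<open>
  All translates of the fixed kernel form one set that is bounded in the L1 sense. The seminorm of this set
  dominates the orbit of the kernel uniformly, hence its ergodic mean.
\<close>

lemma extended_mean_continuous:
  "continuous_map DL1_dual_topology euclidean (extended_mean :: ((real \<Rightarrow> complex) \<Rightarrow> 'x::complex_banach) \<Rightarrow> 'x)"
  unfolding continuous_map_def
proof (intro conjI allI impI)
  fix W :: "'x set" assume W: "openin euclidean W"
  have k1: "kernel 1 \<in> test_functions" by (rule kernel_test_function) simp
  (* The orbit of T at kernel 1 lists exactly the values of T on this set. *)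
  define U where "U = range (\<lambda>x. shift (- x) (kernel 1))"
  have U: "DL1_bounded U"
    unfolding DL1_bounded_def
  proof (intro conjI allI)
    show "U \<subseteq> test_functions" unfolding U_def using test_functions_shift[OF k1] by blast
    fix j
    have "(\<integral>\<^sup>+x. norm (nth_deriv j \<phi> x) \<partial>lebesgue) \<le> ennreal (l1 (nth_deriv j (kernel 1)))" if "\<phi> \<in> U" for \<phi>
    proof -
      obtain x where \<phi>: "\<phi> = shift (- x) (kernel 1)" using \<open>\<phi> \<in> U\<close> by (auto simp: U_def)
      show ?thesis
        unfolding \<phi> smooth_shift(2)[OF test_functions_smooth[OF k1]]
        by (simp add: nn_integral_eq_l1 test_functions_shift test_functions_nth_deriv k1 l1_shift)
    qed
    then have "(SUP \<phi>\<in>U. \<integral>\<^sup>+x. norm (nth_deriv j \<phi> x) \<partial>lebesgue) \<le> ennreal (l1 (nth_deriv j (kernel 1)))"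
      by (rule SUP_least)
    also have "\<dots> < \<infinity>" by simp
    finally show "(SUP \<phi>\<in>U. \<integral>\<^sup>+x. norm (nth_deriv j \<phi> x) \<partial>lebesgue) < \<infinity>" .
  qed
  show "openin DL1_dual_topology {T \<in> topspace DL1_dual_topology. extended_mean T \<in> W}"
    unfolding DL1_dual_topology_def openin_seminorm_topology topspace_seminorm_topology
  proof (intro conjI ballI)
    fix f :: "(real \<Rightarrow> complex) \<Rightarrow> 'x" assume f: "f \<in> {T \<in> ergodic_distributions. extended_mean T \<in> W}"
    obtain e where e: "e > 0" "\<And>y. dist y (extended_mean f) < e \<Longrightarrow> y \<in> W"
      using f W by (auto simp: open_openin[symmetric] open_dist)
    show "\<exists>F \<epsilon>. 0 < \<epsilon> \<and> finite F \<and> F \<subseteq> {\<lambda>T. SUP \<phi>\<in>U. ennreal (norm (T \<phi>)) | U. DL1_bounded U} \<and>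
       {g \<in> ergodic_distributions. \<forall>p\<in>F. p (\<lambda>x. g x - f x) < ennreal \<epsilon>} \<subseteq> {T \<in> ergodic_distributions. extended_mean T \<in> W}"
    proof (intro exI conjI)
      show "{\<lambda>T. SUP \<phi>\<in>U. ennreal (norm (T \<phi>))} \<subseteq> {\<lambda>T. SUP \<phi>\<in>U. ennreal (norm (T \<phi> :: 'x)) | U. DL1_bounded U}" using U by blast
      show "{g \<in> ergodic_distributions. \<forall>p\<in>{\<lambda>T. SUP \<phi>\<in>U. ennreal (norm (T \<phi>))}. p (\<lambda>x. g x - f x) < ennreal (e / 2)}
         \<subseteq> {T \<in> ergodic_distributions. extended_mean T \<in> W}"
      proof safe
        fix g :: "(real \<Rightarrow> complex) \<Rightarrow> 'x" assume g: "g \<in> ergodic_distributions"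
          and lt: "\<forall>p\<in>{\<lambda>T. SUP \<phi>\<in>U. ennreal (norm (T \<phi>))}. p (\<lambda>x. g x - f x) < ennreal (e / 2)"
        have "norm (orbit g (kernel 1) x - orbit f (kernel 1) x) \<le> e / 2" for x
        proof -
          have "ennreal (norm (g (shift (- x) (kernel 1)) - f (shift (- x) (kernel 1)))) \<le> (SUP \<phi>\<in>U. ennreal (norm (g \<phi> - f \<phi>)))"
            by (rule SUP_upper) (simp add: U_def)
          also have "\<dots> < ennreal (e / 2)" using lt by simp
          finally show ?thesis using e(1) by (simp add: orbit_def ennreal_less_iff)
        qed
        moreover have fE: "f \<in> ergodic_distributions" using f by simp
        ultimately have "norm (extended_mean g - extended_mean f) \<le> e / 2"
          by (intro ergodic_means_close[OF _ _ has_extended_mean[OF g] has_extended_mean[OF fE]] orbit_locally_bochner_integrable k1)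
             (auto intro: ergodic_distributions_distribution g)
        then show "extended_mean g \<in> W" using e by (intro e(2)) (simp add: dist_norm)
      qed
    qed (use e in auto)
  qed auto
qed auto

theorem continuous_linear_mean_extension_extended_mean:
  "continuous_linear_mean_extension (extended_mean :: ((real \<Rightarrow> complex) \<Rightarrow> 'x::complex_banach) \<Rightarrow> 'x)"
  unfolding continuous_linear_mean_extension_def
proof (intro conjI ballI allI extended_mean_continuous)
  have k1: "kernel 1 \<in> test_functions" "(LINT x|lebesgue. kernel 1 x) = 1" by (rule kernel_test_function; simp)+
  fix f :: "real \<Rightarrow> 'x" assume "f \<in> ergodic_functions"
  then obtain m where f: "locally_bochner_integrable f" and m: "has_ergodic_mean f m" by (auto simp: ergodic_functions_def)
  have "has_ergodic_mean (orbit (dist_of f) (kernel 1)) m"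
    using dist_of_ergodic_mean[OF f m k1(1)] k1(2) by simp
  then have "extended_mean (dist_of f) = m" by (rule extended_mean_eqI[OF dist_of_distribution[OF f]])
  then show "extended_mean (dist_of f) = ergodic_mean f" using ergodic_mean_eq[OF f m] by simp
next
  have k1: "kernel 1 \<in> test_functions" by (rule kernel_test_function) simp
  fix T :: "(real \<Rightarrow> complex) \<Rightarrow> 'x" assume T: "T \<in> ergodic_distributions"
  note TD = ergodic_distributions_distribution[OF T]
  show "extended_mean (\<lambda>\<phi>. c *\<^sub>C T \<phi>) = c *\<^sub>C extended_mean T" for c
    unfolding extended_mean_def[of "\<lambda>\<phi>. c *\<^sub>C T \<phi>"] orbit_def
    by (rule ergodic_mean_eq, rule locally_bochner_integrable_continuous)
       (use has_ergodic_mean_scaleC[OF orbit_continuous[OF TD k1] has_extended_mean[OF T], of c]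
          bounded_linear.continuous_on[OF scaleC.bounded_linear_right orbit_continuous[OF TD k1], of UNIV c] in \<open>simp_all add: orbit_def\<close>)
  fix S :: "(real \<Rightarrow> complex) \<Rightarrow> 'x" assume S: "S \<in> ergodic_distributions"
  note SD = ergodic_distributions_distribution[OF S]
  show "extended_mean (\<lambda>\<phi>. S \<phi> + T \<phi>) = extended_mean S + extended_mean T"
    unfolding extended_mean_def[of "\<lambda>\<phi>. S \<phi> + T \<phi>"] orbit_def
    by (rule ergodic_mean_eq, rule locally_bochner_integrable_continuous)
       (use has_ergodic_mean_add[OF orbit_continuous[OF SD k1] orbit_continuous[OF TD k1] has_extended_mean[OF S] has_extended_mean[OF T]]
          continuous_on_add[OF orbit_continuous[OF SD k1] orbit_continuous[OF TD k1], of UNIV] in \<open>simp_all add: orbit_def\<close>)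
qed

text \<open>
  The orbits of the kernels of width \<open>r\<close> are ergodic functions with mean \<open>extended_mean T\<close>, so every extension takes
  this value on the distributions they define. For \<open>r\<close> tending to 0 these distributions tend to \<open>T\<close>.
\<close>

theorem extended_mean_unique:
  fixes T :: "(real \<Rightarrow> complex) \<Rightarrow> 'x::complex_banach"
  assumes M': "continuous_linear_mean_extension M'" and T: "T \<in> ergodic_distributions"
  shows "M' T = extended_mean T"
proof -
  note TD = ergodic_distributions_distribution[OF T]
  define f where "f = (\<lambda>r. dist_of (orbit T (kernel r)))"
  have mean: "has_ergodic_mean (orbit T (kernel r)) (extended_mean T)" if "r > 0" for r
    using orbit_mean_eq_extended_mean[OF T kernel_test_function(1)[OF that]] kernel_test_function(2)[OF that] by simp
  have loc: "locally_bochner_integrable (orbit T (kernel r))" if "r > 0" for r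
    by (rule orbit_locally_bochner_integrable[OF TD kernel_test_function(1)[OF that]])
  have erg: "orbit T (kernel r) \<in> ergodic_functions" if "r > 0" for r
    using mean[OF that] loc[OF that] by (auto simp: ergodic_functions_def)
  have "limitin DL1_dual_topology f T (at_right 0)"
  proof (rule DL1_dual_limitI[OF T])
    show "\<forall>\<^sub>F r in at_right 0. f r \<in> ergodic_distributions"
      unfolding f_def eventually_at_right_field by (intro exI[of _ 1]) (auto intro: dist_of_ergodic erg)
    fix U and \<epsilon> :: real assume U: "DL1_bounded U" and e: "\<epsilon> > 0"
    obtain r0 where r0: "r0 > 0" "\<And>r \<beta> \<phi>. 0 < r \<Longrightarrow> r \<le> r0 \<Longrightarrow> mollifier r \<beta> \<Longrightarrow> \<phi> \<in> U \<Longrightarrow> norm (T (\<lambda>x. \<phi> x - mollify \<beta> r \<phi> x)) \<le> \<epsilon>"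
      using mollification_uniformly_close[OF T U e] by blast
    have "norm (f r \<phi> - T \<phi>) \<le> \<epsilon>" if r: "0 < r" "r < r0" and \<phi>U: "\<phi> \<in> U" for r \<phi>
    proof -
      have \<phi>: "\<phi> \<in> test_functions" using U \<phi>U by (auto simp: DL1_bounded_def)
      obtain \<beta> where \<beta>: "mollifier r \<beta>" "kernel r = (\<lambda>x. complex_of_real (\<beta> x))" by (rule kernelE[OF r(1)])
      obtain R where R: "R > 0" "\<phi> \<in> test_functions_on {-R..R}" by (rule test_functions_supportE[OF \<phi>])
      have "f r \<phi> = integral {-R..R} (\<lambda>t. \<phi> t *\<^sub>C orbit T (kernel r) t)"
        unfolding f_def by (rule dist_of_eq_integral(1)[OF loc[OF r(1)] R(2)])
      also have "\<dots> = T (mollify \<beta> r \<phi>)"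
        using integral_unique[OF mollified_value[OF TD \<beta>(1) r(1) R(2) R(1)]] by (simp add: \<beta>(2))
      finally have "T \<phi> - f r \<phi> = T (\<lambda>x. \<phi> x - mollify \<beta> r \<phi> x)"
        by (simp add: linear_on_tests_diff[OF distributions_linear[OF TD] \<phi> mollify_test_function[OF \<beta>(1) \<phi>]])
      then show ?thesis using r0(2)[OF r(1) _ \<beta>(1) \<phi>U] r(2) by (simp add: norm_minus_commute)
    qed
    then show "\<forall>\<^sub>F r in at_right 0. \<forall>\<phi>\<in>U. norm (f r \<phi> - T \<phi>) \<le> \<epsilon>"
      unfolding eventually_at_right_field using r0(1) by blast
  qed
  then have "limitin euclidean (M' \<circ> f) (M' T) (at_right 0)"
    using M' by (intro continuous_map_limit) (auto simp: continuous_linear_mean_extension_def)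
  then have "((M' \<circ> f) \<longlongrightarrow> M' T) (at_right 0)" by simp
  moreover have "((M' \<circ> f) \<longlongrightarrow> extended_mean T) (at_right 0)"
  proof (rule tendsto_eventually)
    have "M' (f r) = extended_mean T" if "r > 0" for r
      using M' erg[OF that] ergodic_mean_eq[OF loc[OF that] mean[OF that]]
      by (simp add: continuous_linear_mean_extension_def f_def)
    then show "\<forall>\<^sub>F r in at_right 0. (M' \<circ> f) r = extended_mean T"
      unfolding eventually_at_right_field by (intro exI[of _ 1]) auto
  qed
  ultimately show ?thesis by (rule tendsto_unique[OF trivial_limit_at_right_real])
qed

section \<open>Convergence of the averages\<close>

lemma back_average_shift: "back_average h (shift a \<phi>) = shift a (back_average h \<phi>)"
  by (simp add: back_average_def shift_def algebra_simps)

lemma superposition_add: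
  assumes "continuous_on UNIV w" "smooth \<phi>" "smooth \<psi>"
  shows "superposition w a b (\<lambda>x. \<phi> x + \<psi> x) = (\<lambda>x. superposition w a b \<phi> x + superposition w a b \<psi> x)"
proof -
  have i: "(\<lambda>s. w s * \<phi> (y - s)) integrable_on {a..b}" if "smooth \<phi>" for \<phi> y
    using integrable_continuous_real[OF continuous_on_translates[OF assms(1) that, of _ 0 y]] by simp
  show ?thesis
    unfolding superposition_def distrib_left
    by (simp add: Henstock_Kurzweil_Integration.integral_add i assms)
qed

lemma superposition_cmult: "superposition w a b (\<lambda>x. c * \<phi> x) = (\<lambda>x. c * superposition w a b \<phi> x)"
proof -
  have "(\<lambda>s. w s * (c * \<phi> (y - s))) = (\<lambda>s. c * (w s * \<phi> (y - s)))" for y by (simp add: mult_ac)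
  then show ?thesis by (simp add: superposition_def)
qed

lemma back_average_add:
  assumes "smooth \<phi>" "smooth \<psi>"
  shows "back_average h (\<lambda>x. \<phi> x + \<psi> x) = (\<lambda>x. back_average h \<phi> x + back_average h \<psi> x)"
  by (simp only: back_average_eq_superposition assms smooth_add(1) superposition_add continuous_on_const)

lemma back_average_cmult:
  assumes "smooth \<phi>"
  shows "back_average h (\<lambda>x. c * \<phi> x) = (\<lambda>x. c * back_average h \<phi> x)"
  by (simp only: back_average_eq_superposition assms smooth_cmult(1) superposition_cmult)

lemma back_average_bound:
  assumes \<phi>: "smooth \<phi>" and h: "h > 0" and B: "\<And>x. norm (\<phi> x) \<le> B"
  shows "norm (back_average h \<phi> y) \<le> B"
proof -
  have i: "(\<lambda>s. \<phi> (y - s)) integrable_on {0..h}"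
    using integrable_continuous_real[OF continuous_on_translates[of "\<lambda>_. 1" \<phi> "{0..h}" 0 y]] \<phi> by simp
  have "B \<ge> 0" using B[of 0] norm_ge_zero order_trans by blast
  then have "norm (integral {0..h} (\<lambda>s. \<phi> (y - s))) \<le> B * measure lborel {0..h}"
    using has_integral_bound_real[OF _ finite.emptyI integrable_integral[OF i]] B by simp
  then have "norm (integral {0..h} (\<lambda>s. \<phi> (y - s))) \<le> B * h" using h by simp
  then show ?thesis
    using h by (simp add: back_average_eq_superposition[OF \<phi>] superposition_def norm_mult norm_divide field_simps)
qed

lemma dist_average_eq: "\<phi> \<in> test_functions \<Longrightarrow> dist_average h S \<phi> = S (back_average h \<phi>)"
  by (simp add: dist_average_def on_tests_def)

lemma dist_average_distribution:
  fixes S :: "(real \<Rightarrow> complex) \<Rightarrow> 'x::complex_banach"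
  assumes S: "S \<in> distributions" and h: "h > 0"
  shows "dist_average h S \<in> distributions"
proof (rule distributionsI)
  show "dist_average h S \<phi> = 0" if "\<phi> \<notin> test_functions" for \<phi> using that by (simp add: dist_average_def on_tests_def)
  note lin = distributions_linear[OF S]
  show "linear_on_tests (dist_average h S)"
    unfolding linear_on_tests_def
    by (auto simp: dist_average_eq test_functions_add test_functions_cmult back_average_add back_average_cmult test_functions_smooth
        linear_on_tests_add[OF lin] linear_on_tests_cmult[OF lin] back_average_test_function)
  fix R :: real
  obtain k C where C: "order_bound S {-R+0..R+h} k C" using distributions_order_bound[OF S compact_Icc] by blast
  have "order_bound (dist_average h S) {-R..R} k C"
    unfolding order_bound_def
  proof (intro ballI allI impI)
    fix \<phi> B assume \<phi>: "\<phi> \<in> test_functions_on {-R..R}" and B: "\<forall>j\<le>k. \<forall>x. norm (nth_deriv j \<phi> x) \<le> B"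
    have sm: "smooth \<phi>" by (rule test_functions_onD(1)[OF \<phi>])
    have "norm (S (back_average h \<phi>)) \<le> C * B"
    proof (rule order_boundD[OF C])
      show "back_average h \<phi> \<in> test_functions_on {-R+0..R+h}"
        unfolding back_average_eq_superposition[OF sm] by (rule superposition_test_function[OF continuous_on_const \<phi>])
      show "norm (nth_deriv j (back_average h \<phi>) x) \<le> B" if "j \<le> k" for j x
        unfolding nth_deriv_back_average[OF sm]
        by (rule back_average_bound[OF smooth_nth_deriv[OF sm] h]) (use B that in blast)
    qed
    then show "norm (dist_average h S \<phi>) \<le> C * B"
      by (simp add: dist_average_eq[OF test_functions_on_subset[OF compact_Icc \<phi>]])
  qed
  then show "\<exists>k C. order_bound (dist_average h S) {-R..R} k C" by blast
qed

lemma orbit_dist_average: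
  assumes "\<phi> \<in> test_functions"
  shows "orbit (dist_average h S) \<phi> = orbit S (back_average h \<phi>)"
  using assms by (simp add: orbit_def dist_average_eq test_functions_shift back_average_shift)

lemma dist_average_ergodic:
  fixes S :: "(real \<Rightarrow> complex) \<Rightarrow> 'x::complex_banach"
  assumes S: "S \<in> ergodic_distributions" and h: "h > 0"
  shows "dist_average h S \<in> ergodic_distributions"
proof (rule ergodic_distributionsI[OF dist_average_distribution[OF ergodic_distributions_distribution[OF S] h]])
  fix \<phi> assume \<phi>: "\<phi> \<in> test_functions"
  show "\<exists>m. has_ergodic_mean (orbit (dist_average h S) \<phi>) m"
    unfolding orbit_dist_average[OF \<phi>] by (rule ergodic_distributions_orbit[OF S back_average_test_function[OF \<phi>]])
qed

lemma orbit_back_average: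
  fixes S :: "(real \<Rightarrow> complex) \<Rightarrow> 'x::complex_banach"
  assumes S: "S \<in> distributions" and \<phi>: "\<phi> \<in> test_functions" and h: "h > 0"
  shows "orbit S (back_average h \<phi>) x = (1 / h) *\<^sub>R integral {x..x+h} (orbit S \<phi>)"
proof -
  have sh: "shift (- x) \<phi> \<in> test_functions" by (rule test_functions_shift[OF \<phi>])
  have "orbit S (back_average h \<phi>) x = S (superposition (\<lambda>_. complex_of_real (1 / h)) 0 h (shift (- x) \<phi>))"
    by (simp add: orbit_def back_average_shift[symmetric] back_average_eq_superposition[OF test_functions_smooth[OF sh]])
  also have "\<dots> = integral {0..h} (\<lambda>s. complex_of_real (1 / h) *\<^sub>C S (shift (- s) (shift (- x) \<phi>)))"
    by (rule integral_unique[symmetric], rule distribution_superposition[OF S continuous_on_const sh]) (use h in simp)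
  also have "\<dots> = integral {0..h} (\<lambda>s. (1 / h) *\<^sub>R orbit S \<phi> (x + s))"
    unfolding scaleC_of_real by (simp add: orbit_def shift_def algebra_simps)
  also have "\<dots> = (1 / h) *\<^sub>R integral {x..x+h} (orbit S \<phi>)"
    using integral_unique[OF has_integral_translation[of "orbit S \<phi>" x 0 h]]
      integrable_continuous_real[OF orbit_continuous[OF S \<phi>]] by simp
  finally show ?thesis .
qed

lemma const_dist_ergodic:
  fixes a :: "'x::complex_banach"
  shows "const_dist a \<in> ergodic_distributions"
proof -
  have loc: "locally_bochner_integrable (\<lambda>_::real. a)" by (rule locally_bochner_integrable_continuous) simp
  have "has_ergodic_mean (\<lambda>_. a) a"
    unfolding has_ergodic_mean_iff[OF loc] by (intro allI impI exI[of _ 1]) auto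
  then have erg: "(\<lambda>_. a) \<in> ergodic_functions" using loc by (auto simp: ergodic_functions_def)
  have "const_dist a = dist_of (\<lambda>_. a)"
  proof (rule ext)
    fix \<phi>
    show "const_dist a \<phi> = dist_of (\<lambda>_. a) \<phi>"
    proof (cases "\<phi> \<in> test_functions")
      case True
      then obtain R where R: "\<phi> \<in> test_functions_on {-R..R}" by (metis test_functions_supportE)
      have i: "\<phi> integrable_on {-R..R}"
        using smooth_continuous_on[OF test_functions_onD(1)[OF R], of "{-R..R}" 0] by (intro integrable_continuous_real) simp
      show ?thesis
        unfolding dist_of_eq_integral(1)[OF loc R]
        using integral_linear[OF i scaleC.bounded_linear_left[of a]] True
        by (simp add: const_dist_def on_tests_def LINT_test_function[OF R] o_def)
    next
      case False
      then show ?thesis by (simp add: const_dist_def dist_of_def on_tests_def)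
    qed
  qed
  then show ?thesis using dist_of_ergodic[OF erg] by simp
qed

text \<open>
  Replace \<open>\<phi>\<close> by \<open>mollify \<beta> r \<phi>\<close>, with an error that is small uniformly in \<open>\<phi> \<in> U\<close> and in the averaging length \<open>h\<close>.
  On the mollified function the average of \<open>S\<close> is the integral of \<open>\<phi> s\<close> against the mean of one fixed orbit over
  \<open>{s..s+h}\<close>. This mean converges uniformly in \<open>s\<close>, and the L1 norms of \<open>\<phi> \<in> U\<close> are bounded.
\<close>

theorem dist_average_limit:
  fixes S :: "(real \<Rightarrow> complex) \<Rightarrow> 'x::complex_banach"
  assumes S: "S \<in> ergodic_distributions"
  shows "limitin DL1_dual_topology (\<lambda>h. dist_average h S) (const_dist (extended_mean S)) at_top"
proof (rule DL1_dual_limitI[OF const_dist_ergodic])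
  note SD = ergodic_distributions_distribution[OF S]
  show "\<forall>\<^sub>F h in at_top. dist_average h S \<in> ergodic_distributions"
    using eventually_gt_at_top[of 0] by eventually_elim (rule dist_average_ergodic[OF S])
  fix U and \<epsilon> :: real assume U: "DL1_bounded U" and e: "\<epsilon> > 0"
  obtain M where M: "M > 0" "\<And>\<psi>. \<psi> \<in> U \<Longrightarrow> sobolev_norm 0 \<psi> \<le> M" using DL1_bounded_sobolev_norm[OF U] by blast
  obtain r where r: "r > 0" and close: "\<And>\<beta> \<phi> h. mollifier r \<beta> \<Longrightarrow> \<phi> \<in> U \<Longrightarrow> h > 0 \<Longrightarrow>
      norm (S (back_average h (\<lambda>x. \<phi> x - mollify \<beta> r \<phi> x))) \<le> \<epsilon> / 2"
    using mollification_uniformly_close[OF S U, of "\<epsilon> / 2"] e by (metis half_gt_zero order_refl)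
  obtain \<beta> where \<beta>: "mollifier r \<beta>" using mollifier_exists[OF r] by blast
  define \<rho> where "\<rho> = (\<lambda>x. complex_of_real (\<beta> x))"
  have \<rho>: "\<rho> \<in> test_functions" "(LINT x|lebesgue. \<rho> x) = 1" using mollifier_test_function[OF \<beta>] by (simp_all add: \<rho>_def)
  have mean: "has_ergodic_mean (orbit S \<rho>) (extended_mean S)"
    using orbit_mean_eq_extended_mean[OF S \<rho>(1)] \<rho>(2) by simp
  have "\<epsilon> / (2 * M) > 0" using e M by simp
  then obtain H where H: "H > 0" "\<And>h x. h \<ge> H \<Longrightarrow> norm ((1 / h) *\<^sub>R integral {x..x+h} (orbit S \<rho>) - extended_mean S) \<le> \<epsilon> / (2 * M)"
    using mean[unfolded has_ergodic_mean_iff[OF orbit_locally_bochner_integrable[OF SD \<rho>(1)]]] by blast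
  have "norm (dist_average h S \<phi> - const_dist (extended_mean S) \<phi>) \<le> \<epsilon>" if h: "h \<ge> H" and \<phi>U: "\<phi> \<in> U" for h \<phi>
  proof -
    have hp: "h > 0" using h H by simp
    note SA = dist_average_distribution[OF SD hp]
    have \<phi>: "\<phi> \<in> test_functions" using U \<phi>U by (auto simp: DL1_bounded_def)
    obtain R where R: "R > 0" "\<phi> \<in> test_functions_on {-R..R}" by (rule test_functions_supportE[OF \<phi>])
    have m\<phi>: "mollify \<beta> r \<phi> \<in> test_functions" by (rule mollify_test_function[OF \<beta> \<phi>])
    have "orbit (dist_average h S) \<rho> s = (1 / h) *\<^sub>R integral {s..s+h} (orbit S \<rho>)" for s
      unfolding orbit_dist_average[OF \<rho>(1)] by (rule orbit_back_average[OF SD \<rho>(1) hp])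
    then have hi: "((\<lambda>s. \<phi> s *\<^sub>C ((1 / h) *\<^sub>R integral {s..s+h} (orbit S \<rho>))) has_integral dist_average h S (mollify \<beta> r \<phi>)) {-R..R}"
      using mollified_value[OF SA \<beta> r R(2) R(1)] by (simp add: \<rho>_def)
    have "norm (dist_average h S (mollify \<beta> r \<phi>) - (LINT x|lebesgue. \<phi> x) *\<^sub>C extended_mean S) \<le> \<epsilon> / (2 * M) * l1 \<phi>"
      using smeared_mean_close[OF R(2) has_integral_integrable[OF hi] H(2)[OF h]] by (simp only: integral_unique[OF hi])
    also have "\<dots> \<le> \<epsilon> / (2 * M) * M" using M(2)[OF \<phi>U] e M(1) by (intro mult_left_mono) (auto simp: sobolev_norm_def)
    also have "\<dots> = \<epsilon> / 2" using M(1) by simp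
    finally have 1: "norm (dist_average h S (mollify \<beta> r \<phi>) - const_dist (extended_mean S) \<phi>) \<le> \<epsilon> / 2"
      using \<phi> by (simp add: const_dist_def on_tests_def)
    have "dist_average h S \<phi> - dist_average h S (mollify \<beta> r \<phi>) = dist_average h S (\<lambda>x. \<phi> x - mollify \<beta> r \<phi> x)"
      by (simp add: linear_on_tests_diff[OF distributions_linear[OF SA] \<phi> m\<phi>])
    also have "\<dots> = S (back_average h (\<lambda>x. \<phi> x - mollify \<beta> r \<phi> x))"
      by (rule dist_average_eq[OF test_functions_diff[OF \<phi> m\<phi>]])
    finally have 2: "norm (dist_average h S \<phi> - dist_average h S (mollify \<beta> r \<phi>)) \<le> \<epsilon> / 2"
      using close[OF \<beta> \<phi>U hp] by simp
    show ?thesis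
      using 1 2 norm_triangle_ineq[of "dist_average h S \<phi> - dist_average h S (mollify \<beta> r \<phi>)"
        "dist_average h S (mollify \<beta> r \<phi>) - const_dist (extended_mean S) \<phi>"] by simp
  qed
  then show "\<forall>\<^sub>F h in at_top. \<forall>\<phi>\<in>U. norm (dist_average h S \<phi> - const_dist (extended_mean S) \<phi>) \<le> \<epsilon>"
    unfolding eventually_at_top_linorder by blast
qed

theorem proposition8p4:
  shows "\<exists>M :: ((real \<Rightarrow> complex) \<Rightarrow> 'x::complex_banach) \<Rightarrow> 'x.
    continuous_linear_mean_extension M \<and>
    (\<forall>M'. continuous_linear_mean_extension M' \<longrightarrow> (\<forall>T\<in>ergodic_distributions. M' T = M T)) \<and>
    (\<forall>T\<in>ergodic_distributions. \<forall>a. M (translate a T) = M T) \<and>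
    (\<forall>T\<in>ergodic_distributions. \<forall>\<phi>\<in>test_functions.
       ergodic_mean (dist_conv T \<phi>) = (LINT x|lebesgue. \<phi> x) *\<^sub>C M T) \<and>
    (\<forall>S\<in>ergodic_distributions.
       limitin DL1_dual_topology (\<lambda>h. dist_average h S) (const_dist (M S)) at_top)"
  by (intro exI[of _ extended_mean] conjI allI impI ballI
      continuous_linear_mean_extension_extended_mean extended_mean_unique extended_mean_translate
      dist_conv_mean dist_average_limit)

end
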